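(* Let $T>0$, $d\ge 1$, let $q$ and $u_0$ be distributions on $\mathbb{R}^d$ with $q\ge 0$ (meaning that all regularisations $q_\varepsilon$ considered are non-negative functions). Assume that the regularisations $q_\varepsilon=q\ast\psi_\varepsilon$ and $u_{0,\varepsilon}=u_0\ast\psi_\varepsilon$ satisfy: there exist $N,N_0\in\mathbb{N}_0$ and constants $C,C_0>0$ such that $$\Vert u_{0,\varepsilon}\Vert_{H^1}\le C_0\,\omega(\varepsilon)^{-N_0},\qquad \Vert q_\varepsilon\Vert_{L^\infty}\le C\,\omega(\varepsilon)^{-N}\qquad\text{for all }\varepsilon\in(0,1].$$ Then the Cauchy problem $$\partial_t u(t,x)-\Delta u(t,x)+q(x)u(t,x)=0,\quad (t,x)\in(0,T)\times\mathbb{R}^d,\qquad u(0,x)=u_0(x),$$ has a very weak solution.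
   Context: Regularisation: $\psi$ is a Friedrichs mollifier, i.e. $\psi\in C_0^\infty(\mathbb{R}^d)$, $\psi\ge 0$, $\int\psi=1$; $\omega(\varepsilon)$, $\varepsilon\in(0,1]$, is a positive function with $\omega(\varepsilon)\to 0$ as $\varepsilon\to 0$; and $\psi_\varepsilon(x)=\omega(\varepsilon)^{-d}\psi(x/\omega(\varepsilon))$. Moderateness: for a Banach space $X$, a net $(f_\varepsilon)_{\varepsilon\in(0,1]}$ in $X$ is $X$-moderate if there exist $N\in\mathbb{N}_0$ and $c>0$ with $\Vert f_\varepsilon\Vert_X\le c\,\omega(\varepsilon)^{-N}$ for all $\varepsilon\in(0,1]$. "$C$-moderate" means $C([0,T];H^1(\mathbb{R}^d))$-moderate. Very weak solution: a net $(u_\varepsilon)_\varepsilon$ is a very weak solution to the Cauchy problem if there exist an $L^\infty$-moderate regularisation $(q_\varepsilon)_\varepsilon$ of $q$ (with $q_\varepsilon\ge0$) and an $H^1$-moderate regularisation $(u_{0,\varepsilon})_\varepsilon$ of $u_0$ such that, for all $\varepsilon\in(0,1]$, $u_\varepsilon$ solves $\partial_t u_\varepsilon-\Delta u_\varepsilon+q_\varepsilon u_\varepsilon=0$ on $(0,T)\times\mathbb{R}^d$ with $u_\varepsilon(0,\cdot)=u_{0,\varepsilon}$, and the net $(u_\varepsilon)_\varepsilon$ is $C$-moderate.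
   Formalization: The scale ω is additionally assumed bounded above on (0,1]; without this, powers of 1/ω are not comparable where ω is large, and for d ≥ 3 there are q and u₀ satisfying the bounds whose solution net is not C-moderate. *)

theory Defs
  imports "HOL-Analysis.Analysis" "HOL-Probability.Essential_Supremum"
begin

text \<open>The space \<open>\<real>\<^sup>d\<close> is rendered by a type of class \<open>euclidean_space\<close> (so \<open>d = DIM('a) \<ge> 1\<close>), and
  space-time by the product type \<open>real \<times> 'a\<close>, which is again of that class.  Elements of function
  spaces are represented by Borel functions; equality in these spaces is equality almost everywhere.
  Functions and distributions are complex valued.\<close>

subsection \<open>Test functions and distributions\<close>

definition dir_deriv :: "'a::euclidean_space \<Rightarrow> ('a \<Rightarrow> 'b::real_normed_vector) \<Rightarrow> 'a \<Rightarrow> 'b"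
  where "dir_deriv v f x = frechet_derivative f (at x) v"

abbreviation iter_deriv :: "'a::euclidean_space list \<Rightarrow> ('a \<Rightarrow> 'b::real_normed_vector) \<Rightarrow> 'a \<Rightarrow> 'b"
  where "iter_deriv vs f \<equiv> foldr dir_deriv vs f"

definition smooth :: "('a::euclidean_space \<Rightarrow> 'b::real_normed_vector) \<Rightarrow> bool"
  where "smooth f \<longleftrightarrow> (\<forall>vs. set vs \<subseteq> Basis \<longrightarrow> (\<forall>x. iter_deriv vs f differentiable (at x)))"

definition supp :: "('a::euclidean_space \<Rightarrow> 'b::real_normed_vector) \<Rightarrow> 'a set"
  where "supp f = closure {x. f x \<noteq> 0}"

definition test_functions :: "'a::euclidean_space set \<Rightarrow> ('a \<Rightarrow> 'b::real_normed_vector) set"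
  where "test_functions \<Omega> = {\<phi>. smooth \<phi> \<and> compact (supp \<phi>) \<and> supp \<phi> \<subseteq> \<Omega>}"

text \<open>Lists of basis vectors play the role of multi-indices.  The sum below repeats each mixed
  partial derivative once per ordering, which gives an equivalent seminorm.\<close>

definition test_seminorm :: "nat \<Rightarrow> ('a::euclidean_space \<Rightarrow> complex) \<Rightarrow> real"
  where "test_seminorm m \<phi> =
    (\<Sum>vs | set vs \<subseteq> Basis \<and> length vs \<le> m. SUP x. norm (iter_deriv vs \<phi> x))"

definition distribution :: "(('a::euclidean_space \<Rightarrow> complex) \<Rightarrow> complex) \<Rightarrow> bool"
  where "distribution F \<longleftrightarrow>
    (\<forall>\<phi>\<in>test_functions UNIV. \<forall>\<eta>\<in>test_functions UNIV. F (\<lambda>x. \<phi> x + \<eta> x) = F \<phi> + F \<eta>) \<and>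
    (\<forall>c. \<forall>\<phi>\<in>test_functions UNIV. F (\<lambda>x. c * \<phi> x) = c * F \<phi>) \<and>
    (\<forall>K. compact K \<longrightarrow> (\<exists>m C. \<forall>\<phi>\<in>test_functions UNIV.
        supp \<phi> \<subseteq> K \<longrightarrow> norm (F \<phi>) \<le> C * test_seminorm m \<phi>))"

definition distr_deriv ::
    "'a::euclidean_space \<Rightarrow> (('a \<Rightarrow> complex) \<Rightarrow> complex) \<Rightarrow> ('a \<Rightarrow> complex) \<Rightarrow> complex"
  where "distr_deriv v F \<phi> = - F (dir_deriv v \<phi>)"

definition regular_distr :: "('a::euclidean_space \<Rightarrow> complex) \<Rightarrow> ('a \<Rightarrow> complex) \<Rightarrow> complex"
  where "regular_distr f \<phi> = (LINT x|lborel. f x * \<phi> x)"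

subsection \<open>Regularisation\<close>

definition friedrichs_mollifier :: "('a::euclidean_space \<Rightarrow> real) \<Rightarrow> bool"
  where "friedrichs_mollifier \<psi> \<longleftrightarrow>
    \<psi> \<in> test_functions UNIV \<and> (\<forall>x. 0 \<le> \<psi> x) \<and> (LINT x|lborel. \<psi> x) = 1"

definition regularising_scale :: "(real \<Rightarrow> real) \<Rightarrow> bool"
  where "regularising_scale \<omega> \<longleftrightarrow> (\<forall>\<epsilon>\<in>{0<..1}. 0 < \<omega> \<epsilon>) \<and> (\<omega> \<longlongrightarrow> 0) (at_right 0)"

definition scaled_mollifier ::
    "('a::euclidean_space \<Rightarrow> real) \<Rightarrow> (real \<Rightarrow> real) \<Rightarrow> real \<Rightarrow> 'a \<Rightarrow> real"
  where "scaled_mollifier \<psi> \<omega> \<epsilon> x = \<psi> (x /\<^sub>R \<omega> \<epsilon>) / \<omega> \<epsilon> ^ DIM('a)"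

definition distr_conv ::
    "(('a::euclidean_space \<Rightarrow> complex) \<Rightarrow> complex) \<Rightarrow> ('a \<Rightarrow> real) \<Rightarrow> 'a \<Rightarrow> complex"
  where "distr_conv F \<psi> x = F (\<lambda>y. complex_of_real (\<psi> (x - y)))"

definition is_regularisation ::
    "('a::euclidean_space \<Rightarrow> real) \<Rightarrow> (real \<Rightarrow> real) \<Rightarrow> (('a \<Rightarrow> complex) \<Rightarrow> complex) \<Rightarrow>
      (real \<Rightarrow> 'a \<Rightarrow> complex) \<Rightarrow> bool"
  where "is_regularisation \<psi> \<omega> F f \<longleftrightarrow>
    (\<forall>\<epsilon>\<in>{0<..1}. f \<epsilon> = distr_conv F (scaled_mollifier \<psi> \<omega> \<epsilon>))"

subsection \<open>Function spaces\<close>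

definition Linf_space :: "('a::euclidean_space \<Rightarrow> complex) set"
  where "Linf_space =
    {f \<in> borel_measurable lborel. esssup lborel (\<lambda>x. ereal (norm (f x))) < \<infinity>}"

definition Linf_norm :: "('a::euclidean_space \<Rightarrow> complex) \<Rightarrow> real"
  where "Linf_norm f = real_of_ereal (esssup lborel (\<lambda>x. ereal (norm (f x))))"

definition L2_space :: "('a::euclidean_space \<Rightarrow> complex) set"
  where "L2_space = {f \<in> borel_measurable lborel. integrable lborel (\<lambda>x. (norm (f x))\<^sup>2)}"

definition L2_norm :: "('a::euclidean_space \<Rightarrow> complex) \<Rightarrow> real"
  where "L2_norm f = sqrt (LINT x|lborel. (norm (f x))\<^sup>2)"

definition is_weak_deriv ::
    "'a::euclidean_space \<Rightarrow> ('a \<Rightarrow> complex) \<Rightarrow> ('a \<Rightarrow> complex) \<Rightarrow> bool"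
  where "is_weak_deriv v f g \<longleftrightarrow>
    (\<forall>\<phi>\<in>test_functions UNIV. distr_deriv v (regular_distr f) \<phi> = regular_distr g \<phi>)"

definition H1_space :: "('a::euclidean_space \<Rightarrow> complex) set"
  where "H1_space = {f \<in> L2_space. \<forall>b\<in>Basis. \<exists>g\<in>L2_space. is_weak_deriv b f g}"

text \<open>For \<open>f\<close> in \<open>H\<^sup>1\<close> the chosen function is unique up to a null set.\<close>

definition weak_deriv :: "'a::euclidean_space \<Rightarrow> ('a \<Rightarrow> complex) \<Rightarrow> 'a \<Rightarrow> complex"
  where "weak_deriv v f = (SOME g. g \<in> L2_space \<and> is_weak_deriv v f g)"

definition H1_norm :: "('a::euclidean_space \<Rightarrow> complex) \<Rightarrow> real"
  where "H1_norm f = sqrt ((L2_norm f)\<^sup>2 + (\<Sum>b\<in>Basis. (L2_norm (weak_deriv b f))\<^sup>2))"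

definition CH1_space :: "real \<Rightarrow> (real \<Rightarrow> 'a::euclidean_space \<Rightarrow> complex) set"
  where "CH1_space T = {u. (\<forall>t\<in>{0..T}. u t \<in> H1_space) \<and>
    (\<forall>t\<in>{0..T}. ((\<lambda>s. H1_norm (\<lambda>x. u s x - u t x)) \<longlongrightarrow> 0) (at t within {0..T}))}"

definition CH1_norm :: "real \<Rightarrow> (real \<Rightarrow> 'a::euclidean_space \<Rightarrow> complex) \<Rightarrow> real"
  where "CH1_norm T u = (SUP t\<in>{0..T}. H1_norm (u t))"

text \<open>A Banach space is passed as its carrier \<open>X\<close> together with its norm \<open>N\<^sub>X\<close>.\<close>

definition moderate :: "'x set \<Rightarrow> ('x \<Rightarrow> real) \<Rightarrow> (real \<Rightarrow> real) \<Rightarrow> (real \<Rightarrow> 'x) \<Rightarrow> bool"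
  where "moderate X N\<^sub>X \<omega> f \<longleftrightarrow> (\<forall>\<epsilon>\<in>{0<..1}. f \<epsilon> \<in> X) \<and>
    (\<exists>(N::nat) c. 0 < c \<and> (\<forall>\<epsilon>\<in>{0<..1}. N\<^sub>X (f \<epsilon>) \<le> c / \<omega> \<epsilon> ^ N))"

subsection \<open>The Cauchy problem\<close>

text \<open>The distribution on \<open>(0,T) \<times> \<real>\<^sup>d\<close> given by a curve of functions.  For a continuous curve in
  \<open>L\<^sup>2\<close> the inner integral is a continuous function of \<open>t\<close>, so the iterated integral
  needs no joint measurability of the chosen representatives.\<close>

definition spacetime_distr ::
    "real \<Rightarrow> (real \<Rightarrow> 'a::euclidean_space \<Rightarrow> complex) \<Rightarrow> (real \<times> 'a \<Rightarrow> complex) \<Rightarrow> complex"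
  where "spacetime_distr T u \<phi> =
    (LINT t:{0<..<T}|lborel. (LINT x|lborel. u t x * \<phi> (t, x)))"

text \<open>\<open>\<partial>\<^sub>t u - \<Delta> u + q u = 0\<close> in the sense of distributions on \<open>(0,T) \<times> \<real>\<^sup>d\<close>,
  with \<open>u(0) = u\<^sub>0\<close> as elements of \<open>H\<^sup>1\<close>.\<close>

definition solves_heat ::
    "real \<Rightarrow> ('a::euclidean_space \<Rightarrow> complex) \<Rightarrow> ('a \<Rightarrow> complex) \<Rightarrow>
      (real \<Rightarrow> 'a \<Rightarrow> complex) \<Rightarrow> bool"
  where "solves_heat T q u\<^sub>0 u \<longleftrightarrow> u \<in> CH1_space T \<and>
    (\<forall>\<phi>\<in>test_functions ({0<..<T} \<times> UNIV).
        distr_deriv (1, 0) (spacetime_distr T u) \<phi>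
        - (\<Sum>b\<in>Basis. distr_deriv (0, b) (distr_deriv (0, b) (spacetime_distr T u)) \<phi>)
        + spacetime_distr T (\<lambda>t x. q x * u t x) \<phi> = 0) \<and>
    (AE x in lborel. u 0 x = u\<^sub>0 x)"

definition very_weak_solution ::
    "('a::euclidean_space \<Rightarrow> real) \<Rightarrow> (real \<Rightarrow> real) \<Rightarrow> real \<Rightarrow>
      (('a \<Rightarrow> complex) \<Rightarrow> complex) \<Rightarrow> (('a \<Rightarrow> complex) \<Rightarrow> complex) \<Rightarrow>
      (real \<Rightarrow> real \<Rightarrow> 'a \<Rightarrow> complex) \<Rightarrow> bool"
  where "very_weak_solution \<psi> \<omega> T q u\<^sub>0 u \<longleftrightarrow> (\<exists>q\<^sub>\<epsilon> u\<^sub>0\<^sub>\<epsilon>.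
    is_regularisation \<psi> \<omega> q q\<^sub>\<epsilon> \<and> (\<forall>\<epsilon>\<in>{0<..1}. \<forall>x. q\<^sub>\<epsilon> \<epsilon> x \<in> \<real>\<^sub>\<ge>\<^sub>0) \<and>
    moderate Linf_space Linf_norm \<omega> q\<^sub>\<epsilon> \<and>
    is_regularisation \<psi> \<omega> u\<^sub>0 u\<^sub>0\<^sub>\<epsilon> \<and>
    moderate H1_space H1_norm \<omega> u\<^sub>0\<^sub>\<epsilon> \<and>
    (\<forall>\<epsilon>\<in>{0<..1}. solves_heat T (q\<^sub>\<epsilon> \<epsilon>) (u\<^sub>0\<^sub>\<epsilon> \<epsilon>) (u \<epsilon>)) \<and>
    moderate (CH1_space T) (CH1_norm T) \<omega> u)"

end

theory Submission
  imports Defs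
begin

text \<open>For a bounded potential \<open>q = s\<^sup>2 \<ge> 0\<close> the heat semigroup is contractive in the form norm
  \<open>\<parallel>u\<parallel>\<^sup>2 + \<parallel>\<nabla>u\<parallel>\<^sup>2 + \<parallel>s u\<parallel>\<^sup>2\<close>, which lies between the squared \<open>H\<^sup>1\<close> norm and \<open>1 + \<parallel>q\<parallel>\<^sub>\<infinity>\<close> times it;
  hence the solution depends only polynomially on \<open>\<parallel>q\<parallel>\<^sub>\<infinity>\<close>, which is what moderateness requires.

  The map \<open>u \<mapsto> (u, \<nabla>u, s u)\<close> identifies \<open>H\<^sup>1\<close> with a closed subspace \<open>W\<close> of an \<open>L\<^sup>2\<close> space. If \<open>P\<close> is the
  projection onto \<open>W\<close> and \<open>E (u, G, h) = (u, 0, 0)\<close>, then \<open>R = P E P\<close> is the resolvent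
  \<open>(1 - \<Delta> + q)\<inverse>\<close> on \<open>W\<close>, a positive contraction, and the heat equation becomes \<open>(R u)' = R u - u\<close>.
  With \<open>S = 1 - R\<close> it is solved as the limit of the flows of the bounded operators \<open>- (S + \<dots> + S\<^sup>n)\<close>:
  the operators \<open>R (S + \<dots> + S\<^sup>n) = S - S\<^sup>n\<^sup>+\<^sup>1\<close> converge strongly because \<open>S\<^sup>n\<close> does.\<close>

subsection \<open>A degenerate evolution equation in Hilbert space\<close>

text \<open>The obstacle is that \<open>solves_heat\<close> wants a curve continuous in H^1 for data
  merely in H^1, where u' and Delta u need not be functions in L^2. With the form norm as the norm
  of the Hilbert space, continuity in H^1 comes with continuity in that space, and the generator
  never appears: only \<open>R u\<close> has to be differentiable. For U, V in W the product R U . V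
  = E U . V is the L^2 pairing of the functions and U . V is the form, so (R U)' = R U - U says (u',
  v) = -(grad u, grad v) - (q u, v). The powers of \<open>S\<close> are handled by positivity alone,
  without spectral calculus. They tend to 0 only on the closure of the range of \<open>R\<close>;
  this range is dense in W because E is injective there: a state with u = 0 also has zero gradient.
  That fact, and the independence of \<open>H1_norm\<close> from the weak derivative chosen in its
  definition, rest on the fundamental lemma of the calculus of variations. All Hilbert spaces are
  real; a complex identity is recovered from its real part by testing with i phi as well as
  phi.\<close>

text \<open>A distance-minimising sequence is Cauchy by the parallelogram law, since the midpoint of
  two members lies in \<open>W\<close> and is no closer to \<open>x\<close> than the infimum.
  Minimality along each line through the limit gives orthogonality.\<close>

lemma orthogonal_projection_exists:
  fixes W :: "'x::{real_inner,banach} set"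
  assumes W: "subspace W" "closed W"
  obtains p where "p \<in> W" "\<And>w. w \<in> W \<Longrightarrow> (x - p) \<bullet> w = 0"
proof -
  define D where "D = (INF w\<in>W. (norm (x - w))\<^sup>2)"
  have "0 \<in> W" using W(1) by (rule subspace_0)
  have bdd: "bdd_below ((\<lambda>w. (norm (x - w))\<^sup>2) ` W)"
    by (auto intro!: bdd_belowI[of _ 0])
  have D_le: "D \<le> (norm (x - w))\<^sup>2" if "w \<in> W" for w
    unfolding D_def using bdd that by (rule cINF_lower)
  have "\<exists>w\<in>W. (norm (x - w))\<^sup>2 < D + inverse (real (Suc n))" for n
  proof -
    have "Inf ((\<lambda>w. (norm (x - w))\<^sup>2) ` W) < D + inverse (real (Suc n))"
      unfolding D_def by simp
    then show ?thesis
      using \<open>0 \<in> W\<close> bdd by (subst (asm) cINF_less_iff) auto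
  qed
  then obtain w where w: "\<And>n. w n \<in> W" and w_less: "\<And>n. (norm (x - w n))\<^sup>2 < D + inverse (real (Suc n))"
    by metis
  have parallelogram: "(norm (w m - w n))\<^sup>2 \<le> 2 * (inverse (real (Suc m)) + inverse (real (Suc n)))" for m n
  proof -
    have mid: "(1/2) *\<^sub>R (w m + w n) \<in> W"
      using W(1) w by (intro subspace_scale subspace_add)
    have "4 * D \<le> (norm (2 *\<^sub>R x - (w m + w n)))\<^sup>2"
    proof -
      have "2 *\<^sub>R x - (w m + w n) = 2 *\<^sub>R (x - (1/2) *\<^sub>R (w m + w n))"
        by (simp add: algebra_simps)
      then have "(norm (2 *\<^sub>R x - (w m + w n)))\<^sup>2 = 4 * (norm (x - (1/2) *\<^sub>R (w m + w n)))\<^sup>2"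
        by (simp add: power_mult_distrib)
      then show ?thesis using D_le[OF mid] by simp
    qed
    moreover have "(norm (w m - w n))\<^sup>2 + (norm (2 *\<^sub>R x - (w m + w n)))\<^sup>2
        = 2 * (norm (x - w m))\<^sup>2 + 2 * (norm (x - w n))\<^sup>2"
      unfolding power2_norm_eq_inner by (simp add: algebra_simps inner_commute)
    ultimately show ?thesis
      using w_less[of m] w_less[of n] by argo
  qed
  have "Cauchy w"
  proof (rule metric_CauchyI)
    fix e :: real assume "0 < e"
    then have "0 < e\<^sup>2 / 4" by simp
    then obtain N where N: "inverse (real (Suc N)) < e\<^sup>2 / 4"
      using reals_Archimedean by blast
    have "dist (w m) (w n) < e" if "N \<le> m" "N \<le> n" for m n
    proof -
      have "inverse (real (Suc m)) \<le> inverse (real (Suc N))" "inverse (real (Suc n)) \<le> inverse (real (Suc N))"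
        using that by (auto simp: field_simps)
      then have "(norm (w m - w n))\<^sup>2 < e\<^sup>2"
        using parallelogram[of m n] N by argo
      then show ?thesis using \<open>0 < e\<close>
        unfolding dist_norm by (simp add: power_less_imp_less_base)
    qed
    then show "\<exists>N. \<forall>m\<ge>N. \<forall>n\<ge>N. dist (w m) (w n) < e" by blast
  qed
  then obtain p where p: "w \<longlonglongrightarrow> p"
    by (auto simp: Cauchy_convergent_iff convergent_def)
  have "p \<in> W" using W(2) w p by (metis closed_sequentially)
  have "(norm (x - p))\<^sup>2 \<le> D"
  proof (rule LIMSEQ_le)
    show "(\<lambda>n. (norm (x - w n))\<^sup>2) \<longlonglongrightarrow> (norm (x - p))\<^sup>2" by (intro tendsto_intros p)
    show "(\<lambda>n. D + inverse (real (Suc n))) \<longlonglongrightarrow> D"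
      using tendsto_add[OF tendsto_const LIMSEQ_inverse_real_of_nat] by simp
  qed (use w_less less_imp_le in blast)
  have "(x - p) \<bullet> v = 0" if "v \<in> W" for v
  proof (cases "v = 0")
    case False
    \<comment> \<open>This \<open>s\<close> minimises |x - p - s v|^2 over the reals; with it the
      inequality below reduces to ((x - p) . v)^2 <= 0.\<close>
    define s where "s = ((x - p) \<bullet> v) / (v \<bullet> v)"
    have "p + s *\<^sub>R v \<in> W" using W(1) \<open>p \<in> W\<close> that by (intro subspace_add subspace_scale)
    from D_le[OF this] \<open>(norm (x - p))\<^sup>2 \<le> D\<close>
    have "(norm (x - p))\<^sup>2 \<le> (norm ((x - p) - s *\<^sub>R v))\<^sup>2"
      by (simp only: diff_diff_eq)
    then have "2 * s * ((x - p) \<bullet> v) \<le> s\<^sup>2 * (v \<bullet> v)"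
      unfolding power2_norm_eq_inner by (simp add: inner_diff inner_commute power2_eq_square)
    moreover have "v \<bullet> v > 0" using False by simp
    ultimately have "((x - p) \<bullet> v)\<^sup>2 \<le> 0"
      unfolding s_def by (simp add: field_simps power2_eq_square)
    then show ?thesis by simp
  qed simp
  with \<open>p \<in> W\<close> show thesis by (rule that)
qed

text \<open>The solution is the exponential series of t^k / k! A^k x, differentiated term by term.
  For T < 0 the interval is empty and any function with value \<open>x\<close> at 0 will do.\<close>

lemma linear_ode_solution_exists:
  fixes A :: "'x::banach \<Rightarrow> 'x"
  assumes A: "bounded_linear A"
  shows "\<exists>u. u 0 = x \<and> (\<forall>t\<in>{0..T}. (u has_vector_derivative A (u t)) (at t within {0..T}))"
proof (cases "0 \<le> T")
  case True
  interpret A: bounded_linear A by fact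
  obtain M where "M > 0" and M: "\<And>x. norm (A x) \<le> norm x * M"
    using A.pos_bounded by blast
  define a where "a k = (A ^^ k) x" for k
  define f where "f k t = (t ^ k / fact k) *\<^sub>R a k" for k and t :: real
  have a_Suc: "a (Suc k) = A (a k)" for k by (simp add: a_def)
  have norm_a: "norm (a k) \<le> M ^ k * norm x" for k
  proof (induction k)
    case (Suc k)
    have "norm (a (Suc k)) \<le> norm (a k) * M" unfolding a_Suc by (rule M)
    also have "\<dots> \<le> M ^ k * norm x * M" using Suc \<open>M > 0\<close> by simp
    finally show ?case by (simp add: mult_ac)
  qed (simp add: a_def)
  have norm_f: "norm (f k t) \<le> (M * T) ^ k / fact k * norm x" if "t \<in> {0..T}" for k t
  proof -
    have "norm (f k t) = t ^ k / fact k * norm (a k)" using that by (simp add: f_def)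
    also have "\<dots> \<le> T ^ k / fact k * (M ^ k * norm x)"
      using that norm_a by (intro mult_mono divide_right_mono power_mono) auto
    finally show ?thesis by (simp add: power_mult_distrib mult_ac)
  qed
  have exp_summable: "summable (\<lambda>k. (M * T) ^ k / fact k * norm x)"
    using summable_exp[of "M * T"] by (intro summable_mult2) (simp add: field_simps)
  have unif: "uniform_limit {0..T} (\<lambda>n t. \<Sum>k<n. f k t) (\<lambda>t. \<Sum>k. f k t) sequentially"
    using norm_f exp_summable by (rule Weierstrass_m_test)
  \<comment> \<open>The derivative of term k is \<open>A\<close> of term k - 1, so the first n + 1
    derivatives sum to \<open>A\<close> of the first n terms. This is why the convergence estimate
    below is proved for \<open>Suc n\<close> and shifted back at the end.\<close>
  define f' where "f' k t = (case k of 0 \<Rightarrow> 0 | Suc j \<Rightarrow> A (f j t))" for k t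
  have f_deriv: "(f k has_vector_derivative f' k t) (at t within {0..T})" for k t
  proof (cases k)
    case 0 then show ?thesis by (simp add: f_def[abs_def] f'_def)
  next
    case (Suc j)
    have "((\<lambda>t. t ^ Suc j / fact (Suc j)) has_real_derivative t ^ j / fact j) (at t within {0..T})"
      by (auto intro!: derivative_eq_intros simp: divide_simps) (cases j; simp add: algebra_simps)
    from has_vector_derivative_scaleR[OF this has_vector_derivative_const[of "a (Suc j)"]]
    show ?thesis unfolding Suc f'_def f_def[abs_def] by (simp add: A.scaleR a_Suc)
  qed
  have sum_f': "(\<Sum>k<Suc n. f' k t) = A (\<Sum>k<n. f k t)" for n t
    unfolding sum.lessThan_Suc_shift by (simp add: f'_def A.sum)
  have f_0_sums: "(\<lambda>k. f k 0) sums x"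
  proof -
    have "(\<lambda>k. f k 0) = (\<lambda>k. if k = 0 then x else 0)" by (auto simp: f_def a_def)
    then show ?thesis using sums_single[of 0 "\<lambda>_. x"] by simp
  qed
  have "\<exists>g. \<forall>t\<in>{0..T}. (\<lambda>k. f k t) sums g t \<and>
      (g has_derivative (\<lambda>h. h *\<^sub>R A (\<Sum>k. f k t))) (at t within {0..T})"
  proof (rule has_derivative_series)
    show "convex {0..T}" by simp
    show "(f k has_derivative (\<lambda>h. h *\<^sub>R f' k t)) (at t within {0..T})" for k t
      using f_deriv unfolding has_vector_derivative_def .
    show "0 \<in> {0..T}" using True by simp
    show "(\<lambda>k. f k 0) sums x" by (rule f_0_sums)
    show "\<forall>\<^sub>F n in sequentially. \<forall>t\<in>{0..T}. \<forall>h.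
        norm ((\<Sum>k<n. h *\<^sub>R f' k t) - h *\<^sub>R A (\<Sum>k. f k t)) \<le> e * norm h" if "e > 0" for e
    proof -
      from uniform_limitD[OF unif, of "e / M"] \<open>e > 0\<close> \<open>M > 0\<close>
      have "\<forall>\<^sub>F n in sequentially. \<forall>t\<in>{0..T}. dist (\<Sum>k<n. f k t) (\<Sum>k. f k t) < e / M" by simp
      then have "\<forall>\<^sub>F n in sequentially. \<forall>t\<in>{0..T}. \<forall>h.
        norm ((\<Sum>k<Suc n. h *\<^sub>R f' k t) - h *\<^sub>R A (\<Sum>k. f k t)) \<le> e * norm h"
      proof (rule eventually_mono, intro ballI allI)
        fix n t and h :: real
        assume *: "\<forall>t\<in>{0..T}. dist (\<Sum>k<n. f k t) (\<Sum>k. f k t) < e / M" and "t \<in> {0..T}"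
        have "(\<Sum>k<Suc n. h *\<^sub>R f' k t) - h *\<^sub>R A (\<Sum>k. f k t)
            = h *\<^sub>R A ((\<Sum>k<n. f k t) - (\<Sum>k. f k t))"
          unfolding scaleR_sum_right[symmetric] sum_f' A.diff by (simp add: algebra_simps)
        then have "norm ((\<Sum>k<Suc n. h *\<^sub>R f' k t) - h *\<^sub>R A (\<Sum>k. f k t))
            \<le> \<bar>h\<bar> * (norm ((\<Sum>k<n. f k t) - (\<Sum>k. f k t)) * M)"
          using M by (simp add: mult_left_mono)
        also have "\<dots> \<le> \<bar>h\<bar> * e"
          using * \<open>t \<in> {0..T}\<close> \<open>M > 0\<close>
          by (intro mult_left_mono) (auto simp: dist_norm field_simps intro: less_imp_le)
        finally show "norm ((\<Sum>k<Suc n. h *\<^sub>R f' k t) - h *\<^sub>R A (\<Sum>k. f k t)) \<le> e * norm h"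
          by (simp add: mult.commute)
      qed
      then show ?thesis by (subst (asm) eventually_sequentially_Suc)
    qed
  qed
  then obtain g where g: "\<And>t. t \<in> {0..T} \<Longrightarrow> (\<lambda>k. f k t) sums g t"
    "\<And>t. t \<in> {0..T} \<Longrightarrow> (g has_derivative (\<lambda>h. h *\<^sub>R A (\<Sum>k. f k t))) (at t within {0..T})"
    by blast
  have "g 0 = x"
    using g(1)[of 0] True f_0_sums by (auto intro: sums_unique2)
  moreover have "(g has_vector_derivative A (g t)) (at t within {0..T})" if "t \<in> {0..T}" for t
    using g[OF that] by (simp add: has_vector_derivative_def sums_iff)
  ultimately show ?thesis by blast
qed (auto intro: exI[of _ "\<lambda>_. x"])

text \<open>Formally \<open>R = (1 + A)\<inverse>\<close> for a positive self-adjoint \<open>A\<close>, so that \<open>u' = - A u\<close> reads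
  \<open>(R u)' = R u - u\<close>. The unbounded \<open>A = R\<inverse> - 1\<close> is approximated by the truncated Neumann series.\<close>

locale positive_contraction =
  fixes R :: "'x::{real_inner,banach} \<Rightarrow> 'x"
  assumes bounded_linear_R: "bounded_linear R"
    and symmetric_R: "R x \<bullet> y = x \<bullet> R y"
    and R_nonneg: "0 \<le> R x \<bullet> x"
    and R_le: "R x \<bullet> x \<le> x \<bullet> x"
begin

sublocale R: bounded_linear R by (rule bounded_linear_R)

definition S :: "'x \<Rightarrow> 'x" where "S x = x - R x"

sublocale S: bounded_linear S
  unfolding S_def[abs_def] by (intro bounded_linear_sub bounded_linear_ident bounded_linear_R)

lemma symmetric_S: "S x \<bullet> y = x \<bullet> S y"
  by (simp add: S_def inner_diff symmetric_R)

lemma S_nonneg: "0 \<le> S x \<bullet> x"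
  using R_le[of x] by (simp add: S_def inner_diff)

lemma R_S_commute: "R (S x) = S (R x)"
  by (simp add: S_def R.diff)

lemma bounded_linear_S_pow: "bounded_linear (S ^^ n)"
proof (induction n)
  case (Suc n)
  then show ?case using bounded_linear_compose[OF S.bounded_linear_axioms] by (simp add: o_def)
qed (simp add: id_def bounded_linear_ident)

lemma symmetric_S_pow: "(S ^^ n) x \<bullet> y = x \<bullet> (S ^^ n) y"
  by (induction n arbitrary: x y) (simp_all add: symmetric_S funpow_swap1)

lemma R_S_pow_commute: "R ((S ^^ n) x) = (S ^^ n) (R x)"
  by (induction n) (simp_all add: R_S_commute)

text \<open>Symmetry moves half of the factors to the other side: an even power gives |S^k x|^2, an
  odd one gives S y . y with y = S^k x.\<close>

lemma S_pow_nonneg: "0 \<le> (S ^^ n) x \<bullet> x"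
proof -
  obtain k where "n = k + k \<or> n = Suc (k + k)" by (metis add_Suc_right oddE evenE mult_2 add.commute plus_1_eq_Suc)
  then show ?thesis
  proof
    assume "n = k + k"
    then have "(S ^^ n) x \<bullet> x = (S ^^ k) x \<bullet> (S ^^ k) x"
      by (simp only: funpow_add o_apply symmetric_S_pow)
    then show ?thesis by simp
  next
    assume "n = Suc (k + k)"
    then have "n = k + Suc k" by simp
    then have "(S ^^ n) x \<bullet> x = S ((S ^^ k) x) \<bullet> (S ^^ k) x"
      by (simp only: funpow_add o_apply symmetric_S_pow[of k]) simp
    then show ?thesis by (simp add: S_nonneg)
  qed
qed

text \<open>The difference of the two sides is S^n R x . x. Halving the power as before leaves R y .
  y for even n and S R y . y for odd n.\<close>

lemma S_pow_Suc_le: "(S ^^ Suc n) x \<bullet> x \<le> (S ^^ n) x \<bullet> x"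
proof -
  \<comment> \<open>Positivity of a product of commuting positive operators normally uses a square
    root. Here R + S = 1 gives S R = R S R + S R S, a sum of two evidently positive
    operators.\<close>
  have SR_nonneg: "0 \<le> S (R y) \<bullet> y" for y
  proof -
    have "S (R y) \<bullet> y = S (R y) \<bullet> (R y + S y)" by (simp add: S_def)
    also have "\<dots> = S (R y) \<bullet> R y + R (S y) \<bullet> S y"
      by (simp add: inner_add R_S_commute)
    finally show ?thesis using S_nonneg R_nonneg by (metis add_nonneg_nonneg)
  qed
  have diff: "(S ^^ n) x \<bullet> x - (S ^^ Suc n) x \<bullet> x = (S ^^ n) (R x) \<bullet> x"
    by (simp add: S_def inner_diff flip: R_S_pow_commute)
  obtain k where "n = k + k \<or> n = k + Suc k"
    by (metis add_Suc_right oddE evenE mult_2 add.commute plus_1_eq_Suc)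
  then have "0 \<le> (S ^^ n) (R x) \<bullet> x"
  proof
    assume "n = k + k"
    then have "(S ^^ n) (R x) \<bullet> x = R ((S ^^ k) x) \<bullet> (S ^^ k) x"
      by (simp only: funpow_add o_apply symmetric_S_pow[of k] R_S_pow_commute)
    then show ?thesis by (simp add: R_nonneg)
  next
    assume "n = k + Suc k"
    then have "(S ^^ n) (R x) \<bullet> x = S (R ((S ^^ k) x)) \<bullet> (S ^^ k) x"
      by (simp only: funpow_add o_apply symmetric_S_pow[of k]) (simp add: R_S_pow_commute)
    then show ?thesis by (simp add: SR_nonneg)
  qed
  with diff show ?thesis by simp
qed

text \<open>Put a_n = S^n x . x, a decreasing nonnegative sequence. Symmetry gives |S^m x - S^n x|^2
  = a_2m - 2 a_(m+n) + a_2n, so convergence of the numbers a_n makes the vectors a Cauchy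
  sequence.\<close>

lemma convergent_S_pow: "convergent (\<lambda>n. (S ^^ n) x)"
proof -
  have "decseq (\<lambda>n. (S ^^ n) x \<bullet> x)" using S_pow_Suc_le by (intro decseq_SucI)
  \<comment> \<open>The limit is kept as a lower bound too: if a_2m and a_2n are below L + e^2 / 2
    while a_(m+n) >= L, the combination stays below e^2.\<close>
  then obtain L where L: "(\<lambda>n. (S ^^ n) x \<bullet> x) \<longlonglongrightarrow> L" "\<And>n. L \<le> (S ^^ n) x \<bullet> x"
    using S_pow_nonneg by (metis decseq_convergent)
  have "Cauchy (\<lambda>n. (S ^^ n) x)"
  proof (rule metric_CauchyI)
    fix e :: real assume "0 < e"
    then have "0 < e\<^sup>2 / 2" by simp
    with L(1) obtain N where N: "\<And>n. n \<ge> N \<Longrightarrow> \<bar>(S ^^ n) x \<bullet> x - L\<bar> < e\<^sup>2 / 2"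
      by (metis LIMSEQ_D real_norm_def)
    have "dist ((S ^^ m) x) ((S ^^ n) x) < e" if "m \<ge> N" "n \<ge> N" for m n
    proof -
      have "(norm ((S ^^ m) x - (S ^^ n) x))\<^sup>2
          = (S ^^ (m + m)) x \<bullet> x - 2 * ((S ^^ (m + n)) x \<bullet> x) + (S ^^ (n + n)) x \<bullet> x"
        unfolding power2_norm_eq_inner
        by (simp add: inner_diff funpow_add symmetric_S_pow inner_commute[of "(S ^^ n) x" "(S ^^ m) x"])
           (metis add.commute funpow_add o_apply)
      also have "\<dots> < e\<^sup>2"
        using N[of "m + m"] N[of "n + n"] L(2)[of "m + n"] that by linarith
      finally show ?thesis using \<open>0 < e\<close>
        unfolding dist_norm by (simp add: power_less_imp_less_base)
    qed
    then show "\<exists>N. \<forall>m\<ge>N. \<forall>n\<ge>N. dist ((S ^^ m) x) ((S ^^ n) x) < e" by blast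
  qed
  then show ?thesis by (simp add: Cauchy_convergent_iff)
qed

lemma norm_S_pow_le: "norm ((S ^^ n) x) \<le> norm x"
proof -
  have "(S ^^ n) x \<bullet> x \<le> x \<bullet> x" for n
    using lift_Suc_antimono_le[of "\<lambda>n. (S ^^ n) x \<bullet> x" 0 n] S_pow_Suc_le by simp
  then have "(S ^^ n) x \<bullet> (S ^^ n) x \<le> x \<bullet> x"
    using symmetric_S_pow by (metis funpow_add o_apply)
  then show ?thesis by (simp add: norm_le)
qed

text \<open>On the range, S^n R w = S^n w - S^(n+1) w is the difference of consecutive members of a
  convergent sequence. Contractivity of all S^n extends the limit to the closure.\<close>

lemma S_pow_tendsto_0:
  assumes "x \<in> closure (range R)"
  shows "(\<lambda>n. (S ^^ n) x) \<longlonglongrightarrow> 0"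
proof (rule LIMSEQ_I)
  fix e :: real assume "0 < e"
  then obtain w where w: "norm (x - R w) < e / 2"
    using assms by (metis closure_approachable dist_norm half_gt_zero norm_minus_commute rangeE)
  obtain l where "(\<lambda>n. (S ^^ n) w) \<longlonglongrightarrow> l" using convergent_S_pow by (auto simp: convergent_def)
  from tendsto_diff[OF this LIMSEQ_Suc[OF this]]
  have "(\<lambda>n. (S ^^ n) (R w)) \<longlonglongrightarrow> 0"
    by (simp add: S_def flip: R_S_pow_commute)
  then obtain N where N: "\<And>n. n \<ge> N \<Longrightarrow> norm ((S ^^ n) (R w)) < e / 2"
    using \<open>0 < e\<close> by (metis LIMSEQ_D diff_zero half_gt_zero)
  have "norm ((S ^^ n) x - 0) < e" if "n \<ge> N" for n
  proof -
    interpret Sn: bounded_linear "S ^^ n" by (rule bounded_linear_S_pow)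
    have "(S ^^ n) x = (S ^^ n) (x - R w) + (S ^^ n) (R w)" by (simp add: Sn.diff)
    then have "norm ((S ^^ n) x) \<le> norm ((S ^^ n) (x - R w)) + norm ((S ^^ n) (R w))"
      by (metis norm_triangle_ineq)
    then show ?thesis using norm_S_pow_le[of n "x - R w"] w N[OF that] by simp
  qed
  then show "\<exists>N. \<forall>n\<ge>N. norm ((S ^^ n) x - 0) < e" by blast
qed

text \<open>Since R = 1 - S, formally R^(-1) - 1 = S (1 - S)^(-1) = S + S^2 + ...; the exponents
  start at 1 because the identity has been subtracted.\<close>

definition A :: "nat \<Rightarrow> 'x \<Rightarrow> 'x" where "A n x = (\<Sum>k<n. (S ^^ Suc k) x)"

lemma bounded_linear_A: "bounded_linear (A n)"
  unfolding A_def[abs_def] by (intro bounded_linear_sum bounded_linear_S_pow)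

lemma A_nonneg: "0 \<le> A n x \<bullet> x"
  unfolding A_def inner_sum_left by (intro sum_nonneg S_pow_nonneg)

text \<open>The geometric sum telescopes. It shows that \<open>A n\<close> converges strongly on the
  range of \<open>R\<close>, although the operators themselves need not stay bounded in n.\<close>

lemma A_R: "A n (R x) = S x - (S ^^ Suc n) x"
proof -
  have "A n (R x) = (\<Sum>k<n. (S ^^ Suc k) x - (S ^^ Suc (Suc k)) x)"
    unfolding A_def by (intro sum.cong refl) (simp add: S_def R.diff flip: R_S_pow_commute)
  also have "\<dots> = S x - (S ^^ Suc n) x"
    by (subst sum_lessThan_telescope') simp
  finally show ?thesis .
qed

lemma R_A_commute: "R (A n x) = A n (R x)"
  by (simp only: A_def R.sum R_S_pow_commute)

lemma A_S_pow_commute: "(S ^^ m) (A n x) = A n ((S ^^ m) x)"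
proof -
  interpret Sm: bounded_linear "S ^^ m" by (rule bounded_linear_S_pow)
  have "(S ^^ m) ((S ^^ k) x) = (S ^^ k) ((S ^^ m) x)" for k
    by (metis add.commute funpow_add o_apply)
  then show ?thesis by (simp only: A_def Sm.sum)
qed

lemma A_A_commute: "A m (A n x) = A n (A m x)"
proof -
  interpret An: bounded_linear "A n" by (rule bounded_linear_A)
  show ?thesis by (simp only: A_def[of m] An.sum A_S_pow_commute)
qed

end

section \<open>Flows of the bounded approximations and their uniform limit\<close>

text \<open>The derivative of |z|^2 is 2 z' . z, so the mean value theorem applies. The case c = 0
  yields contractivity of a flow, the general case compares two flows.\<close>

lemma dissipative_norm_le:
  fixes z :: "real \<Rightarrow> 'x::real_inner"
  assumes z: "\<And>t. t \<in> {0..T} \<Longrightarrow> (z has_vector_derivative z' t) (at t within {0..T})"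
    and le: "\<And>t. t \<in> {0..T} \<Longrightarrow> z' t \<bullet> z t \<le> c"
    and "t \<in> {0..T}"
  shows "(norm (z t))\<^sup>2 \<le> (norm (z 0))\<^sup>2 + 2 * c * t"
proof (cases "t = 0")
  case False
  with \<open>t \<in> {0..T}\<close> have "0 < t" by simp
  have der: "((\<lambda>t. z t \<bullet> z t) has_real_derivative 2 * (z' s \<bullet> z s)) (at s within {0..t})" if "s \<in> {0..t}" for s
  proof -
    have "(z has_vector_derivative z' s) (at s within {0..t})"
      using z[of s] that \<open>t \<in> {0..T}\<close> by (auto intro: has_vector_derivative_within_subset)
    from bounded_bilinear.has_vector_derivative[OF bounded_bilinear_inner this this]
    show ?thesis
      by (simp add: has_real_derivative_iff_has_vector_derivative inner_commute)
  qed
  have "\<exists>s. 0 < s \<and> s < t \<and> z t \<bullet> z t - z 0 \<bullet> z 0 = (2 * (z' s \<bullet> z s)) * (t - 0)"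
  proof -
    have "\<exists>s\<in>{0<..<t}. z t \<bullet> z t - z 0 \<bullet> z 0 = (\<lambda>h. 2 * (z' s \<bullet> z s) * h) (t - 0)"
      using der \<open>0 < t\<close> by (intro mvt_simple) (auto simp: has_field_derivative_def)
    then show ?thesis by auto
  qed
  then obtain s where s: "0 < s" "s < t" "z t \<bullet> z t - z 0 \<bullet> z 0 = 2 * (z' s \<bullet> z s) * t" by auto
  have "z' s \<bullet> z s * t \<le> c * t" using le[of s] s \<open>t \<in> {0..T}\<close> by (intro mult_right_mono) auto
  with s(3) show ?thesis by (simp add: power2_norm_eq_inner)
qed simp

context positive_contraction
begin

lemma flow_norm_le:
  assumes "\<And>t. t \<in> {0..T} \<Longrightarrow> (z has_vector_derivative - A n (z t)) (at t within {0..T})"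
    and "t \<in> {0..T}"
  shows "norm (z t) \<le> norm (z 0)"
proof -
  have "(norm (z t))\<^sup>2 \<le> (norm (z 0))\<^sup>2 + 2 * 0 * t"
    using assms A_nonneg by (intro dissipative_norm_le[where z' = "\<lambda>t. - A n (z t)"]) auto
  then show ?thesis by simp
qed

text \<open>With d = v - w one has d' = - A_n d - (A_n - A_m) w. The first term is dissipative.
  Since \<open>A n\<close> and \<open>A m\<close> commute, (A_n - A_m) w is itself a flow of - A_m
  and never exceeds its initial norm |A_n y - A_m y|; moreover |d| <= 2 |y|. These bounds and the
  factor 2 from differentiating |d|^2 give the constant 4 T |y|.\<close>

lemma flow_difference:
  assumes v: "\<And>t. t \<in> {0..T} \<Longrightarrow> (v has_vector_derivative - A n (v t)) (at t within {0..T})"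
    and w: "\<And>t. t \<in> {0..T} \<Longrightarrow> (w has_vector_derivative - A m (w t)) (at t within {0..T})"
    and init: "v 0 = y" "w 0 = y"
    and t: "t \<in> {0..T}"
  shows "(norm (v t - w t))\<^sup>2 \<le> 4 * T * norm y * norm (A n y - A m y)"
proof -
  interpret An: bounded_linear "A n" by (rule bounded_linear_A)
  interpret Am: bounded_linear "A m" by (rule bounded_linear_A)
  have bl: "bounded_linear (\<lambda>x. A n x - A m x)"
    by (intro bounded_linear_sub bounded_linear_A)
  define \<delta> where "\<delta> = norm (A n y - A m y)"
  have nv: "norm (v s) \<le> norm y" if "s \<in> {0..T}" for s using flow_norm_le[OF v that] init by simp
  have nw: "norm (w s) \<le> norm y" if "s \<in> {0..T}" for s using flow_norm_le[OF w that] init by simp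
  have nd: "norm (A n (w s) - A m (w s)) \<le> \<delta>" if "s \<in> {0..T}" for s
  proof -
    have "((\<lambda>s. A n (w s) - A m (w s)) has_vector_derivative - A m (A n (w s) - A m (w s))) (at s within {0..T})"
      if "s \<in> {0..T}" for s
      using bounded_linear.has_vector_derivative[OF bl w[OF that]]
      by (simp add: An.neg Am.neg Am.diff A_A_commute[of m n])
    from flow_norm_le[OF this that] show ?thesis using init by (simp add: \<delta>_def)
  qed
  have "(norm (v t - w t))\<^sup>2 \<le> (norm (v 0 - w 0))\<^sup>2 + 2 * (2 * norm y * \<delta>) * t"
  proof (rule dissipative_norm_le[OF _ _ t])
    show "((\<lambda>t. v t - w t) has_vector_derivative - A n (v s) - - A m (w s)) (at s within {0..T})"
      if "s \<in> {0..T}" for s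
      using v[OF that] w[OF that] by (rule has_vector_derivative_diff)
    fix s assume s: "s \<in> {0..T}"
    have "(- A n (v s) - - A m (w s)) \<bullet> (v s - w s)
        = - (A n (v s - w s) \<bullet> (v s - w s)) - (A n (w s) - A m (w s)) \<bullet> (v s - w s)"
      by (simp add: An.diff inner_diff algebra_simps)
    also have "\<dots> \<le> norm (A n (w s) - A m (w s)) * norm (v s - w s)"
      using A_nonneg[of n "v s - w s"] norm_cauchy_schwarz[of "- (A n (w s) - A m (w s))" "v s - w s"]
      by (simp only: inner_minus_left norm_minus_cancel)
    also have "\<dots> \<le> \<delta> * (2 * norm y)"
      using nd[OF s] nv[OF s] nw[OF s] norm_triangle_ineq4[of "v s" "w s"]
      by (intro mult_mono) (auto simp: \<delta>_def)
    finally show "(- A n (v s) - - A m (w s)) \<bullet> (v s - w s) \<le> 2 * norm y * \<delta>" by (simp add: mult_ac)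
  qed
  also have "\<dots> \<le> 4 * T * norm y * \<delta>"
  proof -
    have "t * (norm y * \<delta>) \<le> T * (norm y * \<delta>)" using t by (intro mult_right_mono) (auto simp: \<delta>_def)
    then show ?thesis using init by (simp add: mult_ac)
  qed
  finally show ?thesis by (simp add: \<delta>_def)
qed

text \<open>Replace \<open>x\<close> by a nearby y = R w. By contractivity this costs at most e / 3
  in every flow at every time. For such \<open>y\<close> the difference A_n y - A_m y equals S^(m+1)
  w - S^(n+1) w, which is small because S^n w converges.\<close>

lemma uniformly_Cauchy_flow:
  assumes u: "\<And>n t. t \<in> {0..T} \<Longrightarrow> (u n has_vector_derivative - A n (u n t)) (at t within {0..T})"
    and init: "\<And>n. u n 0 = x" and x: "x \<in> closure (range R)" and "0 \<le> T"
  shows "uniformly_Cauchy_on {0..T} u"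
proof (rule uniformly_Cauchy_onI)
  fix e :: real assume "0 < e"
  then obtain w where w: "norm (x - R w) < e / 3"
    using x by (metis closure_approachable dist_norm divide_pos_pos norm_minus_commute rangeE zero_less_numeral)
  define y where "y = R w"
  have "\<exists>v. v 0 = y \<and> (\<forall>t\<in>{0..T}. (v has_vector_derivative - A n (v t)) (at t within {0..T}))" for n
    using linear_ode_solution_exists[of "\<lambda>x. - A n x" y T] bounded_linear_A bounded_linear_minus by blast
  then obtain v where v0: "\<And>n. v n 0 = y"
    and v: "\<And>n t. t \<in> {0..T} \<Longrightarrow> (v n has_vector_derivative - A n (v n t)) (at t within {0..T})"
    by metis
  have uv: "norm (u n t - v n t) < e / 3" if "t \<in> {0..T}" for n t
  proof -
    interpret An: bounded_linear "A n" by (rule bounded_linear_A)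
    have "((\<lambda>t. u n t - v n t) has_vector_derivative - A n (u n s - v n s)) (at s within {0..T})"
      if "s \<in> {0..T}" for s
      using has_vector_derivative_diff[OF u[OF that] v[OF that]] by (simp add: An.diff)
    from flow_norm_le[OF this that] w show ?thesis by (simp add: init v0 y_def)
  qed
  define c where "c = 4 * T * norm y"
  have "0 \<le> c" using \<open>0 \<le> T\<close> by (simp add: c_def)
  have "Cauchy (\<lambda>n. (S ^^ Suc n) w)"
    using convergent_S_pow[of w] convergent_Suc_iff[of "\<lambda>n. (S ^^ n) w"]
    unfolding Cauchy_convergent_iff by (simp only:)
  \<comment> \<open>The denominator is c + 1 because c = 4 T |y| vanishes when T = 0 or y =
    0.\<close>
  moreover have "0 < (e / 3)\<^sup>2 / (c + 1)" using \<open>0 < e\<close> \<open>0 \<le> c\<close> by simp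
  ultimately obtain N where N: "\<And>m n. m \<ge> N \<Longrightarrow> n \<ge> N \<Longrightarrow>
      norm ((S ^^ Suc m) w - (S ^^ Suc n) w) < (e / 3)\<^sup>2 / (c + 1)"
    by (metis CauchyD)
  have vv: "norm (v n t - v m t) < e / 3" if "n \<ge> N" "m \<ge> N" "t \<in> {0..T}" for n m t
  proof -
    have "A n y - A m y = (S ^^ Suc m) w - (S ^^ Suc n) w"
      unfolding y_def A_R by simp
    then have "norm (A n y - A m y) < (e / 3)\<^sup>2 / (c + 1)" using N that by simp
    then have less: "(c + 1) * norm (A n y - A m y) < (e / 3)\<^sup>2"
      using \<open>0 \<le> c\<close> by (simp add: field_simps)
    have "(norm (v n t - v m t))\<^sup>2 \<le> c * norm (A n y - A m y)"
      unfolding c_def by (rule flow_difference[OF v v v0 v0 that(3)])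
    also have "\<dots> \<le> (c + 1) * norm (A n y - A m y)" by (simp add: mult_right_mono)
    also note less
    finally show ?thesis using \<open>0 < e\<close> by (intro power_less_imp_less_base[of _ 2 "e / 3"]) auto
  qed
  have "dist (u n t) (u m t) < e" if "t \<in> {0..T}" "n \<ge> N" "m \<ge> N" for t n m
  proof -
    have "u n t - u m t = (u n t - v n t) + (v n t - v m t) - (u m t - v m t)" by simp
    then have "norm (u n t - u m t) \<le> norm (u n t - v n t) + norm (v n t - v m t) + norm (u m t - v m t)"
      using norm_triangle_ineq4[of "(u n t - v n t) + (v n t - v m t)" "u m t - v m t"]
        norm_triangle_ineq[of "u n t - v n t" "v n t - v m t"] by simp
    then show ?thesis
      using uv[OF that(1), of n] uv[OF that(1), of m] vv[OF that(2,3,1)] unfolding dist_norm by linarith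
  qed
  then show "\<exists>N. \<forall>t\<in>{0..T}. \<forall>m\<ge>N. \<forall>n\<ge>N. dist (u m t) (u n t) < e" by blast
qed

text \<open>The approximate flows converge uniformly, but their derivatives need not. After applying
  \<open>R\<close> the derivative is - R A_n u_n = S^(n+1) u_n - S u_n, which does converge
  uniformly, to - S u = R u - u. Hence the equation is obtained for \<open>R u\<close> only.\<close>

lemma degenerate_evolution:
  assumes x: "x \<in> closure (range R)" and "0 \<le> T"
  obtains u where "continuous_on {0..T} u" "u 0 = x"
    "\<And>t. t \<in> {0..T} \<Longrightarrow> norm (u t) \<le> norm x"
    "\<And>t. t \<in> {0..T} \<Longrightarrow> ((\<lambda>s. R (u s)) has_vector_derivative R (u t) - u t) (at t within {0..T})"
proof -
  have "\<exists>v. v 0 = x \<and> (\<forall>t\<in>{0..T}. (v has_vector_derivative - A n (v t)) (at t within {0..T}))" for n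
    using linear_ode_solution_exists[of "\<lambda>x. - A n x" x T] bounded_linear_A bounded_linear_minus by blast
  then obtain u where init: "\<And>n. u n 0 = x"
    and u: "\<And>n t. t \<in> {0..T} \<Longrightarrow> (u n has_vector_derivative - A n (u n t)) (at t within {0..T})"
    by metis
  have "uniformly_Cauchy_on {0..T} u" using u init assms by (rule uniformly_Cauchy_flow)
  then obtain U where U: "uniform_limit {0..T} u U sequentially"
    using uniformly_convergent_eq_Cauchy[of "{0..T}" u] by (auto simp: uniformly_convergent_on_def)
  have lim: "(\<lambda>n. u n t) \<longlonglongrightarrow> U t" if "t \<in> {0..T}" for t
    using tendsto_uniform_limitI[OF U that] .
  have cont: "continuous_on {0..T} U"
  proof (rule uniform_limit_theorem[OF _ U])
    show "\<forall>\<^sub>F n in sequentially. continuous_on {0..T} (u n)"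
      using u by (intro always_eventually allI continuous_on_vector_derivative)
  qed simp
  have "U 0 = x" using lim[of 0] \<open>0 \<le> T\<close> init by (simp add: LIMSEQ_const_iff)
  have norm_le: "norm (U t) \<le> norm x" if "t \<in> {0..T}" for t
    using flow_norm_le[OF u that] init
    by (intro LIMSEQ_le_const2[OF tendsto_norm[OF lim[OF that]]]) auto
  have uniform: "uniform_limit {0..T} (\<lambda>n t. - R (A n (u n t))) (\<lambda>t. R (U t) - U t) sequentially"
  proof -
    \<comment> \<open>S^(n+1) commutes with \<open>A n\<close>, so S^(n+1) u_n is again a flow of -
      A_n. Contractivity bounds it at all times by its initial value S^(n+1) x, which tends to
      0.\<close>
    have 1: "uniform_limit {0..T} (\<lambda>n t. (S ^^ Suc n) (u n t)) (\<lambda>t. 0) sequentially"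
    proof (rule uniform_limitI)
      fix e :: real assume "0 < e"
      have "(\<lambda>n. (S ^^ Suc n) x) \<longlonglongrightarrow> 0" using S_pow_tendsto_0[OF x] by (rule LIMSEQ_Suc)
      then have "\<forall>\<^sub>F n in sequentially. norm ((S ^^ Suc n) x) < e"
        using order_tendstoD(2)[OF tendsto_norm_zero \<open>0 < e\<close>] by blast
      then show "\<forall>\<^sub>F n in sequentially. \<forall>t\<in>{0..T}. dist ((S ^^ Suc n) (u n t)) 0 < e"
      proof (rule eventually_mono, intro ballI)
        fix n t assume *: "norm ((S ^^ Suc n) x) < e" and t: "t \<in> {0..T}"
        interpret An: bounded_linear "A n" by (rule bounded_linear_A)
        interpret Sn: bounded_linear "S ^^ Suc n" by (rule bounded_linear_S_pow)
        have "((\<lambda>s. (S ^^ Suc n) (u n s)) has_vector_derivative - A n ((S ^^ Suc n) (u n s))) (at s within {0..T})"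
          if "s \<in> {0..T}" for s
          using bounded_linear.has_vector_derivative[OF Sn.bounded_linear_axioms u[OF that]]
          by (simp only: Sn.neg A_S_pow_commute)
        from flow_norm_le[OF this t] * show "dist ((S ^^ Suc n) (u n t)) 0 < e"
          by (simp add: init)
      qed
    qed
    have "uniform_limit {0..T} (\<lambda>n t. S (u n t)) (\<lambda>t. S (U t)) sequentially"
      by (rule S.uniform_limit[OF U])
    from uniform_limit_minus[OF 1 this] show ?thesis
      unfolding R_A_commute A_R by (simp add: S_def)
  qed
  have "\<exists>g. \<forall>t\<in>{0..T}. (\<lambda>n. R (u n t)) \<longlonglongrightarrow> g t \<and>
      (g has_derivative (\<lambda>h. h *\<^sub>R (R (U t) - U t))) (at t within {0..T})"
  proof (rule has_derivative_sequence)
    show "((\<lambda>t. R (u n t)) has_derivative (\<lambda>h. h *\<^sub>R (- R (A n (u n t))))) (at t within {0..T})"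
      if "t \<in> {0..T}" for n t
      using bounded_linear.has_vector_derivative[OF bounded_linear_R u[OF that]]
      by (simp add: has_vector_derivative_def R.neg)
    show "0 \<in> {0..T}" using \<open>0 \<le> T\<close> by simp
    show "(\<lambda>n. R (u n 0)) \<longlonglongrightarrow> R x" by (simp add: init)
    fix e :: real assume "0 < e"
    from uniform_limitD[OF uniform this]
    show "\<forall>\<^sub>F n in sequentially. \<forall>t\<in>{0..T}. \<forall>h.
        norm (h *\<^sub>R (- R (A n (u n t))) - h *\<^sub>R (R (U t) - U t)) \<le> e * norm h"
    proof (rule eventually_mono, intro ballI allI)
      fix n t and h :: real
      assume *: "\<forall>t\<in>{0..T}. dist (- R (A n (u n t))) (R (U t) - U t) < e" and t: "t \<in> {0..T}"
      have "norm (h *\<^sub>R (- R (A n (u n t))) - h *\<^sub>R (R (U t) - U t))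
          = \<bar>h\<bar> * norm (- R (A n (u n t)) - (R (U t) - U t))"
        by (simp only: norm_scaleR flip: scaleR_diff_right)
      also have "\<dots> \<le> \<bar>h\<bar> * e"
        using * t by (intro mult_left_mono) (auto simp only: dist_norm intro: less_imp_le)
      finally show "norm (h *\<^sub>R (- R (A n (u n t))) - h *\<^sub>R (R (U t) - U t)) \<le> e * norm h"
        by (simp add: mult.commute)
    qed
  qed simp
  then obtain g where g: "\<And>t. t \<in> {0..T} \<Longrightarrow> (\<lambda>n. R (u n t)) \<longlonglongrightarrow> g t"
    "\<And>t. t \<in> {0..T} \<Longrightarrow> (g has_vector_derivative R (U t) - U t) (at t within {0..T})"
    unfolding has_vector_derivative_def by blast
  have g_eq: "g t = R (U t)" if "t \<in> {0..T}" for t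
    using g(1)[OF that] R.tendsto[OF lim[OF that]] by (rule LIMSEQ_unique)
  have "((\<lambda>s. R (U s)) has_vector_derivative R (U t) - U t) (at t within {0..T})" if "t \<in> {0..T}" for t
    by (rule has_vector_derivative_transform[OF that _ g(2)[OF that]]) (simp add: g_eq)
  with cont \<open>U 0 = x\<close> norm_le show thesis by (rule that)
qed

end

section \<open>Passage to a closed subspace: the evolution in weak form\<close>

lemma subspace_closure:
  fixes V :: "'x::real_normed_vector set"
  assumes V: "subspace V"
  shows "subspace (closure V)"
  unfolding subspace_def
proof (intro conjI ballI allI)
  show "0 \<in> closure V" using subspace_0[OF V] closure_subset[of V] by (rule rev_subsetD)
next
  fix y z assume "y \<in> closure V" "z \<in> closure V"
  then obtain Y Z where YZ: "\<And>n. Y n \<in> V" "Y \<longlonglongrightarrow> y" "\<And>n. Z n \<in> V" "Z \<longlonglongrightarrow> z"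
    unfolding closure_sequential by fast
  show "y + z \<in> closure V"
    unfolding closure_sequential
    by (intro exI[of _ "\<lambda>n. Y n + Z n"] conjI allI subspace_add[OF V] tendsto_add YZ)
next
  fix c :: real and y assume "y \<in> closure V"
  then obtain Y where Y: "\<And>n. Y n \<in> V" "Y \<longlonglongrightarrow> y"
    unfolding closure_sequential by fast
  show "c *\<^sub>R y \<in> closure V"
    unfolding closure_sequential
    by (intro exI[of _ "\<lambda>n. c *\<^sub>R Y n"] conjI allI subspace_scale[OF V] tendsto_scaleR tendsto_const Y)
qed

text \<open>Read E u . v as the L^2 pairing and u . v as the bilinear form: the conclusion is then a
  parabolic equation tested against all v in \<open>W\<close>. With P the orthogonal projection, R =
  P E P satisfies R x . v = E x . v for x and v in \<open>W\<close>, so it represents the pairing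
  inside the space normed by the form.\<close>

lemma constrained_evolution:
  fixes W :: "'x::{real_inner,banach} set" and E :: "'x \<Rightarrow> 'x"
  assumes W: "subspace W" "closed W"
    and E: "bounded_linear E" "\<And>x y. E x \<bullet> y = x \<bullet> E y" "\<And>x. 0 \<le> E x \<bullet> x" "\<And>x. E x \<bullet> x \<le> x \<bullet> x"
    and E_inj: "\<And>x. x \<in> W \<Longrightarrow> E x \<bullet> x = 0 \<Longrightarrow> x = 0"
    and x: "x \<in> W" and "0 \<le> T"
  obtains u where "continuous_on {0..T} u" "u 0 = x" "\<And>t. u t \<in> W"
    "\<And>t. t \<in> {0..T} \<Longrightarrow> norm (u t) \<le> norm x"
    "\<And>t v. t \<in> {0..T} \<Longrightarrow> v \<in> W \<Longrightarrow>
       ((\<lambda>s. E (u s) \<bullet> v) has_real_derivative E (u t) \<bullet> v - u t \<bullet> v) (at t within {0..T})"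
proof -
  have "\<forall>x. \<exists>p. p \<in> W \<and> (\<forall>w\<in>W. (x - p) \<bullet> w = 0)"
    using orthogonal_projection_exists[OF W] by metis
  then obtain P where P: "\<And>x. P x \<in> W" and orth: "\<And>x w. w \<in> W \<Longrightarrow> (x - P x) \<bullet> w = 0"
    by metis
  have P_unique: "P x = p" if "p \<in> W" "\<And>w. w \<in> W \<Longrightarrow> (x - p) \<bullet> w = 0" for x p
  proof -
    have d: "P x - p \<in> W" using W(1) P that(1) by (rule subspace_diff)
    from orth[OF d] that(2)[OF d] have "(P x - p) \<bullet> (P x - p) = 0"
      by (smt (verit) inner_diff_left)
    then show ?thesis by simp
  qed
  have P_W: "P x = x" if "x \<in> W" for x using that by (intro P_unique) auto
  have P_inner: "P x \<bullet> w = x \<bullet> w" if "w \<in> W" for x w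
    using orth[OF that, of x] by (simp add: inner_diff)
  have P_sym: "P x \<bullet> y = x \<bullet> P y" for x y
    using P_inner[OF P, of x y] P_inner[OF P, of y x] by (simp add: inner_commute)
  have P_norm: "norm (P x) \<le> norm x" for x
  proof -
    have "(norm (P x))\<^sup>2 = x \<bullet> P x" using P_inner[OF P, of x x] by (simp add: power2_norm_eq_inner)
    also have "\<dots> \<le> norm x * norm (P x)" by (rule norm_cauchy_schwarz)
    finally show ?thesis
      by (cases "P x = 0") (auto simp: power2_eq_square)
  qed
  have P_bl: "bounded_linear P"
  proof (rule bounded_linear_intro)
    show "P (x + y) = P x + P y" for x y
      using W(1) P P_inner by (intro P_unique subspace_add) (simp_all add: inner_diff inner_add)
    show "P (r *\<^sub>R x) = r *\<^sub>R P x" for r x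
      using W(1) P P_inner by (intro P_unique subspace_scale) (simp_all add: inner_diff)
    show "norm (P x) \<le> norm x * 1" for x using P_norm by simp
  qed
  interpret P: bounded_linear P by (rule P_bl)
  define R where "R x = P (E (P x))" for x
  interpret R: positive_contraction R
  proof (rule positive_contraction.intro)
    show "bounded_linear R" unfolding R_def[abs_def]
      by (intro bounded_linear_compose[OF P_bl] bounded_linear_compose[OF E(1)] P_bl)
    show "R x \<bullet> y = x \<bullet> R y" for x y unfolding R_def by (metis P_sym E(2))
    show "0 \<le> R x \<bullet> x" for x unfolding R_def by (metis P_sym E(3))
    show "R x \<bullet> x \<le> x \<bullet> x" for x
    proof -
      have "R x \<bullet> x = E (P x) \<bullet> P x" unfolding R_def by (rule P_sym)
      also have "\<dots> \<le> P x \<bullet> P x" by (rule E(4))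
      also have "\<dots> \<le> x \<bullet> x" using P_norm[of x] by (simp add: norm_le)
      finally show ?thesis .
    qed
  qed
  have R_W: "R x \<in> W" for x by (simp add: R_def P)
  have cl: "subspace (closure (range R))"
  proof -
    have sub: "subspace (range R)"
      using linear_subspace_image[OF R.R.linear subspace_UNIV] .
    then show ?thesis by (rule subspace_closure)
  qed
  \<comment> \<open>Let p be the projection of \<open>x\<close> onto the closed range. The rest d =
    x - p lies in \<open>W\<close> and is orthogonal to R d, so E d . d = R d . d = 0, and
    injectivity of E on \<open>W\<close> gives d = 0.\<close>
  have "x \<in> closure (range R)"
  proof -
    obtain p where p: "p \<in> closure (range R)" "\<And>w. w \<in> closure (range R) \<Longrightarrow> (x - p) \<bullet> w = 0"
      using orthogonal_projection_exists[OF cl closed_closure] by metis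
    have "closure (range R) \<subseteq> W" using R_W W(2) by (intro closure_minimal) auto
    then have d: "x - p \<in> W" using W(1) x p(1) by (intro subspace_diff) auto
    have "R (x - p) \<in> closure (range R)" using closure_subset by (rule subsetD) (rule rangeI)
    from p(2)[OF this] have "E (x - p) \<bullet> (x - p) = 0"
      unfolding R_def P_W[OF d] using P_inner[OF d, of "E (x - p)"] by (simp add: inner_commute)
    from E_inj[OF d this] p(1) show ?thesis by simp
  qed
  then obtain u where u: "continuous_on {0..T} u" "u 0 = x" "\<And>t. t \<in> {0..T} \<Longrightarrow> norm (u t) \<le> norm x"
    "\<And>t. t \<in> {0..T} \<Longrightarrow> ((\<lambda>s. R (u s)) has_vector_derivative R (u t) - u t) (at t within {0..T})"
    using R.degenerate_evolution \<open>0 \<le> T\<close> by metis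
  show thesis
  \<comment> \<open>Membership in \<open>W\<close> is demanded at all times, also outside [0,T]
    where nothing is known of \<open>u\<close>. Projecting secures it and preserves the rest: P does
    not increase norms, R depends on P u only, and P u . v = u . v for v in
    \<open>W\<close>.\<close>
  proof (rule that[of "\<lambda>t. P (u t)"])
    show "continuous_on {0..T} (\<lambda>t. P (u t))" by (intro P.continuous_on u)
    show "P (u 0) = x" using u(2) P_W x by simp
    show "P (u t) \<in> W" for t by (rule P)
    show "norm (P (u t)) \<le> norm x" if "t \<in> {0..T}" for t
      using P_norm u(3)[OF that] by (rule order_trans)
    fix t v assume "t \<in> {0..T}" "v \<in> W"
    from bounded_linear.has_vector_derivative[OF bounded_linear_inner_left u(4)[OF this(1)], of v]
    show "((\<lambda>s. E (P (u s)) \<bullet> v) has_real_derivative E (P (u t)) \<bullet> v - P (u t) \<bullet> v) (at t within {0..T})"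
      unfolding has_real_derivative_iff_has_vector_derivative R_def
      using P_inner[OF \<open>v \<in> W\<close>] by (simp add: inner_diff)
  qed
qed

subsection \<open>The Hilbert space of square integrable functions\<close>

text \<open>The values may lie in any Euclidean space, whereas \<open>L2_space\<close> is confined
  to complex values; states combine a function, its gradient and a multiple of it into one
  vector-valued function.\<close>

definition square_integrable :: "('a::euclidean_space \<Rightarrow> 'b::euclidean_space) \<Rightarrow> bool"
  where "square_integrable f \<longleftrightarrow> f \<in> borel_measurable borel \<and> integrable lborel (\<lambda>x. (norm (f x))\<^sup>2)"

lemma square_integrable_measurable [measurable_dest]: "square_integrable f \<Longrightarrow> f \<in> borel_measurable borel"
  by (simp add: square_integrable_def)

lemma square_integrable_dominated:
  fixes f :: "'a::euclidean_space \<Rightarrow> 'b::euclidean_space"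
  assumes "f \<in> borel_measurable borel" "integrable lborel g" "AE x in lborel. (norm (f x))\<^sup>2 \<le> g x"
  shows "square_integrable f"
  unfolding square_integrable_def
proof (intro conjI)
  show "integrable lborel (\<lambda>x. (norm (f x))\<^sup>2)"
    using assms by (intro Bochner_Integration.integrable_bound[OF assms(2)]) (auto elim!: eventually_mono)
qed fact

lemma square_integrable_add:
  fixes f g :: "'a::euclidean_space \<Rightarrow> 'b::euclidean_space"
  assumes "square_integrable f" "square_integrable g"
  shows "square_integrable (\<lambda>x. f x + g x)"
proof (rule square_integrable_dominated)
  show "(\<lambda>x. f x + g x) \<in> borel_measurable borel"
    using assms by (auto simp: square_integrable_def)
  show "integrable lborel (\<lambda>x. 2 * (norm (f x))\<^sup>2 + 2 * (norm (g x))\<^sup>2)"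
    using assms by (auto simp: square_integrable_def)
  have "(norm (a + b))\<^sup>2 \<le> 2 * (norm a)\<^sup>2 + 2 * (norm b)\<^sup>2" for a b :: 'b
  proof -
    have "(norm (a + b))\<^sup>2 + (norm (a - b))\<^sup>2 = 2 * (norm a)\<^sup>2 + 2 * (norm b)\<^sup>2"
      by (simp add: power2_norm_eq_inner algebra_simps inner_commute)
    then show ?thesis by (smt (verit) zero_le_power2)
  qed
  then show "AE x in lborel. (norm (f x + g x))\<^sup>2 \<le> 2 * (norm (f x))\<^sup>2 + 2 * (norm (g x))\<^sup>2" by simp
qed

lemma square_integrable_scaleR: "square_integrable f \<Longrightarrow> square_integrable (\<lambda>x. c *\<^sub>R f x)"
  by (auto simp: square_integrable_def power_mult_distrib)

lemma square_integrable_minus: "square_integrable f \<Longrightarrow> square_integrable (\<lambda>x. - f x)"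
  by (auto simp: square_integrable_def)

lemma square_integrable_diff:
  "square_integrable f \<Longrightarrow> square_integrable g \<Longrightarrow> square_integrable (\<lambda>x. f x - g x)"
  using square_integrable_add[OF _ square_integrable_minus, of f g] by simp

lemma square_integrable_zero: "square_integrable (\<lambda>x. 0)"
  by (simp add: square_integrable_def)

lemma square_integrable_inner:
  assumes "square_integrable f" "square_integrable g"
  shows "integrable lborel (\<lambda>x. f x \<bullet> g x)"
proof (rule Bochner_Integration.integrable_bound)
  show "integrable lborel (\<lambda>x. (norm (f x))\<^sup>2 + (norm (g x))\<^sup>2)"
    using assms by (auto simp: square_integrable_def)
  show "(\<lambda>x. f x \<bullet> g x) \<in> borel_measurable lborel"
    using assms by (auto simp: square_integrable_def)
  have "\<bar>a \<bullet> b\<bar> \<le> (norm a)\<^sup>2 + (norm b)\<^sup>2" for a b :: 'b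
    using Cauchy_Schwarz_ineq2[of a b] sum_squares_bound[of "norm a" "norm b"]
      mult_nonneg_nonneg[OF norm_ge_zero[of a] norm_ge_zero[of b]] by linarith
  then show "AE x in lborel. norm (f x \<bullet> g x) \<le> norm ((norm (f x))\<^sup>2 + (norm (g x))\<^sup>2)" by simp
qed

definition l2_rel :: "('a::euclidean_space \<Rightarrow> 'b::euclidean_space) \<Rightarrow> ('a \<Rightarrow> 'b) \<Rightarrow> bool"
  where "l2_rel f g \<longleftrightarrow> square_integrable f \<and> square_integrable g \<and> (AE x in lborel. f x = g x)"

\<comment> \<open>As a type, L^2 can be an instance of \<open>real_inner\<close> and
  \<open>banach\<close>, as the abstract evolution theorem requires. The relation is partial so that
  only square integrable functions represent classes. For complex values the inner product is the
  real part of the Hermitian one.\<close>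
quotient_type (overloaded) ('a, 'b) l2 =
  "'a::euclidean_space \<Rightarrow> 'b::euclidean_space" / partial: l2_rel
proof (rule part_equivpI)
  show "\<exists>f::'a \<Rightarrow> 'b. l2_rel f f"
    using square_integrable_zero by (auto simp: l2_rel_def)
  show "symp (l2_rel :: ('a \<Rightarrow> 'b) \<Rightarrow> _)"
    by (rule sympI) (auto simp: l2_rel_def elim: eventually_mono)
  show "transp (l2_rel :: ('a \<Rightarrow> 'b) \<Rightarrow> _)"
    by (rule transpI) (auto simp: l2_rel_def)
qed

lemma square_integrable_rep [simp]: "square_integrable (rep_l2 F)"
  using Quotient3_rel_rep[OF Quotient3_l2, of F F] by (simp add: l2_rel_def)

lemma abs_rep_l2 [simp]: "abs_l2 (rep_l2 F) = F"
  by (rule Quotient3_abs_rep[OF Quotient3_l2])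

lemma rep_abs_l2: "square_integrable f \<Longrightarrow> AE x in lborel. rep_l2 (abs_l2 f) x = f x"
  using rep_abs_rsp_left[OF Quotient3_l2, of f f] by (simp add: l2_rel_def)

instantiation l2 :: (euclidean_space, euclidean_space) real_inner
begin

lift_definition zero_l2 :: "('a, 'b) l2" is "\<lambda>x. 0"
  by (simp add: l2_rel_def square_integrable_zero)

lift_definition plus_l2 :: "('a, 'b) l2 \<Rightarrow> ('a, 'b) l2 \<Rightarrow> ('a, 'b) l2" is "\<lambda>f g x. f x + g x"
  by (auto simp: l2_rel_def intro: square_integrable_add)

lift_definition minus_l2 :: "('a, 'b) l2 \<Rightarrow> ('a, 'b) l2 \<Rightarrow> ('a, 'b) l2" is "\<lambda>f g x. f x - g x"
  by (auto simp: l2_rel_def intro: square_integrable_diff)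

lift_definition uminus_l2 :: "('a, 'b) l2 \<Rightarrow> ('a, 'b) l2" is "\<lambda>f x. - f x"
  by (auto simp: l2_rel_def intro: square_integrable_minus)

lift_definition scaleR_l2 :: "real \<Rightarrow> ('a, 'b) l2 \<Rightarrow> ('a, 'b) l2" is "\<lambda>c f x. c *\<^sub>R f x"
  by (auto simp: l2_rel_def intro: square_integrable_scaleR)

lift_definition inner_l2 :: "('a, 'b) l2 \<Rightarrow> ('a, 'b) l2 \<Rightarrow> real" is "\<lambda>f g. LINT x|lborel. f x \<bullet> g x"
  by (rule Bochner_Integration.integral_cong_AE) (auto simp: l2_rel_def square_integrable_def)

definition norm_l2 :: "('a, 'b) l2 \<Rightarrow> real" where "norm_l2 F = sqrt (F \<bullet> F)"
definition dist_l2 :: "('a, 'b) l2 \<Rightarrow> ('a, 'b) l2 \<Rightarrow> real" where "dist_l2 F G = norm (F - G)"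
definition sgn_l2 :: "('a, 'b) l2 \<Rightarrow> ('a, 'b) l2" where "sgn_l2 F = inverse (norm F) *\<^sub>R F"
definition uniformity_l2 :: "(('a, 'b) l2 \<times> ('a, 'b) l2) filter"
  where "uniformity_l2 = (INF e\<in>{0 <..}. principal {(x, y). dist x y < e})"
definition open_l2 :: "('a, 'b) l2 set \<Rightarrow> bool"
  where "open_l2 U = (\<forall>x\<in>U. eventually (\<lambda>(x', y). x' = x \<longrightarrow> y \<in> U) uniformity)"

instance
proof
  fix F G K :: "('a, 'b) l2" and c d :: real
  show "F + G + K = F + (G + K)"
    by transfer (auto simp: l2_rel_def intro!: square_integrable_add simp: add.assoc)
  show "F + G = G + F"
    by transfer (auto simp: l2_rel_def intro!: square_integrable_add simp: add.commute)
  show "0 + F = F" by transfer (auto simp: l2_rel_def)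
  show "- F + F = 0" by transfer (auto simp: l2_rel_def square_integrable_zero)
  show "F - G = F + - G"
    by transfer (auto simp: l2_rel_def intro!: square_integrable_add square_integrable_diff square_integrable_minus)
  show "c *\<^sub>R (F + G) = c *\<^sub>R F + c *\<^sub>R G"
    by transfer (auto simp: l2_rel_def algebra_simps intro!: square_integrable_add square_integrable_scaleR)
  show "(c + d) *\<^sub>R F = c *\<^sub>R F + d *\<^sub>R F"
    by transfer (auto simp: l2_rel_def scaleR_left_distrib[symmetric] intro!: square_integrable_scaleR)
  show "c *\<^sub>R d *\<^sub>R F = (c * d) *\<^sub>R F"
    by transfer (auto simp: l2_rel_def intro!: square_integrable_scaleR)
  show "1 *\<^sub>R F = F" by transfer (auto simp: l2_rel_def)
  show "F \<bullet> G = G \<bullet> F" by transfer (simp add: inner_commute)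
  show "(F + G) \<bullet> K = F \<bullet> K + G \<bullet> K"
    by transfer (auto simp: l2_rel_def inner_add_left intro!: Bochner_Integration.integral_add square_integrable_inner)
  show "(c *\<^sub>R F) \<bullet> G = c * (F \<bullet> G)" by transfer simp
  show "0 \<le> F \<bullet> F" by transfer simp
  show "(F \<bullet> F = 0) = (F = 0)"
  proof transfer
    fix f :: "'a \<Rightarrow> 'b" assume "l2_rel f f"
    then show "((LINT x|lborel. f x \<bullet> f x) = 0) = l2_rel f (\<lambda>x. 0)"
      using integral_nonneg_eq_0_iff_AE[of lborel "\<lambda>x. f x \<bullet> f x"] square_integrable_inner[of f f]
      by (auto simp: l2_rel_def square_integrable_zero)
  qed
qed (rule norm_l2_def dist_l2_def sgn_l2_def uniformity_l2_def open_l2_def)+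

end

lemma rep_l2_diff: "AE x in lborel. rep_l2 (F - G) x = rep_l2 F x - rep_l2 G x"
proof -
  have "abs_l2 (\<lambda>x. rep_l2 F x - rep_l2 G x) = F - G"
    by (subst minus_l2.abs_eq[symmetric]) (simp_all add: l2_rel_def)
  then show ?thesis
    using rep_abs_l2[OF square_integrable_diff[OF square_integrable_rep square_integrable_rep], of F G] by simp
qed

lemma inner_l2_rep: "F \<bullet> G = (LINT x|lborel. rep_l2 F x \<bullet> rep_l2 G x)"
  using inner_l2.abs_eq[of "rep_l2 F" "rep_l2 G"] by (simp add: l2_rel_def)

lemma inner_abs_l2:
  "square_integrable f \<Longrightarrow> square_integrable g \<Longrightarrow> abs_l2 f \<bullet> abs_l2 g = (LINT x|lborel. f x \<bullet> g x)"
  by (rule inner_l2.abs_eq) (simp_all add: l2_rel_def)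

lemma inner_rep_abs_l2:
  "square_integrable g \<Longrightarrow> F \<bullet> abs_l2 g = (LINT x|lborel. rep_l2 F x \<bullet> g x)"
  using inner_abs_l2[of "rep_l2 F" g] by simp

lemma norm_l2_power2: "(norm F)\<^sup>2 = (LINT x|lborel. (norm (rep_l2 F x))\<^sup>2)"
  unfolding power2_norm_eq_inner by (simp add: inner_l2_rep)

lemma norm_abs_l2_power2:
  "square_integrable f \<Longrightarrow> (norm (abs_l2 f))\<^sup>2 = (LINT x|lborel. (norm (f x))\<^sup>2)"
  unfolding power2_norm_eq_inner by (simp add: inner_abs_l2)

lemma abs_l2_diff:
  "square_integrable f \<Longrightarrow> square_integrable g \<Longrightarrow> abs_l2 f - abs_l2 g = abs_l2 (\<lambda>x. f x - g x)"
  by (rule minus_l2.abs_eq) (simp_all add: l2_rel_def)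

lemma abs_l2_scaleR: "square_integrable f \<Longrightarrow> c *\<^sub>R abs_l2 f = abs_l2 (\<lambda>x. c *\<^sub>R f x)"
  by (rule scaleR_l2.abs_eq) (simp add: l2_rel_def)

lemma nn_integral_norm_l2:
  "(\<integral>\<^sup>+x. ennreal ((norm (rep_l2 F x - rep_l2 G x))\<^sup>2) \<partial>lborel) = ennreal ((norm (F - G))\<^sup>2)"
proof -
  have "(\<integral>\<^sup>+x. ennreal ((norm (rep_l2 F x - rep_l2 G x))\<^sup>2) \<partial>lborel)
      = (\<integral>\<^sup>+x. ennreal ((norm (rep_l2 (F - G) x))\<^sup>2) \<partial>lborel)"
    using rep_l2_diff[of F G] by (intro nn_integral_cong_AE) (auto elim: eventually_mono)
  also have "\<dots> = ennreal (LINT x|lborel. (norm (rep_l2 (F - G) x))\<^sup>2)"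
    using square_integrable_rep[of "F - G"]
    by (intro nn_integral_eq_integral) (auto simp: square_integrable_def)
  finally show ?thesis by (simp add: norm_l2_power2)
qed

section \<open>Completeness of L^2\<close>

text \<open>With g_k the size of the k-th increment, the sum of 2^k g_k^2 has integral at most the
  sum of 2^k 4^(-k), so it is finite almost everywhere. Comparing g_k with 2^k g_k^2 plus a
  geometric term then makes the increments absolutely summable.\<close>

lemma fast_Cauchy_l2_AE_convergent:
  fixes X :: "nat \<Rightarrow> ('a::euclidean_space, 'b::euclidean_space) l2"
  assumes X: "\<And>k. norm (X (Suc k) - X k) \<le> (1/2) ^ k"
  shows "AE x in lborel. convergent (\<lambda>k. rep_l2 (X k) x)"
proof -
  define g where "g k x = norm (rep_l2 (X (Suc k)) x - rep_l2 (X k) x)" for k x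
  have [measurable]: "g k \<in> borel_measurable borel" for k
    unfolding g_def using square_integrable_measurable[OF square_integrable_rep] by measurable
  have "(\<integral>\<^sup>+x. (\<Sum>k. ennreal (2 ^ k * (g k x)\<^sup>2)) \<partial>lborel) = (\<Sum>k. \<integral>\<^sup>+x. ennreal (2 ^ k * (g k x)\<^sup>2) \<partial>lborel)"
    by (intro nn_integral_suminf) measurable
  also have "\<dots> \<le> (\<Sum>k. ennreal ((1/2) ^ k))"
  proof (intro suminf_le allI summableI)
    fix k
    have "(\<integral>\<^sup>+x. ennreal (2 ^ k * (g k x)\<^sup>2) \<partial>lborel) = ennreal (2 ^ k) * ennreal ((norm (X (Suc k) - X k))\<^sup>2)"
      unfolding nn_integral_norm_l2[symmetric] g_def[symmetric]
      by (subst nn_integral_cmult[symmetric]) (auto simp: ennreal_mult')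
    also have "\<dots> \<le> ennreal (2 ^ k) * ennreal (((1/2) ^ k)\<^sup>2)"
      using X by (intro mult_left_mono ennreal_leI power_mono) auto
    also have "\<dots> = ennreal ((1/2) ^ k)"
      by (simp add: ennreal_mult'[symmetric] power2_eq_square power_divide)
    finally show "(\<integral>\<^sup>+x. ennreal (2 ^ k * (g k x)\<^sup>2) \<partial>lborel) \<le> ennreal ((1/2) ^ k)" .
  qed
  also have "\<dots> = ennreal (\<Sum>k. (1/2) ^ k)"
    by (intro suminf_ennreal2 summable_geometric) auto
  finally have fin: "(\<integral>\<^sup>+x. (\<Sum>k. ennreal (2 ^ k * (g k x)\<^sup>2)) \<partial>lborel) \<noteq> \<infinity>"
    by (auto simp: top_unique)
  then have "AE x in lborel. (\<Sum>k. ennreal (2 ^ k * (g k x)\<^sup>2)) \<noteq> \<infinity>"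
    by (intro nn_integral_PInf_AE) measurable
  then show ?thesis
  proof (rule eventually_mono)
    fix x assume "(\<Sum>k. ennreal (2 ^ k * (g k x)\<^sup>2)) \<noteq> \<infinity>"
    then have sm: "summable (\<lambda>k. 2 ^ k * (g k x)\<^sup>2)"
      by (intro summable_suminf_not_top) auto
    \<comment> \<open>The choice 2 q^2 = 1 balances the inequality 2 a <= 1 + a^2 at a = 2^k q^k
      g_k: after multiplication by q^k its left side is 2 g_k and its right side is q^k + 2^k g_k^2
      q^k.\<close>
    define q :: real where "q = 1 / sqrt 2"
    have q: "0 < q" "q < 1" "q\<^sup>2 = 1/2" by (auto simp: q_def power_divide)
    have "g k x \<le> q ^ k + 2 ^ k * (g k x)\<^sup>2 * q ^ k" for k
    proof -
      have "2 * (2 ^ k * q ^ k * g k x) \<le> 1 + (2 ^ k * q ^ k * g k x)\<^sup>2"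
        using sum_squares_bound[of 1 "2 ^ k * q ^ k * g k x"] by simp
      then have "q ^ k * (2 ^ k * q ^ k * g k x) \<le> q ^ k * (1 + (2 ^ k * q ^ k * g k x)\<^sup>2)"
        using q by (intro mult_left_mono) (auto intro: order_trans[of _ "2 * (2 ^ k * q ^ k * g k x)"] simp: g_def)
      moreover have qq: "q ^ k * q ^ k * 2 ^ k = 1"
      proof -
        have "q ^ k * q ^ k * 2 ^ k = (q\<^sup>2 * 2) ^ k" by (simp add: power2_eq_square power_mult_distrib)
        then show ?thesis by (simp add: q)
      qed
      moreover have "q ^ k * (2 ^ k * q ^ k * g k x) = (q ^ k * q ^ k * 2 ^ k) * g k x" by (simp add: mult_ac)
      moreover have "q ^ k * (2 ^ k * q ^ k * g k x)\<^sup>2 = (q ^ k * q ^ k * 2 ^ k) * (2 ^ k * (g k x)\<^sup>2 * q ^ k)"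
        by (simp add: power2_eq_square mult_ac)
      ultimately show ?thesis by (simp add: distrib_left)
    qed
    also have "\<dots> k \<le> q ^ k + 2 ^ k * (g k x)\<^sup>2" for k
      using q mult_left_le[of "q ^ k" "2 ^ k * (g k x)\<^sup>2"] by (simp add: power_le_one)
    finally have le: "g k x \<le> q ^ k + 2 ^ k * (g k x)\<^sup>2" for k .
    have "summable (\<lambda>k. q ^ k + 2 ^ k * (g k x)\<^sup>2)"
      using q by (intro summable_add summable_geometric sm) auto
    then have "summable (\<lambda>k. rep_l2 (X (Suc k)) x - rep_l2 (X k) x)"
      by (rule summable_comparison_test') (use le in \<open>auto simp: g_def\<close>)
    then have "convergent (\<lambda>n. \<Sum>k<n. rep_l2 (X (Suc k)) x - rep_l2 (X k) x)"
      by (simp only: summable_iff_convergent)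
    then have "convergent (\<lambda>n. rep_l2 (X n) x - rep_l2 (X 0) x)"
      by (simp only: sum_lessThan_telescope[of "\<lambda>k. rep_l2 (X k) x"])
    from convergent_add[OF this convergent_const[of "rep_l2 (X 0) x"]]
    show "convergent (\<lambda>k. rep_l2 (X k) x)" by simp
  qed
qed

text \<open>A fast Cauchy subsequence has an almost everywhere limit, Fatou's lemma shows that it is
  also the limit in norm, and a Cauchy sequence converges with its subsequence.\<close>

instance l2 :: (euclidean_space, euclidean_space) banach
proof
  fix X :: "nat \<Rightarrow> ('a, 'b) l2"
  assume "Cauchy X"
  have "\<exists>r. strict_mono r \<and> (\<forall>k. norm (X (r (Suc k)) - X (r k)) \<le> (1/2) ^ k)"
  proof -
    have "\<exists>N. \<forall>m\<ge>N. \<forall>n\<ge>N. norm (X m - X n) < (1/2) ^ k" for k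
      using \<open>Cauchy X\<close> by (auto intro!: CauchyD)
    then obtain N where N: "\<And>k m n. m \<ge> N k \<Longrightarrow> n \<ge> N k \<Longrightarrow> norm (X m - X n) < (1/2) ^ k" by metis
    \<comment> \<open>Summing the thresholds, each increased by one, makes \<open>r\<close> strictly
      increasing and at least \<open>N k\<close> at the same time.\<close>
    define r where "r k = (\<Sum>j\<le>k. Suc (N j))" for k
    have "strict_mono r" by (auto simp: strict_mono_Suc_iff r_def)
    have r: "N k \<le> r k" for k
    proof -
      have "Suc (N k) \<le> r k" unfolding r_def by (rule member_le_sum) auto
      then show ?thesis by simp
    qed
    have "N k \<le> r (Suc k)" for k
      using r[of k] strict_monoD[OF \<open>strict_mono r\<close>, of k "Suc k"] by simp
    with r N \<open>strict_mono r\<close> show ?thesis by (meson less_imp_le)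
  qed
  then obtain r where r: "strict_mono r" and fast: "\<And>k. norm (X (r (Suc k)) - X (r k)) \<le> (1/2) ^ k" by blast
  define f where "f k = rep_l2 (X (r k))" for k
  have [measurable]: "f k \<in> borel_measurable borel" for k
    unfolding f_def by (rule square_integrable_measurable[OF square_integrable_rep])
  define g where "g x = lim (\<lambda>k. f k x)" for x
  have [measurable]: "g \<in> borel_measurable borel" unfolding g_def by measurable
  have lim: "AE x in lborel. (\<lambda>k. f k x) \<longlonglongrightarrow> g x"
    using fast_Cauchy_l2_AE_convergent[of "\<lambda>k. X (r k)"] fast
    by (auto elim!: eventually_mono simp: f_def g_def convergent_LIMSEQ_iff)
  \<comment> \<open>A tail that stays within e of its k-th member passes this bound on to the
    pointwise limit. The case e = 1 gives square integrability of \<open>g\<close>, small e the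
    convergence.\<close>
  have Fatou: "(\<integral>\<^sup>+x. ennreal ((norm (g x - f k x))\<^sup>2) \<partial>lborel) \<le> ennreal (e\<^sup>2)"
    if e: "0 \<le> e" and ev: "\<And>j. j \<ge> k \<Longrightarrow> norm (X (r j) - X (r k)) \<le> e" for k e
  proof -
    have "(\<integral>\<^sup>+x. ennreal ((norm (g x - f k x))\<^sup>2) \<partial>lborel)
        = (\<integral>\<^sup>+x. liminf (\<lambda>j. ennreal ((norm (f j x - f k x))\<^sup>2)) \<partial>lborel)"
    proof (rule nn_integral_cong_AE, rule eventually_mono[OF lim])
      fix x assume *: "(\<lambda>k. f k x) \<longlonglongrightarrow> g x"
      have "(\<lambda>j. ennreal ((norm (f j x - f k x))\<^sup>2)) \<longlonglongrightarrow> ennreal ((norm (g x - f k x))\<^sup>2)"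
        by (intro tendsto_ennrealI tendsto_intros *)
      then show "ennreal ((norm (g x - f k x))\<^sup>2) = liminf (\<lambda>j. ennreal ((norm (f j x - f k x))\<^sup>2))"
        by (intro lim_imp_Liminf[symmetric]) auto
    qed
    also have "\<dots> \<le> liminf (\<lambda>j. \<integral>\<^sup>+x. ennreal ((norm (f j x - f k x))\<^sup>2) \<partial>lborel)"
      by (rule nn_integral_liminf) measurable
    also have "\<dots> = liminf (\<lambda>j. ennreal ((norm (X (r j) - X (r k)))\<^sup>2))"
      unfolding f_def nn_integral_norm_l2 ..
    also have "\<dots> \<le> ennreal (e\<^sup>2)"
    proof -
      have "\<forall>\<^sub>F j in sequentially. ennreal ((norm (X (r j) - X (r k)))\<^sup>2) \<le> ennreal (e\<^sup>2)"
        using ev by (intro eventually_sequentiallyI[of k] ennreal_leI power_mono) auto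
      then have "liminf (\<lambda>j. ennreal ((norm (X (r j) - X (r k)))\<^sup>2)) \<le> liminf (\<lambda>j. ennreal (e\<^sup>2))"
        by (rule Liminf_mono)
      then show ?thesis by (simp add: Liminf_const)
    qed
    finally show ?thesis .
  qed
  have CX: "Cauchy (\<lambda>k. X (r k))" using Cauchy_subseq_Cauchy[OF \<open>Cauchy X\<close> r] by (simp add: o_def)
  have diff_int: "integrable lborel (\<lambda>x. (norm (g x - f k x))\<^sup>2) \<and> (LINT x|lborel. (norm (g x - f k x))\<^sup>2) \<le> e\<^sup>2"
    if e: "0 \<le> e" and ev: "\<And>j. j \<ge> k \<Longrightarrow> norm (X (r j) - X (r k)) \<le> e" for k e
  proof -
    have F: "(\<integral>\<^sup>+x. ennreal ((norm (g x - f k x))\<^sup>2) \<partial>lborel) \<le> ennreal (e\<^sup>2)" by (rule Fatou[OF that])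
    then have "integrable lborel (\<lambda>x. (norm (g x - f k x))\<^sup>2)"
      by (intro integrableI_bounded) (auto simp: less_top[symmetric] top_unique)
    moreover from this F have "(LINT x|lborel. (norm (g x - f k x))\<^sup>2) \<le> e\<^sup>2"
      by (subst (asm) nn_integral_eq_integral) auto
    ultimately show ?thesis by simp
  qed
  have "square_integrable g"
  proof -
    obtain k where "\<And>j. j \<ge> k \<Longrightarrow> norm (X (r j) - X (r k)) < 1"
      using CauchyD[OF CX, of 1] by auto
    then have "integrable lborel (\<lambda>x. (norm (g x - f k x))\<^sup>2)"
      using diff_int[of 1 k] by (simp add: less_imp_le)
    then have "square_integrable (\<lambda>x. g x - f k x)" by (simp add: square_integrable_def)
    from square_integrable_add[OF this square_integrable_rep[of "X (r k)"]]
    show ?thesis by (simp add: f_def)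
  qed
  have "(\<lambda>k. X (r k)) \<longlonglongrightarrow> abs_l2 g"
  proof (rule LIMSEQ_I)
    fix e :: real assume "0 < e"
    then obtain N where N: "\<And>m n. m \<ge> N \<Longrightarrow> n \<ge> N \<Longrightarrow> norm (X (r m) - X (r n)) < e / 2"
      using CauchyD[OF CX, of "e / 2"] by auto
    have "norm (X (r k) - abs_l2 g) < e" if "k \<ge> N" for k
    proof -
      have "(norm (abs_l2 g - X (r k)))\<^sup>2 = (LINT x|lborel. (norm (g x - f k x))\<^sup>2)"
        using norm_abs_l2_power2[OF square_integrable_diff[OF \<open>square_integrable g\<close> square_integrable_rep[of "X (r k)"]]]
          abs_l2_diff[OF \<open>square_integrable g\<close> square_integrable_rep[of "X (r k)"]]
        by (simp add: f_def)
      also have "\<dots> \<le> (e / 2)\<^sup>2"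
        using diff_int[of "e / 2" k] N that \<open>0 < e\<close> by (auto simp: less_imp_le)
      finally have "norm (abs_l2 g - X (r k)) \<le> e / 2"
        by (rule power2_le_imp_le) (use \<open>0 < e\<close> in simp)
      then show ?thesis using \<open>0 < e\<close> by (simp add: norm_minus_commute)
    qed
    then show "\<exists>N. \<forall>k\<ge>N. norm (X (r k) - abs_l2 g) < e" by blast
  qed
  then have "X \<longlonglongrightarrow> abs_l2 g"
    using Cauchy_converges_subseq[OF \<open>Cauchy X\<close> r] by (simp add: o_def)
  then show "convergent X" by (auto simp: convergent_def)
qed

subsection \<open>Test functions\<close>

lemma dir_deriv_eqI: "(f has_derivative f') (at x) \<Longrightarrow> dir_deriv v f x = f' v"
  by (simp add: dir_deriv_def frechet_derivative_at[symmetric])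

lemma smooth_has_derivative:
  assumes "smooth f"
  shows "(f has_derivative (\<lambda>v. dir_deriv v f x)) (at x)"
proof -
  have "f differentiable (at x)" using assms[unfolded smooth_def, rule_format, of "[]"] by simp
  then show ?thesis unfolding dir_deriv_def by (simp add: frechet_derivative_works)
qed

lemma smooth_continuous_on: "smooth f \<Longrightarrow> continuous_on A f"
  by (intro continuous_at_imp_continuous_on ballI has_derivative_continuous[OF smooth_has_derivative])

lemma smooth_iter_deriv_differentiable:
  "smooth f \<Longrightarrow> set vs \<subseteq> Basis \<Longrightarrow> (iter_deriv vs f has_derivative (\<lambda>v. dir_deriv v (iter_deriv vs f) x)) (at x)"
  unfolding smooth_def dir_deriv_def by (simp add: frechet_derivative_works)

lemma smooth_dir_deriv:
  fixes f :: "'a::euclidean_space \<Rightarrow> 'b::real_normed_vector"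
  assumes "smooth f" "b \<in> Basis"
  shows "smooth (dir_deriv b f)"
  unfolding smooth_def
proof (intro allI impI)
  fix vs :: "'a list" and x assume "set vs \<subseteq> Basis"
  then have "set (vs @ [b]) \<subseteq> Basis" using assms by auto
  with assms(1) have "iter_deriv (vs @ [b]) f differentiable (at x)" unfolding smooth_def by blast
  then show "iter_deriv vs (dir_deriv b f) differentiable (at x)" by simp
qed

lemma notin_supp: "x \<notin> supp f \<Longrightarrow> f x = 0"
  unfolding supp_def using closure_subset[of "{x. f x \<noteq> 0}"] by auto

lemma supp_dir_deriv: "supp (dir_deriv v f) \<subseteq> supp f"
proof -
  have "dir_deriv v f x = 0" if "x \<notin> supp f" for x
  proof -
    have "((\<lambda>x. 0) has_derivative (\<lambda>x. 0)) (at x)" by simp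
    then have "(f has_derivative (\<lambda>x. 0)) (at x)"
    proof (rule has_derivative_transform_within_open)
      show "open (- supp f)" by (simp add: supp_def open_Compl)
      show "x \<in> - supp f" using that by simp
      show "0 = f y" if "y \<in> - supp f" for y using that notin_supp[of y f] by simp
    qed
    then show ?thesis by (simp add: dir_deriv_eqI)
  qed
  then have "{x. dir_deriv v f x \<noteq> 0} \<subseteq> supp f" by auto
  then show ?thesis unfolding supp_def by (simp add: closure_minimal)
qed

lemma test_functionsI:
  assumes "smooth f" "compact K" "\<And>x. f x \<noteq> 0 \<Longrightarrow> x \<in> K"
  shows "f \<in> test_functions UNIV"
proof -
  have "supp f \<subseteq> K" unfolding supp_def
    using assms by (intro closure_minimal compact_imp_closed) auto
  then have "compact (supp f)"
    using assms(2) compact_Int_closed[of K "supp f"] by (simp add: supp_def inf.absorb2)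
  with assms(1) show ?thesis by (simp add: test_functions_def)
qed

lemma test_functions_dir_deriv:
  assumes "f \<in> test_functions \<Omega>" "b \<in> Basis"
  shows "dir_deriv b f \<in> test_functions \<Omega>"
proof -
  have "supp (dir_deriv b f) \<subseteq> supp f" by (rule supp_dir_deriv)
  moreover have "compact (supp (dir_deriv b f))"
    using assms(1) supp_dir_deriv[of b f] compact_Int_closed[of "supp f" "supp (dir_deriv b f)"]
    by (simp add: test_functions_def inf.absorb2) (simp add: supp_def)
  ultimately show ?thesis
    using assms by (auto simp: test_functions_def smooth_dir_deriv)
qed

text \<open>Smoothness is defined through iterated derivatives, so the composite needs an explicit
  formula for them: each differentiation contributes one factor \<open>c\<close> and passes through
  \<open>L\<close>.\<close>

lemma smooth_linear_affine:
  fixes f :: "'a::euclidean_space \<Rightarrow> 'b::real_normed_vector" and L :: "'b \<Rightarrow> 'c::real_normed_vector"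
  assumes L: "bounded_linear L" and f: "smooth f"
  shows "smooth (\<lambda>y. L (f (c *\<^sub>R y + a)))"
proof -
  interpret L: bounded_linear L by fact
  have deriv: "((\<lambda>y. L (c ^ k *\<^sub>R iter_deriv vs f (c *\<^sub>R y + a))) has_derivative
      (\<lambda>v. L (c ^ Suc k *\<^sub>R dir_deriv v (iter_deriv vs f) (c *\<^sub>R y + a)))) (at y)"
    if "set vs \<subseteq> Basis" for vs k y
  proof -
    let ?h = "iter_deriv vs f"
    have h: "(?h has_derivative (\<lambda>v. dir_deriv v ?h (c *\<^sub>R y + a))) (at (c *\<^sub>R y + a))"
      using f that by (rule smooth_iter_deriv_differentiable)
    interpret h: bounded_linear "\<lambda>v. dir_deriv v ?h (c *\<^sub>R y + a)"
      using h by (rule has_derivative_bounded_linear)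
    have "((\<lambda>y. c *\<^sub>R y + a) has_derivative (\<lambda>v. c *\<^sub>R v)) (at y)"
      by (auto intro!: derivative_eq_intros)
    from has_derivative_compose[OF this h]
    have "((\<lambda>y. ?h (c *\<^sub>R y + a)) has_derivative (\<lambda>v. dir_deriv (c *\<^sub>R v) ?h (c *\<^sub>R y + a))) (at y)" .
    from L.has_derivative[OF has_derivative_scaleR_right[OF this, of "c ^ k"]]
    show ?thesis by (simp add: h.scaleR mult_ac)
  qed
  have iter: "iter_deriv vs (\<lambda>y. L (f (c *\<^sub>R y + a)))
      = (\<lambda>y. L (c ^ length vs *\<^sub>R iter_deriv vs f (c *\<^sub>R y + a)))" if "set vs \<subseteq> Basis" for vs
    using that
  proof (induction vs)
    case (Cons v vs)
    then have "set vs \<subseteq> Basis" by simp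
    with Cons.IH dir_deriv_eqI[OF deriv[of vs "length vs"]] show ?case by simp
  qed simp
  show ?thesis unfolding smooth_def
    using deriv iter by (auto simp: differentiable_def)
qed

lemma smooth_linear:
  assumes "bounded_linear L" "smooth f"
  shows "smooth (\<lambda>y. L (f y))"
  using smooth_linear_affine[OF assms, of 1 0] by simp

lemma dir_deriv_linear:
  assumes "bounded_linear L" "smooth f"
  shows "dir_deriv v (\<lambda>y. L (f y)) x = L (dir_deriv v f x)"
  using bounded_linear.has_derivative[OF assms(1) smooth_has_derivative[OF assms(2)]]
  by (rule dir_deriv_eqI)

lemma test_functions_linear:
  assumes L: "bounded_linear L" and f: "f \<in> test_functions \<Omega>"
  shows "(\<lambda>y. L (f y)) \<in> test_functions \<Omega>"
proof -
  have "{y. L (f y) \<noteq> 0} \<subseteq> {y. f y \<noteq> 0}"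
    using linear_0[OF bounded_linear.linear[OF L]] by auto
  then have sub: "supp (\<lambda>y. L (f y)) \<subseteq> supp f" unfolding supp_def by (rule closure_mono)
  have "(\<lambda>y. L (f y)) \<in> test_functions UNIV"
    using f sub notin_supp[of _ "\<lambda>y. L (f y)"]
    by (intro test_functionsI[of _ "supp f"] smooth_linear[OF L]) (auto simp: test_functions_def)
  with sub f show ?thesis by (auto simp: test_functions_def)
qed

lemma test_functions_rescale:
  fixes f :: "'a::euclidean_space \<Rightarrow> real"
  assumes f: "f \<in> test_functions UNIV" and "c > 0"
  shows "(\<lambda>y. complex_of_real (f (c *\<^sub>R (y - x)))) \<in> test_functions UNIV"
proof (rule test_functionsI)
  show "smooth (\<lambda>y. complex_of_real (f (c *\<^sub>R (y - x))))"
    using smooth_linear_affine[OF bounded_linear_of_real, of f c "- c *\<^sub>R x"] f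
    by (simp add: test_functions_def algebra_simps)
  show "compact ((\<lambda>z. (1 / c) *\<^sub>R z + x) ` supp f)"
    using f by (intro compact_continuous_image continuous_intros) (simp add: test_functions_def)
  fix y assume "complex_of_real (f (c *\<^sub>R (y - x))) \<noteq> 0"
  then have "c *\<^sub>R (y - x) \<in> supp f" using notin_supp by fastforce
  moreover have "y = (1 / c) *\<^sub>R (c *\<^sub>R (y - x)) + x" using \<open>c > 0\<close> by simp
  ultimately show "y \<in> (\<lambda>z. (1 / c) *\<^sub>R z + x) ` supp f" by blast
qed

text \<open>At a frozen time a space-time test function becomes a spatial one, and the direction b
  corresponds to (0, b). This lets the equation on space-time be tested one time at a time.\<close>

lemma smooth_section:
  fixes f :: "real \<times> 'a::euclidean_space \<Rightarrow> 'b::real_normed_vector"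
  assumes f: "smooth f"
  shows "smooth (\<lambda>x. f (t, x))" and "dir_deriv b (\<lambda>x. f (t, x)) = (\<lambda>x. dir_deriv (0, b) f (t, x))"
proof -
  have deriv: "((\<lambda>x. iter_deriv vs f (t, x)) has_derivative
      (\<lambda>v. dir_deriv (0, v) (iter_deriv vs f) (t, x))) (at x)" if "set vs \<subseteq> Basis" for vs x
  proof -
    have "((\<lambda>x. (t, x)) has_derivative (\<lambda>v. (0, v))) (at x)"
      by (auto intro!: derivative_eq_intros)
    from has_derivative_compose[OF this smooth_iter_deriv_differentiable[OF f that]]
    show ?thesis .
  qed
  from deriv[of "[]"] show "dir_deriv b (\<lambda>x. f (t, x)) = (\<lambda>x. dir_deriv (0, b) f (t, x))"
    using dir_deriv_eqI by (fastforce simp: fun_eq_iff)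
  have iter: "iter_deriv vs (\<lambda>x. f (t, x)) = (\<lambda>x. iter_deriv (map (Pair 0) vs) f (t, x))"
    if "set vs \<subseteq> Basis" for vs
    using that
  proof (induction vs)
    case (Cons v vs)
    then have "set (map (Pair (0::real)) vs) \<subseteq> Basis" by (auto simp: Basis_prod_def)
    with Cons dir_deriv_eqI[OF deriv] show ?case by simp
  qed simp
  show "smooth (\<lambda>x. f (t, x))" unfolding smooth_def
  proof (intro allI impI)
    fix vs :: "'a list" and x assume vs: "set vs \<subseteq> Basis"
    then have "set (map (Pair (0::real)) vs) \<subseteq> Basis" by (auto simp: Basis_prod_def)
    from deriv[OF this] show "iter_deriv vs (\<lambda>x. f (t, x)) differentiable (at x)"
      unfolding iter[OF vs] by (auto simp: differentiable_def)
  qed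
qed

lemma test_functions_section:
  fixes f :: "real \<times> 'a::euclidean_space \<Rightarrow> 'b::real_normed_vector"
  assumes f: "f \<in> test_functions \<Omega>"
  shows "(\<lambda>x. f (t, x)) \<in> test_functions UNIV"
proof (rule test_functionsI)
  show "smooth (\<lambda>x. f (t, x))" using f by (simp add: test_functions_def smooth_section)
  show "compact (snd ` supp f)"
    using f by (intro compact_continuous_image continuous_intros) (simp add: test_functions_def)
  show "x \<in> snd ` supp f" if "f (t, x) \<noteq> 0" for x
    using that notin_supp[of "(t, x)" f] by (metis image_eqI snd_conv)
qed

lemma test_function_bounded:
  assumes f: "f \<in> test_functions \<Omega>"
  obtains M where "0 \<le> M" "\<And>x. norm (f x) \<le> M"
proof -
  have "compact (f ` supp f)"
    using f by (intro compact_continuous_image smooth_continuous_on) (auto simp: test_functions_def)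
  from compact_imp_bounded[OF this] obtain M where M: "\<And>x. x \<in> supp f \<Longrightarrow> norm (f x) \<le> M"
    unfolding bounded_iff by blast
  have "norm (f x) \<le> max M 0" for x
    using M[of x] notin_supp[of x f] by (cases "x \<in> supp f") auto
  then show thesis by (intro that[of "max M 0"]) auto
qed

text \<open>The bound is only required almost everywhere because the functions of interest contain a
  factor that is merely essentially bounded. The explicit norm estimate later turns pointwise
  estimates uniform in space into estimates in L^2.\<close>

lemma square_integrable_compact_support:
  fixes f :: "'a::euclidean_space \<Rightarrow> 'b::euclidean_space"
  assumes f: "f \<in> borel_measurable borel" and K: "compact K" "\<And>x. x \<notin> K \<Longrightarrow> f x = 0"
    and M: "AE x in lborel. norm (f x) \<le> M" and "0 \<le> M"
  shows "square_integrable f" and "norm (abs_l2 f) \<le> M * sqrt (measure lborel K)"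
proof -
  have fin: "emeasure lborel K < \<infinity>" using K(1) by (rule emeasure_compact_finite)
  have Kb: "K \<in> sets lborel" using K(1) by (simp add: borel_compact)
  have int: "integrable lborel (\<lambda>x. M\<^sup>2 * indicator K x)"
    using fin Kb by (intro integrable_mult_right integrable_real_indicator) auto
  have le: "AE x in lborel. (norm (f x))\<^sup>2 \<le> M\<^sup>2 * indicator K x"
    using M
  proof (rule eventually_mono)
    fix x assume "norm (f x) \<le> M"
    then show "(norm (f x))\<^sup>2 \<le> M\<^sup>2 * indicator K x"
      using K(2)[of x] power_mono[of "norm (f x)" M 2] by (cases "x \<in> K") auto
  qed
  show sq: "square_integrable f" by (rule square_integrable_dominated[OF f int le])
  have "(norm (abs_l2 f))\<^sup>2 = (LINT x|lborel. (norm (f x))\<^sup>2)" using sq by (rule norm_abs_l2_power2)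
  also have "\<dots> \<le> (LINT x|lborel. M\<^sup>2 * indicator K x)"
    using sq int le by (intro integral_mono_AE) (auto simp: square_integrable_def)
  also have "\<dots> = (M * sqrt (measure lborel K))\<^sup>2"
    using Kb by (simp add: power_mult_distrib)
  finally show "norm (abs_l2 f) \<le> M * sqrt (measure lborel K)"
    by (rule power2_le_imp_le) (use \<open>0 \<le> M\<close> in simp)
qed

lemma test_function_measurable:
  fixes f :: "'a::euclidean_space \<Rightarrow> 'b::real_normed_vector"
  assumes "f \<in> test_functions \<Omega>"
  shows "f \<in> borel_measurable borel"
  using assms by (intro borel_measurable_continuous_onI smooth_continuous_on) (simp add: test_functions_def)

lemma test_function_square_integrable:
  fixes f :: "'a::euclidean_space \<Rightarrow> 'b::euclidean_space"
  assumes f: "f \<in> test_functions \<Omega>"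
  shows "square_integrable f"
proof -
  obtain M where "0 \<le> M" "\<And>x. norm (f x) \<le> M" using test_function_bounded[OF f] by metis
  then show ?thesis
    using f notin_supp
    by (intro square_integrable_compact_support(1)[of f "supp f" M] test_function_measurable[OF f])
      (auto simp: test_functions_def)
qed

lemma integrable_compact_support:
  fixes f :: "'a::euclidean_space \<Rightarrow> 'b::euclidean_space"
  assumes f: "continuous_on UNIV f" and K: "compact K" "\<And>x. x \<notin> K \<Longrightarrow> f x = 0"
  shows "integrable lborel f"
proof -
  have "(\<lambda>x. indicator K x *\<^sub>R f x) = f" using K(2) by (auto simp: fun_eq_iff indicator_def)
  with borel_integrable_compact[OF K(1) continuous_on_subset[OF f]] show ?thesis by simp
qed

section \<open>Translation invariance and integration by parts\<close>

lemma curve_increment_bound: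
  fixes g :: "real \<Rightarrow> 'b::real_normed_vector"
  assumes g: "\<And>r. (g has_vector_derivative g' r) (at r)"
    and bound: "\<And>r. \<bar>r - a\<bar> \<le> \<bar>s - a\<bar> \<Longrightarrow> norm (g' r) \<le> B"
  shows "norm (g s - g a) \<le> B * \<bar>s - a\<bar>"
proof -
  have "norm (g s - g a) \<le> B * norm (s - a)"
  proof (rule differentiable_bound)
    show "convex (closed_segment a s)" by simp
    fix r assume "r \<in> closed_segment a s"
    then have "\<bar>r - a\<bar> \<le> \<bar>s - a\<bar>" by (auto simp: closed_segment_eq_real_ivl split: if_splits)
    from bound[OF this] show "onorm (\<lambda>h. h *\<^sub>R g' r) \<le> B"
      by (intro onorm_le) (simp add: mult.commute[of B] mult_left_mono)
    show "(g has_derivative (\<lambda>h. h *\<^sub>R g' r)) (at r within closed_segment a s)"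
      using g[of r] unfolding has_vector_derivative_def by (rule has_derivative_at_withinI)
  qed auto
  then show ?thesis by simp
qed

lemma has_vector_derivative_line:
  assumes "(F has_derivative (\<lambda>v. dir_deriv v F (x + r *\<^sub>R v0))) (at (x + r *\<^sub>R v0))"
  shows "((\<lambda>r. F (x + r *\<^sub>R v0)) has_vector_derivative dir_deriv v0 F (x + r *\<^sub>R v0)) (at r)"
proof -
  interpret D: bounded_linear "\<lambda>v. dir_deriv v F (x + r *\<^sub>R v0)"
    using assms by (rule has_derivative_bounded_linear)
  have "((\<lambda>r. x + r *\<^sub>R v0) has_derivative (\<lambda>h. h *\<^sub>R v0)) (at r)"
    by (auto intro!: derivative_eq_intros)
  from has_derivative_compose[OF this assms] show ?thesis
    unfolding has_vector_derivative_def by (simp add: D.scaleR)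
qed

lemma lborel_integral_translation:
  fixes f :: "'a::euclidean_space \<Rightarrow> 'b::euclidean_space"
  assumes [measurable]: "f \<in> borel_measurable borel"
  shows "(LINT x|lborel. f (c + x)) = (LINT x|lborel. f x)"
proof -
  have "(LINT x|lborel. f x) = (LINT x|distr lborel borel ((+) c). f x)" by (simp add: lborel_distr_plus)
  also have "\<dots> = (LINT x|lborel. f (c + x))" by (rule integral_distr) auto
  finally show ?thesis ..
qed

lemma lborel_integrable_translation:
  fixes f :: "'a::euclidean_space \<Rightarrow> 'b::euclidean_space"
  assumes f: "integrable lborel f"
  shows "integrable lborel (\<lambda>x. f (c + x))"
proof -
  have [measurable]: "f \<in> borel_measurable borel" using f by auto
  have "integrable (distr lborel borel ((+) c)) f" using f by (simp add: lborel_distr_plus)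
  then show ?thesis by (subst (asm) integrable_distr_eq) auto
qed

text \<open>By translation invariance the difference quotients have integral zero.\<close>

lemma integral_dir_deriv_eq_0:
  fixes F :: "'a::euclidean_space \<Rightarrow> 'b::euclidean_space"
  assumes F: "\<And>x. (F has_derivative (\<lambda>v. dir_deriv v F x)) (at x)"
    and cont: "continuous_on UNIV (dir_deriv v F)"
    and K: "compact K" "\<And>x. x \<notin> K \<Longrightarrow> F x = 0"
  shows "(LINT x|lborel. dir_deriv v F x) = 0"
proof -
  define h where "h n = 1 / real (Suc n)" for n
  have h: "0 < h n" "h n \<le> 1" for n by (auto simp: h_def)
  have h_lim: "h \<longlonglongrightarrow> 0" unfolding h_def using LIMSEQ_inverse_real_of_nat by (simp add: inverse_eq_divide)
  define D where "D n x = (1 / h n) *\<^sub>R (F (x + h n *\<^sub>R v) - F x)" for n x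
  have line: "((\<lambda>r. F (x + r *\<^sub>R v)) has_vector_derivative dir_deriv v F (x + r *\<^sub>R v)) (at r)" for x r
    by (rule has_vector_derivative_line) (rule F)
  have contF: "continuous_on UNIV F"
    by (intro continuous_at_imp_continuous_on ballI has_derivative_continuous[OF F])
  have [measurable]: "F \<in> borel_measurable borel" "dir_deriv v F \<in> borel_measurable borel"
    using contF cont by (auto intro: borel_measurable_continuous_onI)
  obtain R where R: "\<And>x. x \<in> K \<Longrightarrow> norm x \<le> R" using compact_imp_bounded[OF K(1)] unfolding bounded_iff by blast
  \<comment> \<open>The steps satisfy h n <= 1, so outside this enlarged ball no point x + r v with
    |r| <= 1 meets \<open>K\<close>, and the difference quotient vanishes. Starting inside it, such
    points stay within one more norm of \<open>v\<close>, the ball on which the derivative is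
    bounded below.\<close>
  define K' where "K' = cball (0::'a) (R + norm v)"
  have supp_line: "F (x + r *\<^sub>R v) = 0" if "x \<notin> K'" "\<bar>r\<bar> \<le> 1" for x r
  proof -
    have "norm x \<le> norm (x + r *\<^sub>R v) + norm (r *\<^sub>R v)"
      using norm_triangle_ineq4[of "x + r *\<^sub>R v" "r *\<^sub>R v"] by simp
    moreover have "norm (r *\<^sub>R v) \<le> norm v" using that(2) by (simp add: mult_left_le_one_le)
    ultimately have "norm (x + r *\<^sub>R v) > R" using that(1) by (auto simp: K'_def dist_norm)
    then show ?thesis using R K(2) by force
  qed
  have "compact ((\<lambda>x. dir_deriv v F x) ` cball 0 (R + norm v + norm v))"
    by (intro compact_continuous_image continuous_on_subset[OF cont]) auto
  from compact_imp_bounded[OF this]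
  obtain M where M: "\<And>x. x \<in> cball 0 (R + norm v + norm v) \<Longrightarrow> norm (dir_deriv v F x) \<le> M"
    unfolding bounded_iff by blast
  have "(\<lambda>n. LINT x|lborel. D n x) \<longlonglongrightarrow> (LINT x|lborel. dir_deriv v F x)"
  proof (rule integral_dominated_convergence[where w = "\<lambda>x. M * indicator K' x"])
    show "dir_deriv v F \<in> borel_measurable lborel" by simp
    show "D n \<in> borel_measurable lborel" for n unfolding D_def by measurable
    show "integrable lborel (\<lambda>x. M * indicator K' x)"
      unfolding K'_def by (intro integrable_mult_right integrable_real_indicator emeasure_lborel_cball_finite) auto
    show "AE x in lborel. (\<lambda>n. D n x) \<longlonglongrightarrow> dir_deriv v F x"
    proof (intro AE_I2)
      fix x
      have "((\<lambda>r. F (x + r *\<^sub>R v)) has_derivative (\<lambda>k. k *\<^sub>R dir_deriv v F x)) (at 0)"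
        using line[of x 0] by (simp add: has_vector_derivative_def)
      then have "((\<lambda>y. (1 / norm (y - 0)) *\<^sub>R (F (x + y *\<^sub>R v) - (F (x + 0 *\<^sub>R v) + (y - 0) *\<^sub>R dir_deriv v F x)))
          \<longlongrightarrow> 0) (at 0)"
        unfolding has_derivative_within by simp
      moreover have "filterlim h (at 0) sequentially"
        using h_lim h(1) by (auto simp: filterlim_at intro!: always_eventually) (metis less_irrefl)
      ultimately have "(\<lambda>n. (1 / norm (h n - 0)) *\<^sub>R
          (F (x + h n *\<^sub>R v) - (F (x + 0 *\<^sub>R v) + (h n - 0) *\<^sub>R dir_deriv v F x))) \<longlonglongrightarrow> 0"
        by (rule filterlim_compose)
      moreover have "(1 / norm (h n - 0)) *\<^sub>R
          (F (x + h n *\<^sub>R v) - (F (x + 0 *\<^sub>R v) + (h n - 0) *\<^sub>R dir_deriv v F x))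
          = D n x - dir_deriv v F x" for n
        using h(1)[of n] by (simp add: D_def algebra_simps)
      ultimately have "(\<lambda>n. D n x - dir_deriv v F x) \<longlonglongrightarrow> 0" by simp
      then show "(\<lambda>n. D n x) \<longlonglongrightarrow> dir_deriv v F x" by (rule LIM_zero_cancel)
    qed
    show "AE x in lborel. norm (D n x) \<le> M * indicator K' x" for n
    proof (intro AE_I2)
      fix x
      show "norm (D n x) \<le> M * indicator K' x"
      proof (cases "x \<in> K'")
        case True
        have "norm (F (x + h n *\<^sub>R v) - F (x + 0 *\<^sub>R v)) \<le> M * \<bar>h n - 0\<bar>"
        proof (rule curve_increment_bound[OF line])
          fix r assume "\<bar>r - 0\<bar> \<le> \<bar>h n - 0\<bar>"
          then have "\<bar>r\<bar> \<le> 1" using h[of n] by simp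
          then have "norm (r *\<^sub>R v) \<le> norm v" by (simp add: mult_left_le_one_le)
          then have "norm (x + r *\<^sub>R v) \<le> R + norm v + norm v"
            using True norm_triangle_ineq[of x "r *\<^sub>R v"] by (simp add: K'_def dist_norm)
          then show "norm (dir_deriv v F (x + r *\<^sub>R v)) \<le> M" by (intro M) (simp only: mem_cball_0)
        qed
        with h(1)[of n] True show ?thesis
          unfolding D_def norm_scaleR by (simp add: pos_divide_le_eq)
      next
        case False
        then show ?thesis using supp_line[OF False, of "h n"] supp_line[OF False, of 0] h[of n]
          by (simp add: D_def)
      qed
    qed
  qed
  moreover have "(LINT x|lborel. D n x) = 0" for n
  proof -
    have F_int: "integrable lborel F" using contF K by (rule integrable_compact_support)
    have "integrable lborel (\<lambda>x. F (x + h n *\<^sub>R v))"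
      using lborel_integrable_translation[OF F_int, of "h n *\<^sub>R v"] by (simp add: add.commute)
    moreover have "(LINT x|lborel. F (x + h n *\<^sub>R v)) = (LINT x|lborel. F x)"
      using lborel_integral_translation[of F "h n *\<^sub>R v"] by (simp add: add.commute)
    ultimately show ?thesis using F_int unfolding D_def by simp
  qed
  ultimately show ?thesis by (simp add: LIMSEQ_const_iff)
qed

lemma integration_by_parts:
  fixes f g :: "'a::euclidean_space \<Rightarrow> complex"
  assumes f: "f \<in> test_functions UNIV" and g: "g \<in> test_functions UNIV" and b: "b \<in> Basis"
  shows "- (LINT x|lborel. f x * dir_deriv b g x) = (LINT x|lborel. dir_deriv b f x * g x)"
proof -
  have sf: "smooth f" "smooth (dir_deriv b f)" and sg: "smooth g" "smooth (dir_deriv b g)"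
    using f g b by (auto simp: test_functions_def smooth_dir_deriv)
  note cont = smooth_continuous_on[OF sf(1)] smooth_continuous_on[OF sf(2)]
    smooth_continuous_on[OF sg(1)] smooth_continuous_on[OF sg(2)]
  have D: "((\<lambda>x. f x * g x) has_derivative (\<lambda>v. f x * dir_deriv v g x + dir_deriv v f x * g x)) (at x)" for x
    by (intro has_derivative_mult smooth_has_derivative sf sg)
  have D_eq: "dir_deriv v (\<lambda>x. f x * g x) x = f x * dir_deriv v g x + dir_deriv v f x * g x" for v x
    using D by (rule dir_deriv_eqI)
  have compact: "compact (supp f)" using f by (simp add: test_functions_def)
  have z: "f x = 0" "dir_deriv b f x = 0" if "x \<notin> supp f" for x
    using that notin_supp supp_dir_deriv[of b f] by (auto intro: notin_supp)
  have "(LINT x|lborel. dir_deriv b (\<lambda>x. f x * g x) x) = 0"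
  proof (rule integral_dir_deriv_eq_0[OF _ _ compact])
    show "((\<lambda>x. f x * g x) has_derivative (\<lambda>v. dir_deriv v (\<lambda>x. f x * g x) x)) (at x)" for x
      unfolding D_eq by (rule D)
    show "continuous_on UNIV (dir_deriv b (\<lambda>x. f x * g x))"
      unfolding D_eq[abs_def] by (intro continuous_intros cont)
    show "f x * g x = 0" if "x \<notin> supp f" for x using z[OF that] by simp
  qed
  moreover have "integrable lborel (\<lambda>x. f x * dir_deriv b g x)" "integrable lborel (\<lambda>x. dir_deriv b f x * g x)"
    using z by (auto intro!: integrable_compact_support[OF _ compact] continuous_intros cont)
  ultimately show ?thesis unfolding D_eq by (simp add: add_eq_0_iff)
qed

subsection \<open>The fundamental lemma of the calculus of variations\<close>

text \<open>The measures with densities the positive and the negative part of \<open>f\<close> agree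
  on boxes, an intersection-stable generator of the Borel sets, hence everywhere. So the two
  densities coincide almost everywhere.\<close>

lemma AE_eq_0_if_box_integrals_eq_0:
  fixes f :: "'a::euclidean_space \<Rightarrow> real"
  assumes [measurable]: "f \<in> borel_measurable borel"
    and int: "\<And>a b. integrable lborel (\<lambda>x. indicator (box a b) x * f x)"
    and zero: "\<And>a b. (LINT x|lborel. indicator (box a b) x * f x) = 0"
  shows "AE x in lborel. f x = 0"
proof -
  have fin: "(\<integral>\<^sup>+x. ennreal (g x) * indicator (box a b) x \<partial>lborel) \<noteq> \<infinity>"
    if "g = f \<or> g = (\<lambda>x. - f x)" for g a b
  proof -
    have "(\<integral>\<^sup>+x. ennreal (g x) * indicator (box a b) x \<partial>lborel)
        \<le> (\<integral>\<^sup>+x. ennreal (norm (indicator (box a b) x * f x)) \<partial>lborel)"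
      using that by (intro nn_integral_mono) (auto simp: indicator_def intro!: ennreal_leI)
    then show ?thesis using int[of a b] unfolding integrable_iff_bounded by (auto simp: top_unique)
  qed
  \<comment> \<open>\<open>ennreal\<close> sends negative numbers to 0, so these densities are
    exactly the positive and the negative part of \<open>f\<close>.\<close>
  have "density lborel (\<lambda>x. ennreal (f x)) = density lborel (\<lambda>x. ennreal (- f x))"
  proof (rule measure_eqI_generator_eq[where E = "range (\<lambda>(a, b). box a b)" and \<Omega> = UNIV
        and A = "\<lambda>n. box (- real n *\<^sub>R One) (real n *\<^sub>R One)"])
    show "Int_stable (range (\<lambda>(a, b). box a b :: 'a set))"
      by (auto simp: Int_stable_def box_Int_box)
    show "sets (density lborel (\<lambda>x. ennreal (f x))) = sigma_sets UNIV (range (\<lambda>(a, b). box a b))"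
      "sets (density lborel (\<lambda>x. ennreal (- f x))) = sigma_sets UNIV (range (\<lambda>(a, b). box a b))"
      by (simp_all add: borel_eq_box)
    show "(\<Union>n. box (- real n *\<^sub>R One) (real n *\<^sub>R One)) = (UNIV :: 'a set)"
      using UN_box_eq_UNIV by simp
    show "emeasure (density lborel (\<lambda>x. ennreal (f x))) (box (- real n *\<^sub>R One) (real n *\<^sub>R One)) \<noteq> \<infinity>" for n
      using fin[of f "- real n *\<^sub>R One" "real n *\<^sub>R One"] by (simp add: emeasure_density)
    fix X :: "'a set" assume "X \<in> range (\<lambda>(a, b). box a b)"
    then obtain a b where X: "X = box a b" by auto
    define P where "P = (\<integral>\<^sup>+x. ennreal (f x) * indicator (box a b) x \<partial>lborel)"
    define N where "N = (\<integral>\<^sup>+x. ennreal (- f x) * indicator (box a b) x \<partial>lborel)"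
    have "P = (\<integral>\<^sup>+x. ennreal (indicator (box a b) x * f x) \<partial>lborel)"
      "N = (\<integral>\<^sup>+x. ennreal (- (indicator (box a b) x * f x)) \<partial>lborel)"
      unfolding P_def N_def by (auto intro!: nn_integral_cong simp: indicator_def)
    then have "0 = enn2real P - enn2real N"
      using zero[of a b] by (simp add: real_lebesgue_integral_def[OF int])
    moreover have "P \<noteq> \<infinity>" "N \<noteq> \<infinity>" unfolding P_def N_def by (rule fin, simp)+
    ultimately have "P = N"
      by (metis enn2real_nonneg ennreal_enn2real eq_iff_diff_eq_0 infinity_ennreal_def less_top)
    then show "emeasure (density lborel (\<lambda>x. ennreal (f x))) X = emeasure (density lborel (\<lambda>x. ennreal (- f x))) X"
      unfolding X P_def N_def by (simp add: emeasure_density)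
  qed auto
  then have "AE x in lborel. ennreal (f x) = ennreal (- f x)"
    by (intro sigma_finite_measure.density_unique[OF sigma_finite_lborel]) auto
  then show ?thesis
  proof (rule eventually_mono)
    fix x assume "ennreal (f x) = ennreal (- f x)"
    then show "f x = 0"
      using ennreal_neg[of "f x"] ennreal_neg[of "- f x"] by (cases "f x \<ge> 0") auto
  qed
qed

lemma square_integrable_mult:
  fixes f g :: "'a::euclidean_space \<Rightarrow> complex"
  assumes "square_integrable f" "square_integrable g"
  shows "integrable lborel (\<lambda>x. f x * g x)"
    and "(LINT x|lborel. norm (f x * g x)) \<le> (LINT x|lborel. (norm (f x))\<^sup>2) + (LINT x|lborel. (norm (g x))\<^sup>2)"
proof -
  have sum: "integrable lborel (\<lambda>x. (norm (f x))\<^sup>2 + (norm (g x))\<^sup>2)"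
    using assms by (auto simp: square_integrable_def)
  have le: "norm (f x * g x) \<le> (norm (f x))\<^sup>2 + (norm (g x))\<^sup>2" for x
    using sum_squares_bound[of "norm (f x)" "norm (g x)"]
      mult_nonneg_nonneg[OF norm_ge_zero[of "f x"] norm_ge_zero[of "g x"]] unfolding norm_mult by linarith
  show int: "integrable lborel (\<lambda>x. f x * g x)"
    using assms le by (intro Bochner_Integration.integrable_bound[OF sum]) (auto simp: square_integrable_def)
  have "(LINT x|lborel. norm (f x * g x)) \<le> (LINT x|lborel. (norm (f x))\<^sup>2 + (norm (g x))\<^sup>2)"
    using int sum le by (intro integral_mono) auto
  also have "\<dots> = (LINT x|lborel. (norm (f x))\<^sup>2) + (LINT x|lborel. (norm (g x))\<^sup>2)"
    using assms by (intro Bochner_Integration.integral_add) (auto simp: square_integrable_def)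
  finally show "(LINT x|lborel. norm (f x * g x)) \<le> (LINT x|lborel. (norm (f x))\<^sup>2) + (LINT x|lborel. (norm (g x))\<^sup>2)" .
qed

lemma square_integrable_box_integrable:
  assumes g: "square_integrable (g :: 'a::euclidean_space \<Rightarrow> complex)" and "bounded K" "K \<in> sets borel"
  shows "integrable lborel (\<lambda>x. indicator K x * norm (g x))"
proof (rule Bochner_Integration.integrable_bound)
  show "integrable lborel (\<lambda>x. indicator K x + (norm (g x))\<^sup>2)"
    using g assms(2,3) by (intro Bochner_Integration.integrable_add integrable_real_indicator emeasure_bounded_finite)
      (auto simp: square_integrable_def)
  show "(\<lambda>x. indicator K x * norm (g x)) \<in> borel_measurable lborel"
    using g assms(3) by (auto simp: square_integrable_def)
  have "y \<le> 1 + y\<^sup>2" for y :: real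
    using sum_squares_bound[of 1 y] zero_le_power2[of y] unfolding power_one mult_1_right by linarith
  then show "AE x in lborel. norm (indicator K x * norm (g x)) \<le> norm (indicator K x + (norm (g x))\<^sup>2)"
    by (intro AE_I2) (simp add: indicator_def)
qed

lemma square_integrable_translation:
  fixes g :: "'a::euclidean_space \<Rightarrow> complex"
  assumes g: "square_integrable g"
  shows "square_integrable (\<lambda>z. g (x + z))"
    and "(LINT z|lborel. (norm (g (x + z)))\<^sup>2) = (LINT z|lborel. (norm (g z))\<^sup>2)"
proof -
  have [measurable]: "g \<in> borel_measurable borel" using g by (rule square_integrable_measurable)
  show "square_integrable (\<lambda>z. g (x + z))"
    using g lborel_integrable_translation[of "\<lambda>z. (norm (g z))\<^sup>2" x] by (auto simp: square_integrable_def)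
  show "(LINT z|lborel. (norm (g (x + z)))\<^sup>2) = (LINT z|lborel. (norm (g z))\<^sup>2)"
    by (rule lborel_integral_translation) measurable
qed

text \<open>The translation is moved from \<open>g\<close> to the indicator of the box. Shifted
  indicators converge off the boundary, a null set, and the integrands are dominated by |g| on a
  fixed ball, so no continuity of \<open>g\<close> enters.\<close>

lemma box_average_continuous_at_0:
  fixes g :: "'a::euclidean_space \<Rightarrow> complex"
  assumes g: "square_integrable g"
  shows "((\<lambda>z. LINT x|lborel. indicator (box a b) x *\<^sub>R g (x + z)) \<longlongrightarrow>
      (LINT x|lborel. indicator (box a b) x *\<^sub>R g x)) (at 0)"
  unfolding LIMSEQ_SEQ_conv[symmetric]
proof (intro allI impI, elim conjE)
  fix S :: "nat \<Rightarrow> 'a" assume S: "S \<longlonglongrightarrow> 0"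
  have [measurable]: "g \<in> borel_measurable borel" using g by (rule square_integrable_measurable)
  let ?U = "box a b"
  have shift: "(LINT x|lborel. indicator ?U x *\<^sub>R g (x + z)) = (LINT y|lborel. indicator ?U (y - z) *\<^sub>R g y)" for z
    using lborel_integral_translation[of "\<lambda>y. indicator ?U (y - z) *\<^sub>R g y" z] by (simp add: add.commute)
  obtain R where R: "\<And>x. x \<in> ?U \<Longrightarrow> norm x \<le> R"
    using bounded_box[of a b] unfolding bounded_iff by blast
  obtain B where B: "\<And>n. norm (S n) \<le> B"
    using S by (meson BseqE convergentI convergent_imp_Bseq)
  let ?K = "cball (0::'a) (R + B)"
  have "(\<lambda>n. LINT y|lborel. indicator ?U (y - S n) *\<^sub>R g y) \<longlonglongrightarrow> (LINT y|lborel. indicator ?U y *\<^sub>R g y)"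
  proof (rule integral_dominated_convergence[where w = "\<lambda>y. indicator ?K y * norm (g y)"])
    show "integrable lborel (\<lambda>y. indicator ?K y * norm (g y))"
      using g by (rule square_integrable_box_integrable) auto
    show "AE y in lborel. norm (indicator ?U (y - S n) *\<^sub>R g y) \<le> indicator ?K y * norm (g y)" for n
    proof (intro AE_I2)
      fix y
      have "y \<in> ?K" if "y - S n \<in> ?U"
        using R[OF that] B[of n] norm_triangle_ineq[of "y - S n" "S n"] by simp
      then show "norm (indicator ?U (y - S n) *\<^sub>R g y) \<le> indicator ?K y * norm (g y)"
        by (auto simp: indicator_def)
    qed
    have "AE y in lborel. y \<notin> cbox a b - ?U"
    proof (rule AE_not_in)
      have "cbox a b - ?U \<in> null_sets lebesgue"
        using negligible_frontier_interval[of a b] by (simp add: negligible_iff_null_sets)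
      then show "cbox a b - ?U \<in> null_sets lborel" by (simp add: null_sets_completion_iff)
    qed
    then show "AE y in lborel. (\<lambda>n. indicator ?U (y - S n) *\<^sub>R g y) \<longlonglongrightarrow> indicator ?U y *\<^sub>R g y"
    proof (rule eventually_mono)
      fix y assume y: "y \<notin> cbox a b - ?U"
      have lim: "(\<lambda>n. y - S n) \<longlonglongrightarrow> y" using tendsto_diff[OF tendsto_const S, of y] by simp
      have "\<forall>\<^sub>F n in sequentially. indicator ?U (y - S n) = (indicator ?U y :: real)"
      proof (cases "y \<in> ?U")
        case True
        from topological_tendstoD[OF lim open_box True] show ?thesis
          by (rule eventually_mono) (use True in simp)
      next
        case False
        with y have "y \<in> - cbox a b" by simp
        from topological_tendstoD[OF lim _ this] show ?thesis
          by (rule eventually_mono) (use False box_subset_cbox[of a b] in \<open>auto simp: open_Compl indicator_def\<close>)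
      qed
      then show "(\<lambda>n. indicator ?U (y - S n) *\<^sub>R g y) \<longlonglongrightarrow> indicator ?U y *\<^sub>R g y"
        by (intro tendsto_scaleR tendsto_eventually tendsto_const)
    qed
  qed measurable
  then show "(\<lambda>n. LINT x|lborel. indicator ?U x *\<^sub>R g (x + S n)) \<longlonglongrightarrow> (LINT x|lborel. indicator ?U x *\<^sub>R g x)"
    by (simp add: shift)
qed

lemma lborel_integral_scale:
  fixes f :: "'a::euclidean_space \<Rightarrow> real"
  assumes [measurable]: "f \<in> borel_measurable borel" and "c > 0"
  shows "(LINT x|lborel. f x) = c ^ DIM('a) * (LINT x|lborel. f (c *\<^sub>R x))"
proof -
  have "(LINT x|lborel. f x) = (LINT x|density (distr lborel borel (\<lambda>x. 0 + c *\<^sub>R x)) (\<lambda>_. ennreal (\<bar>c\<bar> ^ DIM('a))). f x)"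
    using lborel_affine[of c "0::'a"] \<open>c > 0\<close> by simp
  also have "\<dots> = (LINT x|distr lborel borel (\<lambda>x. 0 + c *\<^sub>R x). (\<bar>c\<bar> ^ DIM('a)) *\<^sub>R f x)"
    by (rule integral_density) auto
  also have "\<dots> = (LINT x|lborel. (\<bar>c\<bar> ^ DIM('a)) *\<^sub>R f (0 + c *\<^sub>R x))"
    by (rule integral_distr) auto
  finally show ?thesis using \<open>c > 0\<close> by simp
qed

text \<open>Fubini exchanges the average over the box with the mollification, which vanishes at
  every point by assumption. Integrability on the product holds because the inner integral is
  bounded uniformly in x by the two L^2 norms and the box is bounded.\<close>

lemma mollified_box_average_eq_0:
  fixes g :: "'a::euclidean_space \<Rightarrow> complex" and \<rho> :: "'a \<Rightarrow> complex" and a b :: 'a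
  assumes g: "square_integrable g" and \<rho>: "square_integrable \<rho>"
    and zero: "\<And>x. (LINT z|lborel. g (x + z) * \<rho> z) = 0"
  defines "H \<equiv> \<lambda>z. LINT x|lborel. indicator (box a b) x *\<^sub>R g (x + z)"
  shows "integrable lborel (\<lambda>z. H z * \<rho> z)" and "(LINT z|lborel. H z * \<rho> z) = 0"
proof -
  have [measurable]: "g \<in> borel_measurable borel" "\<rho> \<in> borel_measurable borel"
    using g \<rho> by (auto intro: square_integrable_measurable)
  let ?U = "box a b"
  define f where "f = (\<lambda>(x, z). indicator ?U x *\<^sub>R (g (x + z) * \<rho> z))"
  have [measurable]: "f \<in> borel_measurable (lborel \<Otimes>\<^sub>M lborel)"
    unfolding f_def by measurable
  define B where "B = (LINT z|lborel. (norm (g z))\<^sup>2) + (LINT z|lborel. (norm (\<rho> z))\<^sup>2)"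
  have "integrable (lborel \<Otimes>\<^sub>M lborel) f"
  proof (rule lborel_pair.Fubini_integrable)
    show "AE x in lborel. integrable lborel (\<lambda>z. f (x, z))"
      unfolding f_def using square_integrable_mult(1)[OF square_integrable_translation(1)[OF g] \<rho>] by simp
    show "integrable lborel (\<lambda>x. LINT z|lborel. norm (f (x, z)))"
    proof (rule Bochner_Integration.integrable_bound)
      show "integrable lborel (\<lambda>x. B * indicator ?U x)"
        by (intro integrable_mult_right integrable_real_indicator emeasure_bounded_finite) auto
      show "(\<lambda>x. LINT z|lborel. norm (f (x, z))) \<in> borel_measurable lborel" by measurable
      have "(LINT z|lborel. norm (g (x + z) * \<rho> z)) \<le> B" for x
        using square_integrable_mult(2)[OF square_integrable_translation(1)[OF g] \<rho>, of x]
        by (simp add: B_def square_integrable_translation(2)[OF g])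
      then show "AE x in lborel. norm (LINT z|lborel. norm (f (x, z))) \<le> norm (B * indicator ?U x)"
        unfolding f_def by (auto simp: indicator_def intro: order_trans[OF _ abs_ge_self])
    qed
  qed measurable
  then have int: "integrable (lborel \<Otimes>\<^sub>M lborel) (\<lambda>(x, z). indicator ?U x *\<^sub>R (g (x + z) * \<rho> z))"
    by (simp add: f_def)
  have H: "(LINT x|lborel. indicator ?U x *\<^sub>R (g (x + z) * \<rho> z)) = H z * \<rho> z" for z
  proof -
    have "(LINT x|lborel. indicator ?U x *\<^sub>R (g (x + z) * \<rho> z)) = (LINT x|lborel. (indicator ?U x *\<^sub>R g (x + z)) * \<rho> z)"
      by simp
    then show ?thesis unfolding H_def by (simp only: integral_mult_left_zero)
  qed
  show "integrable lborel (\<lambda>z. H z * \<rho> z)"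
    using lborel_pair.integrable_snd[OF int] by (simp only: H)
  have "(LINT z|lborel. H z * \<rho> z) = (LINT z|lborel. LINT x|lborel. indicator ?U x *\<^sub>R (g (x + z) * \<rho> z))"
    by (simp only: H)
  also have "\<dots> = (LINT x|lborel. LINT z|lborel. indicator ?U x *\<^sub>R (g (x + z) * \<rho> z))"
    using int by (rule lborel_pair.Fubini_integral)
  also have "\<dots> = 0" by (simp add: zero)
  finally show "(LINT z|lborel. H z * \<rho> z) = 0" .
qed

text \<open>Let H(z) be the integral of g(x + z) over a box. It is continuous at 0, and its integral
  against every rescaled mollifier rho vanishes, so H(0) times the integral of rho is the integral
  of (H(0) - H) rho, small once rho is concentrated near 0. Hence H(0) = 0 for all boxes. The given
  mollifier supplies the test functions, so no bump function has to be constructed.\<close>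

lemma fundamental_lemma:
  fixes g :: "'a::euclidean_space \<Rightarrow> complex" and \<psi> :: "'a \<Rightarrow> real"
  assumes \<psi>: "friedrichs_mollifier \<psi>" and g: "square_integrable g"
    and zero: "\<And>\<phi>. \<phi> \<in> test_functions UNIV \<Longrightarrow> (LINT x|lborel. g x * \<phi> x) = 0"
  shows "AE x in lborel. g x = 0"
proof -
  have \<psi>_test: "\<psi> \<in> test_functions UNIV" and \<psi>_nonneg: "\<And>x. 0 \<le> \<psi> x" and \<psi>_int: "(LINT x|lborel. \<psi> x) = 1"
    using \<psi> by (auto simp: friedrichs_mollifier_def)
  have [measurable]: "g \<in> borel_measurable borel" "\<psi> \<in> borel_measurable borel"
    using g \<psi>_test by (auto intro: square_integrable_measurable test_function_measurable)
  obtain r where r: "r > 0" "\<And>z. \<psi> z \<noteq> 0 \<Longrightarrow> norm z \<le> r"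
  proof -
    have "bounded (supp \<psi>)" using \<psi>_test by (simp add: test_functions_def compact_imp_bounded)
    then obtain r where "\<And>z. z \<in> supp \<psi> \<Longrightarrow> norm z \<le> r" unfolding bounded_iff by blast
    then show thesis using notin_supp[of _ \<psi>] by (intro that[of "max r 1"]) (auto simp: le_max_iff_disj)
  qed
  have box0: "(LINT x|lborel. indicator (box a b) x *\<^sub>R g x) = 0" for a b
  proof -
    define H where "H z = (LINT x|lborel. indicator (box a b) x *\<^sub>R g (x + z))" for z
    have "norm (H 0) \<le> e" if "e > 0" for e
    proof -
      have "(H \<longlongrightarrow> H 0) (at 0)" unfolding H_def using box_average_continuous_at_0[OF g] by simp
      then obtain d where d: "d > 0" "\<And>z. z \<noteq> 0 \<Longrightarrow> norm z < d \<Longrightarrow> norm (H z - H 0) < e"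
        using \<open>e > 0\<close> unfolding LIM_def dist_norm by (metis diff_zero)
      have H_close: "norm (H 0 - H z) \<le> e" if "norm z < d" for z
        using d(2)[OF _ that] \<open>e > 0\<close> by (cases "z = 0") (auto simp: norm_minus_commute[of "H 0"] less_imp_le)
      \<comment> \<open>The mollifier lives in the ball of radius \<open>r\<close>, hence its
        rescaling in the ball of radius r / c = d / 2, strictly inside the range where H is close to
        H(0).\<close>
      define c where "c = 2 * r / d"
      have "c > 0" using d(1) r(1) by (simp add: c_def)
      define \<rho> where "\<rho> z = \<psi> (c *\<^sub>R z)" for z
      have \<rho>_near: "norm z < d" if "\<rho> z \<noteq> 0" for z
      proof -
        have "c * norm z \<le> r" using r(2)[of "c *\<^sub>R z"] that \<open>c > 0\<close> by (simp add: \<rho>_def)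
        then have "norm z \<le> d / 2" using d(1) r(1) by (simp add: c_def field_simps)
        then show ?thesis using d(1) by simp
      qed
      have \<rho>_test: "(\<lambda>z. complex_of_real (\<rho> z)) \<in> test_functions UNIV"
        using test_functions_rescale[OF \<psi>_test \<open>c > 0\<close>, of 0] by (simp add: \<rho>_def)
      then have \<rho>_sq: "square_integrable (\<lambda>z. complex_of_real (\<rho> z))" by (rule test_function_square_integrable)
      have zero': "(LINT z|lborel. g (x + z) * complex_of_real (\<rho> z)) = 0" for x
      proof -
        have "(LINT z|lborel. g (x + z) * complex_of_real (\<psi> (c *\<^sub>R (x + z - x))))
            = (LINT y|lborel. g y * complex_of_real (\<psi> (c *\<^sub>R (y - x))))"
          by (rule lborel_integral_translation) measurable
        also have "\<dots> = 0" by (intro zero test_functions_rescale \<psi>_test \<open>c > 0\<close>)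
        finally show ?thesis by (simp add: \<rho>_def)
      qed
      note H\<rho> = mollified_box_average_eq_0[OF g \<rho>_sq zero', of a b, folded H_def]
      have \<rho>_int: "(LINT z|lborel. \<rho> z) > 0"
      proof -
        have "0 < c ^ DIM('a) * (LINT z|lborel. \<rho> z)"
          using lborel_integral_scale[of \<psi> c] \<psi>_int \<open>c > 0\<close> by (simp add: \<rho>_def)
        then show ?thesis using \<open>c > 0\<close> by (simp add: zero_less_mult_iff)
      qed
      \<comment> \<open>The integral of a non-integrable function is 0 by convention, so a positive
        value certifies integrability.\<close>
      have \<rho>_integrable: "integrable lborel \<rho>"
        using \<rho>_int not_integrable_integral_eq by fastforce
      have "norm (H 0) * (LINT z|lborel. \<rho> z) = norm (LINT z|lborel. (H 0 - H z) * complex_of_real (\<rho> z))"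
      proof -
        have "(LINT z|lborel. (H 0 - H z) * complex_of_real (\<rho> z))
            = (LINT z|lborel. H 0 * complex_of_real (\<rho> z)) - (LINT z|lborel. H z * complex_of_real (\<rho> z))"
          unfolding left_diff_distrib
          by (intro Bochner_Integration.integral_diff H\<rho>(1)) (simp add: \<rho>_integrable)
        also have "\<dots> = H 0 * complex_of_real (LINT z|lborel. \<rho> z)" by (simp add: H\<rho>(2))
        finally show ?thesis using \<rho>_int by (simp add: norm_mult)
      qed
      also have "\<dots> \<le> (LINT z|lborel. e * \<rho> z)"
      proof (rule order_trans[OF integral_norm_bound], rule integral_mono_AE)
        have "integrable lborel (\<lambda>z. (H 0 - H z) * complex_of_real (\<rho> z))"
          unfolding left_diff_distrib
          by (intro Bochner_Integration.integrable_diff H\<rho>(1)) (simp add: \<rho>_integrable)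
        then show "integrable lborel (\<lambda>z. norm ((H 0 - H z) * complex_of_real (\<rho> z)))" by simp
        show "integrable lborel (\<lambda>z. e * \<rho> z)" using \<rho>_integrable by simp
        show "AE z in lborel. norm ((H 0 - H z) * complex_of_real (\<rho> z)) \<le> e * \<rho> z"
        proof (intro AE_I2)
          fix z show "norm ((H 0 - H z) * complex_of_real (\<rho> z)) \<le> e * \<rho> z"
            using H_close[OF \<rho>_near, of z] \<psi>_nonneg[of "c *\<^sub>R z"]
            by (cases "\<rho> z = 0") (auto simp: norm_mult \<rho>_def intro!: mult_right_mono)
        qed
      qed
      also have "\<dots> = e * (LINT z|lborel. \<rho> z)" by simp
      finally show ?thesis using \<rho>_int by simp
    qed
    then have "norm (H 0) \<le> 0" by (rule dense_ge)
    then show ?thesis by (simp add: H_def)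
  qed
  have int: "integrable lborel (\<lambda>x. indicator (box a b) x *\<^sub>R g x)" for a b
  proof (rule Bochner_Integration.integrable_bound)
    show "integrable lborel (\<lambda>x. indicator (box a b) x * norm (g x))"
      using g by (rule square_integrable_box_integrable) auto
  qed (simp_all add: indicator_def)
  have "AE x in lborel. Re (g x) = 0"
  proof (rule AE_eq_0_if_box_integrals_eq_0)
    show "integrable lborel (\<lambda>x. indicator (box a b) x * Re (g x))" for a b
      using integrable_Re[OF int[of a b]] by simp
    show "(LINT x|lborel. indicator (box a b) x * Re (g x)) = 0" for a b
      using integral_Re[OF int[of a b]] box0 by simp
  qed measurable
  moreover have "AE x in lborel. Im (g x) = 0"
  proof (rule AE_eq_0_if_box_integrals_eq_0)
    show "integrable lborel (\<lambda>x. indicator (box a b) x * Im (g x))" for a b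
      using integrable_Im[OF int[of a b]] by simp
    show "(LINT x|lborel. indicator (box a b) x * Im (g x)) = 0" for a b
      using integral_Im[OF int[of a b]] box0 by simp
  qed measurable
  ultimately show ?thesis by eventually_elim (simp add: complex_eq_iff)
qed

subsection \<open>The energy space\<close>

lemma square_integrable_linear:
  assumes L: "bounded_linear L" and f: "square_integrable f"
  shows "square_integrable (\<lambda>x. L (f x))"
proof -
  obtain M where M: "\<And>y. norm (L y) \<le> norm y * M" using bounded_linear.bounded[OF L] by blast
  show ?thesis
  proof (rule square_integrable_dominated)
    show "(\<lambda>x. L (f x)) \<in> borel_measurable borel"
      using square_integrable_measurable[OF f] borel_measurable_continuous_onI[OF linear_continuous_on[OF L]]
      by (rule measurable_compose)
    show "integrable lborel (\<lambda>x. (norm (f x))\<^sup>2 * M\<^sup>2)"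
      using f unfolding square_integrable_def by (intro integrable_mult_left) simp
    show "AE x in lborel. (norm (L (f x)))\<^sup>2 \<le> (norm (f x))\<^sup>2 * M\<^sup>2"
      unfolding power_mult_distrib[symmetric] by (intro AE_I2 power_mono M norm_ge_zero)
  qed
qed

lemma square_integrable_Pair:
  assumes "square_integrable f" "square_integrable g"
  shows "square_integrable (\<lambda>x. (f x, g x))"
proof -
  have "integrable lborel (\<lambda>x. (norm (f x))\<^sup>2 + (norm (g x))\<^sup>2)"
    using assms unfolding square_integrable_def by (intro Bochner_Integration.integrable_add) simp_all
  moreover have "(\<lambda>x. (f x, g x)) \<in> borel_measurable borel"
    using assms[THEN square_integrable_measurable] by (rule borel_measurable_Pair)
  ultimately show ?thesis unfolding square_integrable_def by (simp add: norm_Pair)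
qed

lemma square_integrable_bounded_scaleR:
  assumes s: "s \<in> borel_measurable borel" "AE x in lborel. \<bar>s x\<bar> \<le> B" and f: "square_integrable f"
  shows "square_integrable (\<lambda>x. s x *\<^sub>R f x)"
proof (rule square_integrable_dominated)
  show "(\<lambda>x. s x *\<^sub>R f x) \<in> borel_measurable borel"
    using s(1) square_integrable_measurable[OF f] by measurable
  show "integrable lborel (\<lambda>x. B\<^sup>2 * (norm (f x))\<^sup>2)"
    using f by (auto simp: square_integrable_def)
  show "AE x in lborel. (norm (s x *\<^sub>R f x))\<^sup>2 \<le> B\<^sup>2 * (norm (f x))\<^sup>2"
    using s(2)
  proof (rule eventually_mono)
    fix x assume "\<bar>s x\<bar> \<le> B"
    then have "(s x)\<^sup>2 \<le> B\<^sup>2" by (metis abs_ge_zero power2_abs power_mono)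
    then show "(norm (s x *\<^sub>R f x))\<^sup>2 \<le> B\<^sup>2 * (norm (f x))\<^sup>2"
      by (simp add: power_mult_distrib mult_right_mono)
  qed
qed

lemma L2_space_iff: "f \<in> L2_space \<longleftrightarrow> square_integrable f"
  by (auto simp: L2_space_def square_integrable_def)

lemma L2_norm_power2: "(L2_norm f)\<^sup>2 = (LINT x|lborel. (norm (f x))\<^sup>2)"
  by (simp add: L2_norm_def)

lemma H1_norm_nonneg: "0 \<le> H1_norm f"
  unfolding H1_norm_def by (intro real_sqrt_ge_zero add_nonneg_nonneg sum_nonneg) auto

text \<open>A state \<open>(f, (Re G, Im G), h)\<close> records a function, its weak gradient and \<open>s f\<close> with
  \<open>s\<^sup>2 = q\<close>, so that its \<open>L\<^sup>2\<close> norm is the form norm of \<open>1 - \<Delta> + q\<close>.\<close>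

type_synonym 'a state = "complex \<times> ('a \<times> 'a) \<times> complex"

text \<open>The complex gradient is stored as two real vectors, its real and imaginary parts; the
  states thus form a Euclidean space whose norm contains exactly the norm of the complex
  gradient.\<close>

definition grad_component :: "'a::euclidean_space \<Rightarrow> 'a state \<Rightarrow> complex"
  where "grad_component b y = Complex (fst (fst (snd y)) \<bullet> b) (snd (fst (snd y)) \<bullet> b)"

lemma bounded_linear_grad_component: "bounded_linear (grad_component b)"
proof -
  have "grad_component b = (\<lambda>y. complex_of_real (fst (fst (snd y)) \<bullet> b) + \<i> * complex_of_real (snd (fst (snd y)) \<bullet> b))"
    by (auto simp: grad_component_def fun_eq_iff complex_eq_iff)
  moreover have "bounded_linear \<dots>"
    by (intro bounded_linear_intros bounded_linear_compose[OF bounded_linear_of_real]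
        bounded_linear_compose[OF bounded_linear_inner_left]
        bounded_linear_compose[OF bounded_linear_fst] bounded_linear_compose[OF bounded_linear_snd]
        bounded_linear_fst bounded_linear_snd)
  ultimately show ?thesis by simp
qed

definition admissible :: "('a::euclidean_space \<Rightarrow> real) \<Rightarrow> ('a \<Rightarrow> 'a state) \<Rightarrow> bool"
  where "admissible s F \<longleftrightarrow>
    (\<forall>b\<in>Basis. is_weak_deriv b (\<lambda>x. fst (F x)) (\<lambda>x. grad_component b (F x))) \<and>
    (AE x in lborel. snd (snd (F x)) = s x *\<^sub>R fst (F x))"

text \<open>The conjugate and the sign are arranged so that the real inner product with a state (f,
  G, h) is Re (f d_b phi + G_b phi). Orthogonality in L^2 is therefore the real part of the identity
  defining the weak derivative.\<close>

definition grad_constraint :: "'a::euclidean_space \<Rightarrow> ('a \<Rightarrow> complex) \<Rightarrow> 'a \<Rightarrow> 'a state"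
  where "grad_constraint b \<phi> x = (cnj (dir_deriv b \<phi> x), (Re (\<phi> x) *\<^sub>R b, - Im (\<phi> x) *\<^sub>R b), 0)"

definition potential_constraint :: "('a::euclidean_space \<Rightarrow> real) \<Rightarrow> ('a \<Rightarrow> complex) \<Rightarrow> 'a \<Rightarrow> 'a state"
  where "potential_constraint s \<zeta> x = (- (s x *\<^sub>R \<zeta> x), 0, \<zeta> x)"

lemma grad_constraint_square_integrable:
  assumes "\<phi> \<in> test_functions UNIV" "b \<in> Basis"
  shows "square_integrable (grad_constraint b \<phi>)"
proof -
  have \<phi>: "square_integrable \<phi>" "square_integrable (dir_deriv b \<phi>)"
    using assms by (auto intro!: test_function_square_integrable test_functions_dir_deriv)
  have "bounded_linear (\<lambda>z. Re z *\<^sub>R b)" "bounded_linear (\<lambda>z. - Im z *\<^sub>R b)"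
    by (intro bounded_linear_scaleR_const bounded_linear_Re bounded_linear_minus bounded_linear_Im)+
  then show ?thesis
    unfolding grad_constraint_def[abs_def]
    by (intro square_integrable_Pair square_integrable_zero square_integrable_linear[OF bounded_linear_cnj]
        square_integrable_linear[of "\<lambda>z. Re z *\<^sub>R b"] square_integrable_linear[of "\<lambda>z. - Im z *\<^sub>R b"] \<phi>)
qed

lemma inner_grad_constraint:
  assumes F: "square_integrable F" and \<phi>: "\<phi> \<in> test_functions UNIV" and b: "b \<in> Basis"
  shows "(LINT x|lborel. F x \<bullet> grad_constraint b \<phi> x)
    = Re ((LINT x|lborel. fst (F x) * dir_deriv b \<phi> x) + (LINT x|lborel. grad_component b (F x) * \<phi> x))"
proof -
  have sq: "square_integrable \<phi>" "square_integrable (dir_deriv b \<phi>)"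
    using \<phi> b by (auto intro!: test_function_square_integrable test_functions_dir_deriv)
  have int: "integrable lborel (\<lambda>x. fst (F x) * dir_deriv b \<phi> x)" "integrable lborel (\<lambda>x. grad_component b (F x) * \<phi> x)"
    by (intro square_integrable_mult square_integrable_linear[OF bounded_linear_fst] sq
        square_integrable_linear[OF bounded_linear_grad_component] F)+
  have "F x \<bullet> grad_constraint b \<phi> x = Re (fst (F x) * dir_deriv b \<phi> x + grad_component b (F x) * \<phi> x)" for x
  proof -
    obtain f p r h where "F x = (f, (p, r), h)" by (metis surj_pair)
    then show ?thesis
      by (simp add: grad_constraint_def grad_component_def inner_Pair inner_complex_def algebra_simps)
  qed
  then have "(LINT x|lborel. F x \<bullet> grad_constraint b \<phi> x)
      = (LINT x|lborel. Re (fst (F x) * dir_deriv b \<phi> x + grad_component b (F x) * \<phi> x))" by simp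
  also have "\<dots> = Re (LINT x|lborel. fst (F x) * dir_deriv b \<phi> x + grad_component b (F x) * \<phi> x)"
    using int by (intro integral_Re) auto
  also have "\<dots> = Re ((LINT x|lborel. fst (F x) * dir_deriv b \<phi> x) + (LINT x|lborel. grad_component b (F x) * \<phi> x))"
    using int by simp
  finally show ?thesis .
qed

text \<open>Only real parts are visible to the real inner product. Replacing phi by i phi turns the
  imaginary part into a real part, so testing with all phi recovers the complex identity.\<close>

lemma is_weak_deriv_iff_grad_constraint:
  assumes F: "square_integrable F" and b: "b \<in> Basis"
  shows "is_weak_deriv b (\<lambda>x. fst (F x)) (\<lambda>x. grad_component b (F x)) \<longleftrightarrow>
    (\<forall>\<phi>\<in>test_functions UNIV. (LINT x|lborel. F x \<bullet> grad_constraint b \<phi> x) = 0)"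
proof -
  define \<Lambda> where "\<Lambda> \<phi> = (LINT x|lborel. fst (F x) * dir_deriv b \<phi> x) + (LINT x|lborel. grad_component b (F x) * \<phi> x)" for \<phi>
  have weak: "is_weak_deriv b (\<lambda>x. fst (F x)) (\<lambda>x. grad_component b (F x)) \<longleftrightarrow> (\<forall>\<phi>\<in>test_functions UNIV. \<Lambda> \<phi> = 0)"
    unfolding is_weak_deriv_def distr_deriv_def regular_distr_def \<Lambda>_def by (simp add: neg_eq_iff_add_eq_0)
  have Re: "(LINT x|lborel. F x \<bullet> grad_constraint b \<phi> x) = Re (\<Lambda> \<phi>)" if "\<phi> \<in> test_functions UNIV" for \<phi>
    unfolding \<Lambda>_def using F that b by (rule inner_grad_constraint)
  have "\<Lambda> \<phi> = 0" if *: "\<forall>\<phi>\<in>test_functions UNIV. Re (\<Lambda> \<phi>) = 0" and \<phi>: "\<phi> \<in> test_functions UNIV" for \<phi>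
  proof -
    have bl: "bounded_linear (\<lambda>z. \<i> * z)" by (rule bounded_linear_mult_right)
    have "dir_deriv b (\<lambda>x. \<i> * \<phi> x) x = \<i> * dir_deriv b \<phi> x" for x
      using \<phi> by (intro dir_deriv_linear[OF bl]) (simp add: test_functions_def)
    then have "\<Lambda> (\<lambda>x. \<i> * \<phi> x) = \<i> * \<Lambda> \<phi>"
      unfolding \<Lambda>_def by (simp add: mult.left_commute[of _ \<i>] distrib_left)
    moreover have "Re (\<Lambda> (\<lambda>x. \<i> * \<phi> x)) = 0" using * test_functions_linear[OF bl \<phi>] by blast
    ultimately show ?thesis using * \<phi> by (simp add: complex_eq_iff)
  qed
  then show ?thesis unfolding weak using Re by auto
qed

section \<open>The energy space as a closed subspace of L^2\<close>

text \<open>Here \<open>s\<close> stands for the square root of the potential. A mollifier is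
  carried along because the fundamental lemma, and with it the uniqueness of weak derivatives, draws
  its test functions from it.\<close>

locale potential =
  fixes s :: "'a::euclidean_space \<Rightarrow> real" and B :: real and \<psi> :: "'a \<Rightarrow> real"
  assumes s_measurable [measurable]: "s \<in> borel_measurable borel"
    and s_bound: "AE x in lborel. \<bar>s x\<bar> \<le> B"
    and mollifier: "friedrichs_mollifier \<psi>"
begin

lemma potential_constraint_square_integrable:
  "square_integrable \<zeta> \<Longrightarrow> square_integrable (potential_constraint s \<zeta>)"
  unfolding potential_constraint_def[abs_def]
  by (intro square_integrable_Pair square_integrable_zero square_integrable_minus
      square_integrable_bounded_scaleR[OF s_measurable s_bound])

text \<open>Each constraint is a vector of L^2, so the admissible states form an intersection of
  hyperplanes. Linearity and closedness of \<open>W\<close>, that is the completeness of H^1, follow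
  at once.\<close>

definition constraints :: "('a \<Rightarrow> 'a state) set"
  where "constraints = {grad_constraint b \<phi> | b \<phi>. b \<in> Basis \<and> \<phi> \<in> test_functions UNIV} \<union>
    {potential_constraint s \<zeta> | \<zeta>. square_integrable \<zeta>}"

lemma constraints_square_integrable: "K \<in> constraints \<Longrightarrow> square_integrable K"
  by (auto simp: constraints_def grad_constraint_square_integrable potential_constraint_square_integrable)

text \<open>For the potential part, the defect d = h - s f is square integrable since
  \<open>s\<close> is bounded, so it may be used as its own test function; then the integral of
  |d|^2 vanishes.\<close>

lemma admissible_iff:
  assumes F: "square_integrable F"
  shows "admissible s F \<longleftrightarrow> (\<forall>K\<in>constraints. (LINT x|lborel. F x \<bullet> K x) = 0)"
proof -
  define d where "d x = snd (snd (F x)) - s x *\<^sub>R fst (F x)" for x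
  have d: "square_integrable d"
    unfolding d_def[abs_def]
    by (intro square_integrable_diff square_integrable_bounded_scaleR[OF s_measurable s_bound]
        square_integrable_linear[OF bounded_linear_fst] square_integrable_linear[OF bounded_linear_snd] F)
  have inner_d: "F x \<bullet> potential_constraint s \<zeta> x = d x \<bullet> \<zeta> x" for \<zeta> x
    by (cases "F x") (simp add: potential_constraint_def d_def inner_diff)
  have "(\<forall>\<zeta>. square_integrable \<zeta> \<longrightarrow> (LINT x|lborel. d x \<bullet> \<zeta> x) = 0) \<longleftrightarrow> (AE x in lborel. d x = 0)"
  proof
    assume "\<forall>\<zeta>. square_integrable \<zeta> \<longrightarrow> (LINT x|lborel. d x \<bullet> \<zeta> x) = 0"
    then have "(LINT x|lborel. d x \<bullet> d x) = 0" using d by blast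
    then show "AE x in lborel. d x = 0"
      using integral_nonneg_eq_0_iff_AE[OF square_integrable_inner[OF d d]] by simp
  next
    assume *: "AE x in lborel. d x = 0"
    show "\<forall>\<zeta>. square_integrable \<zeta> \<longrightarrow> (LINT x|lborel. d x \<bullet> \<zeta> x) = 0"
    proof (intro allI impI)
      fix \<zeta> :: "'a \<Rightarrow> complex" assume "square_integrable \<zeta>"
      show "(LINT x|lborel. d x \<bullet> \<zeta> x) = 0"
        using * by (intro integral_eq_zero_AE) (auto elim: eventually_mono)
    qed
  qed
  moreover have "(AE x in lborel. d x = 0) \<longleftrightarrow> (AE x in lborel. snd (snd (F x)) = s x *\<^sub>R fst (F x))"
    by (simp add: d_def)
  ultimately show ?thesis
    unfolding admissible_def ball_Un constraints_def using is_weak_deriv_iff_grad_constraint[OF F]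
    by (simp add: inner_d[symmetric]) fast
qed

definition W :: "('a, 'a state) l2 set"
  where "W = {U. \<forall>K\<in>constraints. U \<bullet> abs_l2 K = 0}"

lemma subspace_W: "subspace W"
  by (auto simp: subspace_def W_def inner_add)

lemma closed_W: "closed W"
proof -
  have "W = (\<Inter>K\<in>constraints. {U. U \<bullet> abs_l2 K = 0})" by (auto simp: W_def)
  then show ?thesis by (auto intro!: closed_INT closed_Collect_eq continuous_intros)
qed

lemma abs_l2_in_W_iff: "square_integrable F \<Longrightarrow> abs_l2 F \<in> W \<longleftrightarrow> admissible s F"
  by (simp add: W_def admissible_iff inner_abs_l2 constraints_square_integrable)

lemma W_iff: "U \<in> W \<longleftrightarrow> admissible s (rep_l2 U)"
  using abs_l2_in_W_iff[OF square_integrable_rep[of U]] by simp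

text \<open>\<open>weak_deriv\<close> is an arbitrary choice, about which only its defining property
  is known. By the fundamental lemma any other weak derivative agrees with it almost everywhere, so
  \<open>H1_norm\<close> can be computed from whichever one is at hand.\<close>

lemma weak_deriv_unique:
  fixes f g :: "'a \<Rightarrow> complex"
  assumes f: "square_integrable f" and g: "square_integrable g" and fg: "is_weak_deriv b f g"
  shows "L2_norm (weak_deriv b f) = L2_norm g"
proof -
  have "weak_deriv b f \<in> L2_space \<and> is_weak_deriv b f (weak_deriv b f)"
    unfolding weak_deriv_def by (rule someI[of _ g]) (use g fg in \<open>simp add: L2_space_iff\<close>)
  then have w: "square_integrable (weak_deriv b f)" "is_weak_deriv b f (weak_deriv b f)"
    by (auto simp: L2_space_iff)
  have "AE x in lborel. weak_deriv b f x - g x = 0"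
  proof (rule fundamental_lemma[OF mollifier])
    show "square_integrable (\<lambda>x. weak_deriv b f x - g x)" using w(1) g by (rule square_integrable_diff)
    fix \<phi> :: "'a \<Rightarrow> complex" assume \<phi>: "\<phi> \<in> test_functions UNIV"
    have int: "integrable lborel (\<lambda>x. weak_deriv b f x * \<phi> x)" "integrable lborel (\<lambda>x. g x * \<phi> x)"
      by (intro square_integrable_mult w g test_function_square_integrable[OF \<phi>])+
    have "(LINT x|lborel. weak_deriv b f x * \<phi> x) = (LINT x|lborel. g x * \<phi> x)"
      using w(2) fg \<phi> unfolding is_weak_deriv_def regular_distr_def by metis
    then show "(LINT x|lborel. (weak_deriv b f x - g x) * \<phi> x) = 0"
      using int by (simp add: left_diff_distrib)
  qed
  then have "AE x in lborel. (norm (weak_deriv b f x))\<^sup>2 = (norm (g x))\<^sup>2" by (auto elim: eventually_mono)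
  then show ?thesis
    unfolding L2_norm_def using w(1) g
    by (intro arg_cong[where f = sqrt] integral_cong_AE) (auto simp: square_integrable_def)
qed

text \<open>Expanding the gradient in the orthonormal basis splits the norm of a state into the
  squared H^1 norm and a remainder. Since h = s f for admissible states, this remainder is the
  potential energy.\<close>

lemma admissible_energy:
  assumes F: "square_integrable F" "admissible s F"
  shows "(\<lambda>x. fst (F x)) \<in> H1_space"
    and "(norm (abs_l2 F))\<^sup>2 = (H1_norm (\<lambda>x. fst (F x)))\<^sup>2 + (LINT x|lborel. (norm (snd (snd (F x))))\<^sup>2)"
proof -
  have f: "square_integrable (\<lambda>x. fst (F x))" and g: "\<And>b. square_integrable (\<lambda>x. grad_component b (F x))"
    and h: "square_integrable (\<lambda>x. snd (snd (F x)))"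
    by (intro square_integrable_linear[OF bounded_linear_fst] square_integrable_linear[OF bounded_linear_grad_component]
        square_integrable_linear[OF bounded_linear_snd] F)+
  have weak: "is_weak_deriv b (\<lambda>x. fst (F x)) (\<lambda>x. grad_component b (F x))" if "b \<in> Basis" for b
    using F(2) that by (simp add: admissible_def)
  show "(\<lambda>x. fst (F x)) \<in> H1_space"
    unfolding H1_space_def mem_Collect_eq L2_space_iff
  proof (intro conjI ballI f)
    fix b :: 'a assume "b \<in> Basis"
    from weak[OF this] g[of b]
    show "\<exists>g\<in>L2_space. is_weak_deriv b (\<lambda>x. fst (F x)) g"
      by (intro bexI[of _ "\<lambda>x. grad_component b (F x)"]) (simp_all add: L2_space_iff)
  qed
  have H1: "(H1_norm (\<lambda>x. fst (F x)))\<^sup>2 = (LINT x|lborel. (norm (fst (F x)))\<^sup>2) + (\<Sum>b\<in>Basis. LINT x|lborel. (norm (grad_component b (F x)))\<^sup>2)"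
  proof -
    have "(H1_norm (\<lambda>x. fst (F x)))\<^sup>2 = (L2_norm (\<lambda>x. fst (F x)))\<^sup>2 + (\<Sum>b\<in>Basis. (L2_norm (weak_deriv b (\<lambda>x. fst (F x))))\<^sup>2)"
      unfolding H1_norm_def by (intro real_sqrt_pow2 add_nonneg_nonneg sum_nonneg) auto
    also have "\<dots> = (L2_norm (\<lambda>x. fst (F x)))\<^sup>2 + (\<Sum>b\<in>Basis. (L2_norm (\<lambda>x. grad_component b (F x)))\<^sup>2)"
      using weak_deriv_unique[OF f g weak] by simp
    finally show ?thesis by (simp only: L2_norm_power2)
  qed
  have norm: "(norm (F x))\<^sup>2 = (norm (fst (F x)))\<^sup>2 + (\<Sum>b\<in>Basis. (norm (grad_component b (F x)))\<^sup>2) + (norm (snd (snd (F x))))\<^sup>2" for x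
  proof -
    obtain f p r h where Fx: "F x = (f, (p, r), h)" by (metis surj_pair)
    have "(norm (p, r))\<^sup>2 = (\<Sum>b\<in>Basis. (norm (grad_component b (F x)))\<^sup>2)"
      unfolding power2_norm_eq_inner inner_Pair euclidean_inner[of p p] euclidean_inner[of r r]
      by (simp add: Fx grad_component_def inner_complex_def sum.distrib)
    then show ?thesis by (simp add: Fx norm_Pair sum_nonneg)
  qed
  have "(norm (abs_l2 F))\<^sup>2 = (LINT x|lborel. (norm (F x))\<^sup>2)" using F(1) by (rule norm_abs_l2_power2)
  also have "\<dots> = (LINT x|lborel. (norm (fst (F x)))\<^sup>2) + (\<Sum>b\<in>Basis. LINT x|lborel. (norm (grad_component b (F x)))\<^sup>2)
      + (LINT x|lborel. (norm (snd (snd (F x))))\<^sup>2)"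
    unfolding norm using f g h by (simp add: square_integrable_def)
  finally show "(norm (abs_l2 F))\<^sup>2 = (H1_norm (\<lambda>x. fst (F x)))\<^sup>2 + (LINT x|lborel. (norm (snd (snd (F x))))\<^sup>2)"
    unfolding H1 .
qed

lemma H1_norm_le:
  assumes "square_integrable F" "admissible s F"
  shows "H1_norm (\<lambda>x. fst (F x)) \<le> norm (abs_l2 F)"
proof (rule power2_le_imp_le)
  show "(H1_norm (\<lambda>x. fst (F x)))\<^sup>2 \<le> (norm (abs_l2 F))\<^sup>2"
    unfolding admissible_energy(2)[OF assms] by simp
qed simp

definition E :: "('a, 'a state) l2 \<Rightarrow> ('a, 'a state) l2"
  where "E U = abs_l2 (\<lambda>x. (fst (rep_l2 U x), 0, 0))"

lemma E_square_integrable: "square_integrable (\<lambda>x. (fst (rep_l2 (U :: ('a, 'a state) l2) x), 0 :: 'a \<times> 'a, 0 :: complex))"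
  by (intro square_integrable_Pair square_integrable_zero square_integrable_linear[OF bounded_linear_fst] square_integrable_rep)

lemma E_inner: "E U \<bullet> V = (LINT x|lborel. fst (rep_l2 U x) \<bullet> fst (rep_l2 V x))"
  unfolding E_def inner_commute[of _ V] inner_rep_abs_l2[OF E_square_integrable]
  by (simp add: inner_prod_def inner_commute)

lemma E_symmetric: "E U \<bullet> V = U \<bullet> E V"
  unfolding inner_commute[of U] E_inner by (simp add: inner_commute)

lemma E_nonneg: "0 \<le> E U \<bullet> U"
  unfolding E_inner by (rule integral_nonneg_AE) simp

lemma E_le: "E U \<bullet> U \<le> U \<bullet> U"
  unfolding E_inner unfolding inner_l2_rep
  by (intro integral_mono square_integrable_inner square_integrable_linear[OF bounded_linear_fst] square_integrable_rep)
    (simp add: inner_prod_def)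

text \<open>Additivity and homogeneity are read off from symmetry by testing against an arbitrary
  vector, which avoids any handling of representatives.\<close>

lemma bounded_linear_E: "bounded_linear E"
proof (rule bounded_linear_intro)
  show "E (U + V) = E U + E V" for U V
    by (subst vector_eq_rdot[symmetric]) (simp add: E_symmetric inner_add)
  show "E (r *\<^sub>R U) = r *\<^sub>R E U" for r U
    by (subst vector_eq_rdot[symmetric]) (simp add: E_symmetric)
  show "norm (E U) \<le> norm U * 1" for U
  proof -
    have "(norm (E U))\<^sup>2 = E U \<bullet> U"
      unfolding E_inner unfolding E_def norm_abs_l2_power2[OF E_square_integrable]
      by (simp add: norm_Pair power2_norm_eq_inner)
    also have "\<dots> \<le> (norm U)\<^sup>2" using E_le by (simp add: power2_norm_eq_inner)
    finally show ?thesis by simp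
  qed
qed

text \<open>If the function component vanishes, so does h = s f, and the weak gradient of 0
  integrates to 0 against all test functions, hence is 0 by the fundamental lemma. This is the
  hypothesis that makes the range of the resolvent dense.\<close>

lemma E_injective:
  assumes U: "U \<in> W" and "E U \<bullet> U = 0"
  shows "U = 0"
proof -
  let ?F = "rep_l2 U"
  have adm: "admissible s ?F" using U by (simp add: W_iff)
  have f: "square_integrable (\<lambda>x. fst (?F x))"
    by (intro square_integrable_linear[OF bounded_linear_fst] square_integrable_rep)
  have f0: "AE x in lborel. fst (?F x) = 0"
    using assms(2) integral_nonneg_eq_0_iff_AE[OF square_integrable_inner[OF f f]] by (simp add: E_inner)
  have h0: "AE x in lborel. snd (snd (?F x)) = 0"
    using adm f0 unfolding admissible_def by (auto elim: eventually_elim2)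
  have g0: "AE x in lborel. grad_component b (?F x) = 0" if "b \<in> Basis" for b
  proof (rule fundamental_lemma[OF mollifier])
    show "square_integrable (\<lambda>x. grad_component b (?F x))"
      by (intro square_integrable_linear[OF bounded_linear_grad_component] square_integrable_rep)
    fix \<phi> :: "'a \<Rightarrow> complex" assume "\<phi> \<in> test_functions UNIV"
    then have "(LINT x|lborel. grad_component b (?F x) * \<phi> x) = - (LINT x|lborel. fst (?F x) * dir_deriv b \<phi> x)"
      using adm that unfolding admissible_def is_weak_deriv_def distr_deriv_def regular_distr_def by metis
    also have "(LINT x|lborel. fst (?F x) * dir_deriv b \<phi> x) = 0"
      using f0 by (intro integral_eq_zero_AE) (auto elim: eventually_mono)
    finally show "(LINT x|lborel. grad_component b (?F x) * \<phi> x) = 0" by simp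
  qed
  then have "AE x in lborel. \<forall>b\<in>Basis. grad_component b (?F x) = 0"
    by (intro AE_finite_allI finite_Basis) auto
  then have "AE x in lborel. ?F x = 0"
    using f0 h0
  proof eventually_elim
    case (elim x)
    obtain f p r h where Fx: "?F x = (f, (p, r), h)" by (metis surj_pair)
    have "p = 0" "r = 0"
      using elim(1) by (auto simp: Fx grad_component_def complex_eq_iff intro!: euclidean_eqI[where 'a = 'a])
    with elim(2,3) show ?case by (simp add: Fx zero_prod_def)
  qed
  then have "(norm U)\<^sup>2 = 0"
    unfolding norm_l2_power2 by (intro integral_eq_zero_AE) (auto elim: eventually_mono)
  then show ?thesis by simp
qed

end

subsection \<open>The evolution equation\<close>

lemma square_integrable_sum:
  "finite I \<Longrightarrow> (\<And>i. i \<in> I \<Longrightarrow> square_integrable (f i)) \<Longrightarrow> square_integrable (\<lambda>x. \<Sum>i\<in>I. f i x)"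
  by (induction I rule: finite_induct) (auto intro: square_integrable_zero square_integrable_add)

section \<open>Space-time test functions as differentiable curves in L^2\<close>

text \<open>A Taylor estimate in time whose constant does not depend on x: the time derivative is
  again a test function, hence bounded and Lipschitz in time. Uniformity in x is what carries the
  estimate over to L^2.\<close>

lemma test_function_time_derivative_bound:
  fixes \<theta> :: "real \<times> 'a::euclidean_space \<Rightarrow> complex"
  assumes \<theta>: "\<theta> \<in> test_functions \<Omega>"
  obtains M where "0 \<le> M"
    "\<And>r t x. norm (\<theta> (r, x) - \<theta> (t, x)) \<le> M * \<bar>r - t\<bar>"
    "\<And>r t x. norm (\<theta> (r, x) - \<theta> (t, x) - (r - t) *\<^sub>R dir_deriv (1, 0) \<theta> (t, x)) \<le> M * \<bar>r - t\<bar>\<^sup>2"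
proof -
  have basis: "(1, 0) \<in> (Basis :: (real \<times> 'a) set)" by (simp add: Basis_prod_def)
  have line: "((\<lambda>r. \<eta> (r, x)) has_vector_derivative dir_deriv (1, 0) \<eta> (r, x)) (at r)"
    if "\<eta> \<in> test_functions \<Omega>" for \<eta> :: "real \<times> 'a \<Rightarrow> complex" and x r
    using has_vector_derivative_line[of \<eta> "(0, x)" r "(1, 0)"] smooth_has_derivative[of \<eta>] that
    by (simp add: test_functions_def)
  have lipschitz: "\<exists>M\<ge>0. \<forall>r t x. norm (\<eta> (r, x) - \<eta> (t, x)) \<le> M * \<bar>r - t\<bar>"
    if \<eta>: "\<eta> \<in> test_functions \<Omega>" for \<eta> :: "real \<times> 'a \<Rightarrow> complex"
  proof -
    obtain M where M: "0 \<le> M" "\<And>z. norm (dir_deriv (1, 0) \<eta> z) \<le> M"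
      using test_function_bounded[OF test_functions_dir_deriv[OF \<eta> basis]] by metis
    have "norm (\<eta> (r, x) - \<eta> (t, x)) \<le> M * \<bar>r - t\<bar>" for r t x
      by (rule curve_increment_bound[OF line[OF \<eta>]]) (rule M)
    then show ?thesis using M(1) by blast
  qed
  obtain M1 where M1: "0 \<le> M1" "\<And>r t x. norm (\<theta> (r, x) - \<theta> (t, x)) \<le> M1 * \<bar>r - t\<bar>"
    using lipschitz[OF \<theta>] by blast
  obtain M2 where M2: "0 \<le> M2"
    "\<And>r t x. norm (dir_deriv (1, 0) \<theta> (r, x) - dir_deriv (1, 0) \<theta> (t, x)) \<le> M2 * \<bar>r - t\<bar>"
    using lipschitz[OF test_functions_dir_deriv[OF \<theta> basis]] by blast
  have second: "norm (\<theta> (r, x) - \<theta> (t, x) - (r - t) *\<^sub>R dir_deriv (1, 0) \<theta> (t, x)) \<le> M2 * \<bar>r - t\<bar>\<^sup>2" for r t x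
  proof -
    \<comment> \<open>Subtracting the linear part leaves a curve whose derivative is an increment of
      the time derivative, of size at most \<open>M2\<close> |r - t|; this is the source of the
      square.\<close>
    define g where "g r = \<theta> (r, x) - r *\<^sub>R dir_deriv (1, 0) \<theta> (t, x)" for r
    have "(g has_vector_derivative dir_deriv (1, 0) \<theta> (r, x) - dir_deriv (1, 0) \<theta> (t, x)) (at r)" for r
    proof -
      have "((\<lambda>r. r *\<^sub>R dir_deriv (1, 0) \<theta> (t, x)) has_vector_derivative dir_deriv (1, 0) \<theta> (t, x)) (at r)"
        using has_vector_derivative_scaleR[OF DERIV_ident has_vector_derivative_const] by simp
      from has_vector_derivative_diff[OF line[OF \<theta>] this] show ?thesis by (simp add: g_def[abs_def])
    qed
    then have "norm (g r - g t) \<le> (M2 * \<bar>r - t\<bar>) * \<bar>r - t\<bar>"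
    proof (rule curve_increment_bound)
      fix r' assume "\<bar>r' - t\<bar> \<le> \<bar>r - t\<bar>"
      then have "M2 * \<bar>r' - t\<bar> \<le> M2 * \<bar>r - t\<bar>" using M2(1) by (rule mult_left_mono)
      with M2(2) show "norm (dir_deriv (1, 0) \<theta> (r', x) - dir_deriv (1, 0) \<theta> (t, x)) \<le> M2 * \<bar>r - t\<bar>"
        by (rule order_trans)
    qed
    then show ?thesis by (simp add: g_def power2_eq_square algebra_simps)
  qed
  show thesis
  proof (rule that[of "max M1 M2"])
    show "norm (\<theta> (r, x) - \<theta> (t, x)) \<le> max M1 M2 * \<bar>r - t\<bar>" for r t x
      using M1(2) by (rule order_trans) (simp add: mult_right_mono)
    show "norm (\<theta> (r, x) - \<theta> (t, x) - (r - t) *\<^sub>R dir_deriv (1, 0) \<theta> (t, x)) \<le> max M1 M2 * \<bar>r - t\<bar>\<^sup>2" for r t x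
      using second by (rule order_trans) (simp add: mult_right_mono)
  qed (use M1 in auto)
qed

text \<open>The functional \<open>U \<mapsto> Re (\<integral> m f g)\<close> of a state \<open>U = (f, G, h)\<close> is represented by the vector below.\<close>

definition pairing_vector :: "('a::euclidean_space \<Rightarrow> real) \<Rightarrow> ('a \<Rightarrow> complex) \<Rightarrow> ('a, 'a state) l2"
  where "pairing_vector m g = abs_l2 (\<lambda>x. (m x *\<^sub>R cnj (g x), 0, 0))"

text \<open>Bilinear, without conjugation, as for distributions. The multiplier \<open>m\<close>
  will be 1 for the plain pairing and \<open>s\<close> squared for the potential term.\<close>

definition pairing :: "('a::euclidean_space \<Rightarrow> real) \<Rightarrow> ('a, 'a state) l2 \<Rightarrow> ('a \<Rightarrow> complex) \<Rightarrow> complex"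
  where "pairing m U g = (LINT x|lborel. m x *\<^sub>R (fst (rep_l2 U x) * g x))"

lemma pairing_mult: "pairing m U (\<lambda>x. c * g x) = c * pairing m U g"
proof -
  have "pairing m U (\<lambda>x. c * g x) = (LINT x|lborel. c * (m x *\<^sub>R (fst (rep_l2 U x) * g x)))"
    unfolding pairing_def by (intro Bochner_Integration.integral_cong refl) (simp add: mult_ac)
  then show ?thesis unfolding pairing_def by (simp only: integral_mult_right_zero)
qed

locale bounded_multiplier =
  fixes m :: "'a::euclidean_space \<Rightarrow> real" and C :: real
  assumes m_measurable [measurable]: "m \<in> borel_measurable borel"
    and m_bound: "AE x in lborel. \<bar>m x\<bar> \<le> C" and C_nonneg: "0 \<le> C"
begin

lemma pairing_vector_square_integrable:
  assumes "square_integrable g"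
  shows "square_integrable (\<lambda>x. (m x *\<^sub>R cnj (g x), 0 :: 'a \<times> 'a, 0 :: complex))"
  by (intro square_integrable_Pair square_integrable_zero square_integrable_bounded_scaleR[OF m_measurable m_bound]
      square_integrable_linear[OF bounded_linear_cnj] assms)

lemma inner_pairing_vector:
  assumes g: "square_integrable g"
  shows "U \<bullet> pairing_vector m g = Re (pairing m U g)"
proof -
  have int: "integrable lborel (\<lambda>x. m x *\<^sub>R (fst (rep_l2 U x) * g x))"
    using square_integrable_mult(1)[OF square_integrable_linear[OF bounded_linear_fst square_integrable_rep[of U]]
        square_integrable_bounded_scaleR[OF m_measurable m_bound g]] by simp
  have "U \<bullet> pairing_vector m g = (LINT x|lborel. rep_l2 U x \<bullet> (m x *\<^sub>R cnj (g x), 0, 0))"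
    unfolding pairing_vector_def by (rule inner_rep_abs_l2[OF pairing_vector_square_integrable[OF g]])
  also have "\<dots> = (LINT x|lborel. Re (m x *\<^sub>R (fst (rep_l2 U x) * g x)))"
    by (simp add: inner_prod_def inner_complex_def algebra_simps)
  also have "\<dots> = Re (pairing m U g)"
    unfolding pairing_def using int by (rule integral_Re)
  finally show ?thesis .
qed

lemma pairing_vector_diff:
  assumes "square_integrable g" "square_integrable g'"
  shows "pairing_vector m g - pairing_vector m g' = pairing_vector m (\<lambda>x. g x - g' x)"
  unfolding pairing_vector_def
  by (subst abs_l2_diff[OF assms[THEN pairing_vector_square_integrable]]) (simp add: scaleR_diff_right zero_prod_def)

lemma norm_pairing_vector_le:
  assumes g: "g \<in> borel_measurable borel" and K: "compact K" "\<And>x. x \<notin> K \<Longrightarrow> g x = 0"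
    and M: "\<And>x. norm (g x) \<le> M" "0 \<le> M"
  shows "norm (pairing_vector m g) \<le> C * M * sqrt (measure lborel K)"
  unfolding pairing_vector_def
proof (rule square_integrable_compact_support(2)[OF _ K(1)])
  have [measurable]: "(\<lambda>x. cnj (g x)) \<in> borel_measurable borel"
    using g borel_measurable_continuous_onI[OF linear_continuous_on[OF bounded_linear_cnj]]
    by (rule measurable_compose)
  show "(\<lambda>x. (m x *\<^sub>R cnj (g x), 0 :: 'a \<times> 'a, 0 :: complex)) \<in> borel_measurable borel"
    by (intro borel_measurable_Pair) measurable
  show "AE x in lborel. norm (m x *\<^sub>R cnj (g x), 0 :: 'a \<times> 'a, 0 :: complex) \<le> C * M"
    using m_bound by (rule eventually_mono) (auto simp: norm_Pair intro!: mult_mono M C_nonneg)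
  show "0 \<le> C * M" using C_nonneg M by simp
  show "(m x *\<^sub>R cnj (g x), 0 :: 'a \<times> 'a, 0 :: complex) = 0" if "x \<notin> K" for x
    using K(2)[OF that] by (simp add: zero_prod_def)
qed

text \<open>All time sections and their time derivatives vanish outside one compact set, the spatial
  projection of the support. Pointwise bounds thus become norm bounds at the cost of the factor C
  sqrt |K|.\<close>

lemma pairing_vector_section_lipschitz:
  fixes \<theta> :: "real \<times> 'a \<Rightarrow> complex"
  assumes \<theta>: "\<theta> \<in> test_functions \<Omega>"
  obtains L where "\<And>r t. norm (pairing_vector m (\<lambda>x. \<theta> (r, x)) - pairing_vector m (\<lambda>x. \<theta> (t, x))) \<le> L * \<bar>r - t\<bar>"
    "\<And>r t. norm (pairing_vector m (\<lambda>x. \<theta> (r, x)) - pairing_vector m (\<lambda>x. \<theta> (t, x))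
        - (r - t) *\<^sub>R pairing_vector m (\<lambda>x. dir_deriv (1, 0) \<theta> (t, x))) \<le> L * \<bar>r - t\<bar>\<^sup>2"
proof -
  have basis: "(1, 0) \<in> (Basis :: (real \<times> 'a) set)" by (simp add: Basis_prod_def)
  note d\<theta> = test_functions_dir_deriv[OF \<theta> basis]
  obtain M where M: "0 \<le> M" "\<And>r t x. norm (\<theta> (r, x) - \<theta> (t, x)) \<le> M * \<bar>r - t\<bar>"
    "\<And>r t x. norm (\<theta> (r, x) - \<theta> (t, x) - (r - t) *\<^sub>R dir_deriv (1, 0) \<theta> (t, x)) \<le> M * \<bar>r - t\<bar>\<^sup>2"
    using test_function_time_derivative_bound[OF \<theta>] by metis
  let ?K = "snd ` supp \<theta>"
  have K: "compact ?K"
    using \<theta> by (intro compact_continuous_image continuous_intros) (simp add: test_functions_def)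
  have notin: "(t, x) \<notin> supp \<theta>" if "x \<notin> ?K" for t x using that by (metis image_eqI snd_conv)
  have z: "\<theta> (t, x) = 0" "dir_deriv (1, 0) \<theta> (t, x) = 0" if "x \<notin> ?K" for t x
    using notin[OF that, of t] supp_dir_deriv[of "(1, 0)" \<theta>] by (auto intro: notin_supp)
  have sq: "square_integrable (\<lambda>x. \<theta> (t, x))" "square_integrable (\<lambda>x. dir_deriv (1, 0) \<theta> (t, x))" for t
    using test_functions_section[OF \<theta>] test_functions_section[OF d\<theta>]
    by (auto intro: test_function_square_integrable)
  note meas [measurable] = sq[THEN square_integrable_measurable]
  define L where "L = C * M * sqrt (measure lborel ?K)"
  show thesis
  proof (rule that[of L])
    fix r t :: real
    have "norm (pairing_vector m (\<lambda>x. \<theta> (r, x) - \<theta> (t, x))) \<le> C * (M * \<bar>r - t\<bar>) * sqrt (measure lborel ?K)"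
      using M(1,2) z by (intro norm_pairing_vector_le K) (auto intro!: mult_nonneg_nonneg)
    then show "norm (pairing_vector m (\<lambda>x. \<theta> (r, x)) - pairing_vector m (\<lambda>x. \<theta> (t, x))) \<le> L * \<bar>r - t\<bar>"
      by (simp add: pairing_vector_diff sq L_def mult_ac)
    have scale: "(r - t) *\<^sub>R pairing_vector m (\<lambda>x. dir_deriv (1, 0) \<theta> (t, x))
        = pairing_vector m (\<lambda>x. (r - t) *\<^sub>R dir_deriv (1, 0) \<theta> (t, x))"
      unfolding pairing_vector_def abs_l2_scaleR[OF pairing_vector_square_integrable[OF sq(2)]]
      by (simp add: mult.commute[of "r - t"])
    have "norm (pairing_vector m (\<lambda>x. \<theta> (r, x) - \<theta> (t, x) - (r - t) *\<^sub>R dir_deriv (1, 0) \<theta> (t, x)))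
        \<le> C * (M * \<bar>r - t\<bar>\<^sup>2) * sqrt (measure lborel ?K)"
      using M(1,3) z by (intro norm_pairing_vector_le K) (auto intro!: mult_nonneg_nonneg)
    then show "norm (pairing_vector m (\<lambda>x. \<theta> (r, x)) - pairing_vector m (\<lambda>x. \<theta> (t, x))
        - (r - t) *\<^sub>R pairing_vector m (\<lambda>x. dir_deriv (1, 0) \<theta> (t, x))) \<le> L * \<bar>r - t\<bar>\<^sup>2"
      unfolding scale pairing_vector_diff[OF sq(1) sq(1)]
        pairing_vector_diff[OF square_integrable_diff[OF sq(1) sq(1)] square_integrable_scaleR[OF sq(2)]]
      by (simp add: L_def mult_ac)
  qed
qed

lemma continuous_on_pairing_vector_section:
  fixes \<theta> :: "real \<times> 'a \<Rightarrow> complex"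
  assumes "\<theta> \<in> test_functions \<Omega>"
  shows "continuous_on I (\<lambda>t. pairing_vector m (\<lambda>x. \<theta> (t, x)))"
proof -
  obtain L where L: "\<And>r t. norm (pairing_vector m (\<lambda>x. \<theta> (r, x)) - pairing_vector m (\<lambda>x. \<theta> (t, x))) \<le> L * \<bar>r - t\<bar>"
    using pairing_vector_section_lipschitz[OF assms] by metis
  have "norm (pairing_vector m (\<lambda>x. \<theta> (r, x)) - pairing_vector m (\<lambda>x. \<theta> (t, x))) \<le> \<bar>L\<bar> * \<bar>r - t\<bar>" for r t
    using L by (rule order_trans) (simp add: mult_right_mono)
  then have "\<bar>L\<bar>-lipschitz_on I (\<lambda>t. pairing_vector m (\<lambda>x. \<theta> (t, x)))"
    by (auto simp: lipschitz_on_def dist_norm)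
  then show ?thesis by (rule lipschitz_on_continuous_on)
qed

text \<open>The real part is an inner product of two continuous curves in L^2; the imaginary part is
  the real part for - i times the test function.\<close>

lemma continuous_on_pairing:
  fixes \<theta> :: "real \<times> 'a \<Rightarrow> complex"
  assumes u: "continuous_on I u" and \<theta>: "\<theta> \<in> test_functions \<Omega>"
  shows "continuous_on I (\<lambda>t. pairing m (u t) (\<lambda>x. \<theta> (t, x)))"
proof -
  have Re: "continuous_on I (\<lambda>t. Re (pairing m (u t) (\<lambda>x. \<eta> (t, x))))"
    if \<eta>: "\<eta> \<in> test_functions \<Omega>" for \<eta> :: "real \<times> 'a \<Rightarrow> complex"
    using continuous_on_inner[OF u continuous_on_pairing_vector_section[OF \<eta>]]
    by (simp add: inner_pairing_vector test_function_square_integrable[OF test_functions_section[OF \<eta>]])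
  have "Im (pairing m (u t) (\<lambda>x. \<theta> (t, x))) = Re (pairing m (u t) (\<lambda>x. - \<i> * \<theta> (t, x)))" for t
    by (simp only: pairing_mult) simp
  with Re[OF test_functions_linear[OF bounded_linear_mult_right \<theta>, of "- \<i>"]]
  have Im: "continuous_on I (\<lambda>t. Im (pairing m (u t) (\<lambda>x. \<theta> (t, x))))" by simp
  have "continuous_on I (\<lambda>t. complex_of_real (Re (pairing m (u t) (\<lambda>x. \<theta> (t, x))))
      + \<i> * complex_of_real (Im (pairing m (u t) (\<lambda>x. \<theta> (t, x)))))"
    by (intro continuous_intros Re[OF \<theta>] Im)
  then show ?thesis by (simp only: complex_eq[symmetric])
qed

end

lemma bounded_multiplier_1: "bounded_multiplier (\<lambda>x. 1) 1"
  by standard auto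

section \<open>From the abstract evolution to the distributional heat equation\<close>

context potential
begin

text \<open>The state belonging to the conjugate of phi: its gradient is the conjugate of grad phi.
  The conjugation makes real inner products with it equal to real parts of bilinear pairings with
  phi.\<close>

definition test_state :: "('a \<Rightarrow> complex) \<Rightarrow> 'a \<Rightarrow> 'a state"
  where "test_state \<phi> x = (cnj (\<phi> x),
    (\<Sum>b\<in>Basis. Re (dir_deriv b \<phi> x) *\<^sub>R b, \<Sum>b\<in>Basis. - Im (dir_deriv b \<phi> x) *\<^sub>R b), s x *\<^sub>R cnj (\<phi> x))"

lemma grad_component_test_state:
  "b \<in> Basis \<Longrightarrow> grad_component b (test_state \<phi> x) = cnj (dir_deriv b \<phi> x)"
  by (simp only: grad_component_def test_state_def fst_conv snd_conv inner_sum_left_Basis) (simp add: complex_eq_iff)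

lemma test_state_square_integrable:
  assumes \<phi>: "\<phi> \<in> test_functions UNIV"
  shows "square_integrable (test_state \<phi>)"
proof -
  have "bounded_linear (\<lambda>z. Re z *\<^sub>R b)" "bounded_linear (\<lambda>z. - Im z *\<^sub>R b)" for b :: 'a
    by (intro bounded_linear_scaleR_const bounded_linear_Re bounded_linear_minus bounded_linear_Im)+
  then have "square_integrable (\<lambda>x. Re (dir_deriv b \<phi> x) *\<^sub>R b)" "square_integrable (\<lambda>x. - Im (dir_deriv b \<phi> x) *\<^sub>R b)"
    if "b \<in> Basis" for b
    using square_integrable_linear[OF _ test_function_square_integrable[OF test_functions_dir_deriv[OF \<phi> that]]]
    by blast+
  then show ?thesis
    unfolding test_state_def[abs_def]
    by (intro square_integrable_Pair square_integrable_sum square_integrable_linear[OF bounded_linear_cnj]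
        square_integrable_bounded_scaleR[OF s_measurable s_bound] test_function_square_integrable[OF \<phi>] finite_Basis)
qed

lemma test_state_in_W:
  assumes \<phi>: "\<phi> \<in> test_functions UNIV"
  shows "abs_l2 (test_state \<phi>) \<in> W"
  unfolding abs_l2_in_W_iff[OF test_state_square_integrable[OF \<phi>]] admissible_def
proof (intro conjI ballI)
  show "AE x in lborel. snd (snd (test_state \<phi> x)) = s x *\<^sub>R fst (test_state \<phi> x)"
    by (simp add: test_state_def)
  fix b :: 'a assume b: "b \<in> Basis"
  have smooth: "smooth \<phi>" using \<phi> by (simp add: test_functions_def)
  show "is_weak_deriv b (\<lambda>x. fst (test_state \<phi> x)) (\<lambda>x. grad_component b (test_state \<phi> x))"
    unfolding is_weak_deriv_def distr_deriv_def regular_distr_def grad_component_test_state[OF b]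
    using integration_by_parts[OF test_functions_linear[OF bounded_linear_cnj \<phi>] _ b]
      dir_deriv_linear[OF bounded_linear_cnj smooth]
    by (simp add: test_state_def)
qed

lemma E_inner_test_state:
  assumes \<phi>: "\<phi> \<in> test_functions UNIV"
  shows "E U \<bullet> abs_l2 (test_state \<phi>) = Re (pairing (\<lambda>x. 1) U \<phi>)"
proof -
  interpret one: bounded_multiplier "\<lambda>x. 1" 1 by (rule bounded_multiplier_1)
  have "E U \<bullet> abs_l2 (test_state \<phi>) = (LINT x|lborel. (fst (rep_l2 U x), 0, 0) \<bullet> test_state \<phi> x)"
    unfolding E_def by (rule inner_abs_l2[OF E_square_integrable test_state_square_integrable[OF \<phi>]])
  also have "\<dots> = (LINT x|lborel. rep_l2 U x \<bullet> (1 *\<^sub>R cnj (\<phi> x), 0, 0))"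
    by (simp add: test_state_def inner_prod_def)
  also have "\<dots> = U \<bullet> pairing_vector (\<lambda>x. 1) \<phi>"
    unfolding pairing_vector_def
    by (rule inner_rep_abs_l2[OF one.pairing_vector_square_integrable[OF test_function_square_integrable[OF \<phi>]], symmetric])
  also have "\<dots> = Re (pairing (\<lambda>x. 1) U \<phi>)"
    by (rule one.inner_pairing_vector[OF test_function_square_integrable[OF \<phi>]])
  finally show ?thesis .
qed

text \<open>The inner product with the test state is Re of the integral of f phi + grad f . grad phi
  + s^2 f phi, and the term f phi cancels against the one from \<open>E\<close>. Moving the gradient
  onto phi leaves the operator Delta - s^2 acting on the test function.\<close>

lemma inner_test_state:
  assumes U: "U \<in> W" and \<phi>: "\<phi> \<in> test_functions UNIV"
  shows "E U \<bullet> abs_l2 (test_state \<phi>) - U \<bullet> abs_l2 (test_state \<phi>)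
    = Re ((\<Sum>b\<in>Basis. pairing (\<lambda>x. 1) U (dir_deriv b (dir_deriv b \<phi>))) - pairing (\<lambda>x. (s x)\<^sup>2) U \<phi>)"
proof -
  define f where "f x = fst (rep_l2 U x)" for x
  define g where "g b x = grad_component b (rep_l2 U x)" for b x
  have adm: "admissible s (rep_l2 U)" using U by (simp add: W_iff)
  have f: "square_integrable f" and g: "\<And>b. square_integrable (g b)"
    unfolding f_def[abs_def] g_def[abs_def]
    by (intro square_integrable_linear[OF bounded_linear_fst] square_integrable_linear[OF bounded_linear_grad_component]
        square_integrable_rep)+
  note \<phi>_sq = test_function_square_integrable[OF \<phi>]
  have d\<phi>: "dir_deriv b \<phi> \<in> test_functions UNIV" if "b \<in> Basis" for b
    using \<phi> that by (rule test_functions_dir_deriv)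
  have int_f: "integrable lborel (\<lambda>x. f x * \<phi> x)"
    using f \<phi>_sq by (rule square_integrable_mult)
  have int_sf: "integrable lborel (\<lambda>x. (s x)\<^sup>2 *\<^sub>R (f x * \<phi> x))"
    using square_integrable_mult(1)[OF square_integrable_bounded_scaleR[OF s_measurable s_bound f]
        square_integrable_bounded_scaleR[OF s_measurable s_bound \<phi>_sq]]
    by (simp add: power2_eq_square)
  have int_g: "integrable lborel (\<lambda>x. g b x * dir_deriv b \<phi> x)" if "b \<in> Basis" for b
    using g test_function_square_integrable[OF d\<phi>[OF that]] by (rule square_integrable_mult)
  have "U \<bullet> abs_l2 (test_state \<phi>) = (LINT x|lborel. rep_l2 U x \<bullet> test_state \<phi> x)"
    by (rule inner_rep_abs_l2[OF test_state_square_integrable[OF \<phi>]])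
  also have "\<dots> = (LINT x|lborel. Re (f x * \<phi> x + (\<Sum>b\<in>Basis. g b x * dir_deriv b \<phi> x) + (s x)\<^sup>2 *\<^sub>R (f x * \<phi> x)))"
  proof (rule integral_cong_AE)
    show "(\<lambda>x. rep_l2 U x \<bullet> test_state \<phi> x) \<in> borel_measurable lborel"
      using square_integrable_inner[OF square_integrable_rep test_state_square_integrable[OF \<phi>], of U] by auto
    have "integrable lborel (\<lambda>x. f x * \<phi> x + (\<Sum>b\<in>Basis. g b x * dir_deriv b \<phi> x) + (s x)\<^sup>2 *\<^sub>R (f x * \<phi> x))"
      by (intro Bochner_Integration.integrable_add Bochner_Integration.integrable_sum int_f int_g int_sf)
    then show "(\<lambda>x. Re (f x * \<phi> x + (\<Sum>b\<in>Basis. g b x * dir_deriv b \<phi> x) + (s x)\<^sup>2 *\<^sub>R (f x * \<phi> x))) \<in> borel_measurable lborel"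
      by (intro borel_measurable_integrable integrable_Re)
    have "AE x in lborel. snd (snd (rep_l2 U x)) = s x *\<^sub>R fst (rep_l2 U x)"
      using adm by (simp add: admissible_def)
    then show "AE x in lborel. rep_l2 U x \<bullet> test_state \<phi> x
        = Re (f x * \<phi> x + (\<Sum>b\<in>Basis. g b x * dir_deriv b \<phi> x) + (s x)\<^sup>2 *\<^sub>R (f x * \<phi> x))"
    proof (rule eventually_mono)
      fix x assume h: "snd (snd (rep_l2 U x)) = s x *\<^sub>R fst (rep_l2 U x)"
      obtain p r where pr: "rep_l2 U x = (f x, (p, r), s x *\<^sub>R f x)"
        using h unfolding f_def by (metis prod.collapse)
      have "p \<bullet> (\<Sum>b\<in>Basis. Re (dir_deriv b \<phi> x) *\<^sub>R b) + r \<bullet> (\<Sum>b\<in>Basis. - Im (dir_deriv b \<phi> x) *\<^sub>R b)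
          = (\<Sum>b\<in>Basis. Re (g b x * dir_deriv b \<phi> x))"
        by (simp add: g_def pr grad_component_def inner_sum_right algebra_simps sum_subtractf sum_negf)
      then have "rep_l2 U x \<bullet> test_state \<phi> x
          = f x \<bullet> cnj (\<phi> x) + (\<Sum>b\<in>Basis. Re (g b x * dir_deriv b \<phi> x)) + (s x *\<^sub>R f x) \<bullet> (s x *\<^sub>R cnj (\<phi> x))"
        unfolding pr test_state_def inner_Pair by simp
      then show "rep_l2 U x \<bullet> test_state \<phi> x
        = Re (f x * \<phi> x + (\<Sum>b\<in>Basis. g b x * dir_deriv b \<phi> x) + (s x)\<^sup>2 *\<^sub>R (f x * \<phi> x))"
        by (simp add: inner_complex_def power2_eq_square algebra_simps)
    qed
  qed
  also have "\<dots> = Re (LINT x|lborel. f x * \<phi> x + (\<Sum>b\<in>Basis. g b x * dir_deriv b \<phi> x) + (s x)\<^sup>2 *\<^sub>R (f x * \<phi> x))"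
    by (intro integral_Re Bochner_Integration.integrable_add Bochner_Integration.integrable_sum int_f int_g int_sf)
  also have "(LINT x|lborel. f x * \<phi> x + (\<Sum>b\<in>Basis. g b x * dir_deriv b \<phi> x) + (s x)\<^sup>2 *\<^sub>R (f x * \<phi> x))
      = (LINT x|lborel. f x * \<phi> x) + (\<Sum>b\<in>Basis. LINT x|lborel. g b x * dir_deriv b \<phi> x) + (LINT x|lborel. (s x)\<^sup>2 *\<^sub>R (f x * \<phi> x))"
    using int_f int_g int_sf by (simp add: Bochner_Integration.integrable_sum Bochner_Integration.integral_sum)
  \<comment> \<open>The weak derivative identity is applied with the test function d_b phi, which
    produces the second derivative of phi and the minus sign.\<close>
  also have "(\<Sum>b\<in>Basis. LINT x|lborel. g b x * dir_deriv b \<phi> x) = - (\<Sum>b\<in>Basis. pairing (\<lambda>x. 1) U (dir_deriv b (dir_deriv b \<phi>)))"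
    unfolding sum_negf[symmetric]
  proof (rule sum.cong[OF refl])
    fix b :: 'a assume b: "b \<in> Basis"
    then have "is_weak_deriv b f (g b)" using adm unfolding admissible_def f_def[abs_def] g_def[abs_def] by blast
    then have "- (LINT x|lborel. f x * dir_deriv b (dir_deriv b \<phi>) x) = (LINT x|lborel. g b x * dir_deriv b \<phi> x)"
      using d\<phi>[OF b] unfolding is_weak_deriv_def distr_deriv_def regular_distr_def by blast
    then show "(LINT x|lborel. g b x * dir_deriv b \<phi> x) = - pairing (\<lambda>x. 1) U (dir_deriv b (dir_deriv b \<phi>))"
      by (simp add: pairing_def f_def)
  qed
  also have "(LINT x|lborel. f x * \<phi> x) = pairing (\<lambda>x. 1) U \<phi>" by (simp add: pairing_def f_def)
  also have "(LINT x|lborel. (s x)\<^sup>2 *\<^sub>R (f x * \<phi> x)) = pairing (\<lambda>x. (s x)\<^sup>2) U \<phi>" by (simp add: pairing_def f_def)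
  finally show ?thesis unfolding E_inner_test_state[OF \<phi>] by simp
qed

text \<open>The solution at time t paired with (d_t + Delta - s^2) Phi, minus the adjoint of the
  heat operator applied to the test function.\<close>

definition time_integrand :: "(real \<Rightarrow> ('a, 'a state) l2) \<Rightarrow> (real \<times> 'a \<Rightarrow> complex) \<Rightarrow> real \<Rightarrow> complex"
  where "time_integrand u \<Phi> t = pairing (\<lambda>x. 1) (u t) (\<lambda>x. dir_deriv (1, 0) \<Phi> (t, x))
    + (\<Sum>b\<in>Basis. pairing (\<lambda>x. 1) (u t) (\<lambda>x. dir_deriv (0, b) (dir_deriv (0, b) \<Phi>) (t, x)))
    - pairing (\<lambda>x. (s x)\<^sup>2) (u t) (\<lambda>x. \<Phi> (t, x))"

lemma bounded_multiplier_s2: "bounded_multiplier (\<lambda>x. (s x)\<^sup>2) (B\<^sup>2)"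
proof
  show "AE x in lborel. \<bar>(s x)\<^sup>2\<bar> \<le> B\<^sup>2"
    using s_bound by (rule eventually_mono) (metis abs_ge_zero abs_power2 power2_abs power_mono)
qed auto

lemma Basis_spacetime: "(1, 0) \<in> (Basis :: (real \<times> 'a) set)" "b \<in> Basis \<Longrightarrow> (0, b) \<in> (Basis :: (real \<times> 'a) set)"
  by (simp_all add: Basis_prod_def)

lemma continuous_on_time_integrand:
  assumes u: "continuous_on I u" and \<Phi>: "\<Phi> \<in> test_functions \<Omega>"
  shows "continuous_on I (time_integrand u \<Phi>)"
proof -
  note one = bounded_multiplier.continuous_on_pairing[OF bounded_multiplier_1 u]
  have "continuous_on I (\<lambda>t. pairing (\<lambda>x. 1) (u t) (\<lambda>x. dir_deriv (0, b) (dir_deriv (0, b) \<Phi>) (t, x)))"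
    if "b \<in> Basis" for b
    by (rule one[OF test_functions_dir_deriv[OF test_functions_dir_deriv[OF \<Phi>]]]) (rule Basis_spacetime(2)[OF that])+
  then show ?thesis
    unfolding time_integrand_def
    by (intro continuous_on_diff continuous_on_add continuous_on_sum
        one[OF test_functions_dir_deriv[OF \<Phi> Basis_spacetime(1)]]
        bounded_multiplier.continuous_on_pairing[OF bounded_multiplier_s2 u \<Phi>])
qed

lemma pairing_has_derivative:
  assumes u: "continuous_on {0..T} u" and t: "t \<in> {0..T}" and W: "u t \<in> W"
    and der: "\<And>v. v \<in> W \<Longrightarrow>
      ((\<lambda>r. E (u r) \<bullet> v) has_real_derivative E (u t) \<bullet> v - u t \<bullet> v) (at t within {0..T})"
    and \<Phi>: "\<Phi> \<in> test_functions \<Omega>"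
  shows "((\<lambda>r. Re (pairing (\<lambda>x. 1) (u r) (\<lambda>x. \<Phi> (r, x)))) has_real_derivative Re (time_integrand u \<Phi> t))
    (at t within {0..T})"
proof -
  interpret one: bounded_multiplier "\<lambda>x. 1" 1 by (rule bounded_multiplier_1)
  have smooth: "smooth \<Phi>" "smooth (dir_deriv (0, b) \<Phi>)" if "b \<in> Basis" for b
    using \<Phi> that by (auto simp: test_functions_def intro: smooth_dir_deriv Basis_spacetime)
  note \<phi> = test_functions_section[OF \<Phi>]
  define J where "J r = pairing_vector (\<lambda>x. 1) (\<lambda>x. \<Phi> (r, x))" for r
  define J' where "J' = pairing_vector (\<lambda>x. 1) (\<lambda>x. dir_deriv (1, 0) \<Phi> (t, x))"
  obtain L where L: "\<And>r. norm (J r - J t - (r - t) *\<^sub>R J') \<le> L * \<bar>r - t\<bar>\<^sup>2"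
    using one.pairing_vector_section_lipschitz[OF \<Phi>] unfolding J_def J'_def by metis
  have quot: "((\<lambda>r. (1 / (r - t)) *\<^sub>R (J r - J t)) \<longlongrightarrow> J') (at t within {0..T})"
  proof (rule LIM_zero_cancel, rule Lim_null_comparison)
    show "((\<lambda>r. L * \<bar>r - t\<bar>) \<longlongrightarrow> 0) (at t within {0..T})"
      by (auto intro!: tendsto_eq_intros)
    have "norm ((1 / (r - t)) *\<^sub>R (J r - J t) - J') \<le> L * \<bar>r - t\<bar>" if "r \<noteq> t" for r
    proof -
      have "(1 / (r - t)) *\<^sub>R (J r - J t) - J' = (1 / (r - t)) *\<^sub>R (J r - J t - (r - t) *\<^sub>R J')"
        using that by (simp add: scaleR_diff_right)
      then have "norm ((1 / (r - t)) *\<^sub>R (J r - J t) - J') = norm (J r - J t - (r - t) *\<^sub>R J') / \<bar>r - t\<bar>"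
        by (simp add: divide_inverse_commute)
      also have "\<dots> \<le> L * \<bar>r - t\<bar>\<^sup>2 / \<bar>r - t\<bar>" using L by (rule divide_right_mono) simp
      also have "\<dots> = L * \<bar>r - t\<bar>" unfolding power2_eq_square using that by (simp del: abs_mult_self_eq)
      finally show ?thesis .
    qed
    then show "\<forall>\<^sub>F r in at t within {0..T}. norm ((1 / (r - t)) *\<^sub>R (J r - J t) - J') \<le> L * \<bar>r - t\<bar>"
      by (auto simp: eventually_at_filter)
  qed
  have "((\<lambda>r. u r \<bullet> ((1 / (r - t)) *\<^sub>R (J r - J t))) \<longlongrightarrow> u t \<bullet> J') (at t within {0..T})"
    using u t by (intro tendsto_inner quot) (simp add: continuous_on_def)
  then have 1: "((\<lambda>r. u r \<bullet> (J r - J t)) has_real_derivative u t \<bullet> J') (at t within {0..T})"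
    unfolding has_field_derivative_iff by (simp add: divide_inverse_commute)
  have J: "w \<bullet> J r = E w \<bullet> abs_l2 (test_state (\<lambda>x. \<Phi> (r, x)))" for r w
    unfolding J_def E_inner_test_state[OF \<phi>]
    by (rule one.inner_pairing_vector[OF test_function_square_integrable[OF \<phi>]])
  have 2: "((\<lambda>r. u r \<bullet> J t) has_real_derivative
      E (u t) \<bullet> abs_l2 (test_state (\<lambda>x. \<Phi> (t, x))) - u t \<bullet> abs_l2 (test_state (\<lambda>x. \<Phi> (t, x)))) (at t within {0..T})"
    unfolding J by (rule der[OF test_state_in_W[OF \<phi>]])
  have second: "dir_deriv b (dir_deriv b (\<lambda>x. \<Phi> (t, x))) = (\<lambda>x. dir_deriv (0, b) (dir_deriv (0, b) \<Phi>) (t, x))"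
    if "b \<in> Basis" for b
    using smooth[OF that] by (simp add: smooth_section(2))
  have "u t \<bullet> J' = Re (pairing (\<lambda>x. 1) (u t) (\<lambda>x. dir_deriv (1, 0) \<Phi> (t, x)))"
    unfolding J'_def
    by (rule one.inner_pairing_vector[OF test_function_square_integrable[OF
            test_functions_section[OF test_functions_dir_deriv[OF \<Phi> Basis_spacetime(1)]]]])
  then have "u t \<bullet> J' + (E (u t) \<bullet> abs_l2 (test_state (\<lambda>x. \<Phi> (t, x))) - u t \<bullet> abs_l2 (test_state (\<lambda>x. \<Phi> (t, x))))
      = Re (time_integrand u \<Phi> t)"
    unfolding inner_test_state[OF W \<phi>] time_integrand_def by (simp add: second)
  moreover have "Re (pairing (\<lambda>x. 1) (u r) (\<lambda>x. \<Phi> (r, x))) = u r \<bullet> (J r - J t) + u r \<bullet> J t" for r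
    using one.inner_pairing_vector[OF test_function_square_integrable[OF \<phi>], of "u r" r]
    by (simp add: J_def inner_diff)
  ultimately show ?thesis using DERIV_add[OF 1 2] by simp
qed

text \<open>The integrand is, in its real part, the derivative of the pairing with Phi, which
  vanishes at times 0 and T because the support of Phi lies in the open strip. The imaginary part
  follows by testing with i Phi.\<close>

lemma integral_time_integrand_eq_0:
  assumes u: "continuous_on {0..T} u" and "0 < T" and W: "\<And>t. u t \<in> W"
    and der: "\<And>t v. t \<in> {0..T} \<Longrightarrow> v \<in> W \<Longrightarrow>
      ((\<lambda>r. E (u r) \<bullet> v) has_real_derivative E (u t) \<bullet> v - u t \<bullet> v) (at t within {0..T})"
    and \<Phi>: "\<Phi> \<in> test_functions ({0<..<T} \<times> UNIV)"
  shows "(LINT t:{0<..<T}|lborel. time_integrand u \<Phi> t) = 0"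
proof -
  have set_int: "set_integrable lborel {0<..<T} p" if "continuous_on {0..T} p" for p :: "real \<Rightarrow> complex"
    using borel_integrable_atLeastAtMost'[OF that] by (rule set_integrable_subset) auto
  have Re0: "Re (LINT t:{0<..<T}|lborel. time_integrand u \<Phi> t) = 0"
    if \<Phi>: "\<Phi> \<in> test_functions ({0<..<T} \<times> UNIV)" for \<Phi>
  proof -
    note cont = continuous_on_time_integrand[OF u \<Phi>]
    have "Re (LINT t:{0<..<T}|lborel. time_integrand u \<Phi> t) = (LINT t|lborel. Re (indicator {0<..<T} t *\<^sub>R time_integrand u \<Phi> t))"
      unfolding set_lebesgue_integral_def
      by (rule integral_Re[symmetric]) (rule set_int[OF cont, unfolded set_integrable_def])
    also have "\<dots> = (LINT t|lborel. indicator {0..T} t *\<^sub>R Re (time_integrand u \<Phi> t))"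
    proof (rule integral_cong_AE)
      show "(\<lambda>t. Re (indicator {0<..<T} t *\<^sub>R time_integrand u \<Phi> t)) \<in> borel_measurable lborel"
        by (intro borel_measurable_integrable integrable_Re set_int[OF cont, unfolded set_integrable_def])
      show "(\<lambda>t. indicator {0..T} t *\<^sub>R Re (time_integrand u \<Phi> t)) \<in> borel_measurable lborel"
        by (intro borel_measurable_integrable borel_integrable_compact continuous_intros cont) auto
      have "AE t in lborel. t \<noteq> 0 \<and> t \<noteq> T"
        using AE_lborel_singleton[of 0] AE_lborel_singleton[of T] by eventually_elim simp
      then show "AE t in lborel. Re (indicator {0<..<T} t *\<^sub>R time_integrand u \<Phi> t)
          = indicator {0..T} t *\<^sub>R Re (time_integrand u \<Phi> t)"
        by (rule eventually_mono) (auto simp: indicator_def)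
    qed
    also have "\<dots> = Re (pairing (\<lambda>x. 1) (u T) (\<lambda>x. \<Phi> (T, x))) - Re (pairing (\<lambda>x. 1) (u 0) (\<lambda>x. \<Phi> (0, x)))"
    proof (rule integral_FTC_atLeastAtMost)
      show "((\<lambda>r. Re (pairing (\<lambda>x. 1) (u r) (\<lambda>x. \<Phi> (r, x)))) has_vector_derivative Re (time_integrand u \<Phi> t))
          (at t within {0..T})" if "0 \<le> t" "t \<le> T" for t
        unfolding has_real_derivative_iff_has_vector_derivative[symmetric]
        using that by (intro pairing_has_derivative[OF u _ W der \<Phi>]) auto
      show "continuous_on {0..T} (\<lambda>t. Re (time_integrand u \<Phi> t))" by (intro continuous_intros cont)
    qed (use \<open>0 < T\<close> in simp)
    also have "\<dots> = 0"
    proof -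
      have "\<Phi> (t, x) = 0" if "t = 0 \<or> t = T" for t x
        using \<Phi> that by (intro notin_supp) (auto simp: test_functions_def)
      then show ?thesis by (simp add: pairing_def)
    qed
    finally show ?thesis .
  qed
  have bl: "bounded_linear (\<lambda>z. \<i> * z)" by (rule bounded_linear_mult_right)
  have smooth: "smooth \<Phi>" "smooth (dir_deriv (0, b) \<Phi>)" if "b \<in> Basis" for b
    using \<Phi> that by (auto simp: test_functions_def intro: smooth_dir_deriv Basis_spacetime)
  have \<Phi>_smooth: "smooth \<Phi>" using \<Phi> by (simp add: test_functions_def)
  have d1: "dir_deriv v (\<lambda>z. \<i> * \<Phi> z) = (\<lambda>z. \<i> * dir_deriv v \<Phi> z)" for v
    by (rule ext) (rule dir_deriv_linear[OF bl \<Phi>_smooth])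
  have d2: "dir_deriv (0, b) (\<lambda>z. \<i> * dir_deriv (0, b) \<Phi> z) = (\<lambda>z. \<i> * dir_deriv (0, b) (dir_deriv (0, b) \<Phi>) z)"
    if "b \<in> Basis" for b
    by (rule ext) (rule dir_deriv_linear[OF bl smooth(2)[OF that]])
  have "time_integrand u (\<lambda>z. \<i> * \<Phi> z) = (\<lambda>t. \<i> * time_integrand u \<Phi> t)"
    unfolding time_integrand_def d1 by (simp add: d2 pairing_mult algebra_simps sum_distrib_left)
  then have "(LINT t:{0<..<T}|lborel. time_integrand u (\<lambda>z. \<i> * \<Phi> z) t) = \<i> * (LINT t:{0<..<T}|lborel. time_integrand u \<Phi> t)"
    by simp
  with Re0[OF \<Phi>] Re0[OF test_functions_linear[OF bl \<Phi>]] show ?thesis by (simp add: complex_eq_iff)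
qed

text \<open>Differences of elements of \<open>W\<close> are admissible, so the H^1 norm is dominated
  by the norm of \<open>W\<close> and continuity transfers. In the equation one time derivative
  changes the sign and two space derivatives do not; the expression to be annihilated is thus minus
  the time integral already shown to vanish.\<close>

lemma solves_heat_evolution:
  assumes u: "continuous_on {0..T} u" and "0 < T" and W: "\<And>t. u t \<in> W"
    and der: "\<And>t v. t \<in> {0..T} \<Longrightarrow> v \<in> W \<Longrightarrow>
      ((\<lambda>r. E (u r) \<bullet> v) has_real_derivative E (u t) \<bullet> v - u t \<bullet> v) (at t within {0..T})"
    and u\<^sub>0: "AE x in lborel. fst (rep_l2 (u 0) x) = u\<^sub>0 x"
  shows "solves_heat T (\<lambda>x. complex_of_real ((s x)\<^sup>2)) u\<^sub>0 (\<lambda>t x. fst (rep_l2 (u t) x))"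
  unfolding solves_heat_def
proof (intro conjI ballI u\<^sub>0)
  show "(\<lambda>t x. fst (rep_l2 (u t) x)) \<in> CH1_space T"
    unfolding CH1_space_def mem_Collect_eq
  proof (intro conjI ballI)
    show "(\<lambda>x. fst (rep_l2 (u t) x)) \<in> H1_space" for t
      using W[of t] by (intro admissible_energy(1)) (auto simp: W_iff)
    fix t assume t: "t \<in> {0..T}"
    have le: "norm (H1_norm (\<lambda>x. fst (rep_l2 (u r) x) - fst (rep_l2 (u t) x))) \<le> norm (u r - u t)" for r
    proof -
      let ?F = "\<lambda>x. rep_l2 (u r) x - rep_l2 (u t) x"
      have sq: "square_integrable ?F" by (intro square_integrable_diff square_integrable_rep)
      have F: "abs_l2 ?F = u r - u t" using abs_l2_diff[OF square_integrable_rep square_integrable_rep, of "u r" "u t"] by simp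
      have "abs_l2 ?F \<in> W" unfolding F using subspace_W W W by (rule subspace_diff)
      then have "H1_norm (\<lambda>x. fst (?F x)) \<le> norm (abs_l2 ?F)"
        using sq by (intro H1_norm_le) (simp_all add: abs_l2_in_W_iff)
      then show ?thesis using H1_norm_nonneg[of "\<lambda>x. fst (?F x)"] by (simp add: F)
    qed
    have "((\<lambda>r. norm (u r - u t)) \<longlongrightarrow> 0) (at t within {0..T})"
      using u t by (intro tendsto_norm_zero LIM_zero) (simp add: continuous_on_def)
    then show "((\<lambda>r. H1_norm (\<lambda>x. fst (rep_l2 (u r) x) - fst (rep_l2 (u t) x))) \<longlongrightarrow> 0) (at t within {0..T})"
      by (rule Lim_null_comparison[rotated]) (use le in simp)
  qed
  fix \<Phi> :: "real \<times> 'a \<Rightarrow> complex" assume \<Phi>: "\<Phi> \<in> test_functions ({0<..<T} \<times> UNIV)"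
  let ?D = "spacetime_distr T (\<lambda>t x. fst (rep_l2 (u t) x))"
  define p where "p m \<theta> t = pairing m (u t) (\<lambda>x. \<theta> (t, x))" for m and \<theta> :: "real \<times> 'a \<Rightarrow> complex" and t
  have D: "?D \<theta> = (LINT t:{0<..<T}|lborel. p (\<lambda>x. 1) \<theta> t)" for \<theta>
    by (simp add: spacetime_distr_def p_def pairing_def)
  have Dq: "spacetime_distr T (\<lambda>t x. complex_of_real ((s x)\<^sup>2) * fst (rep_l2 (u t) x)) \<Phi>
      = (LINT t:{0<..<T}|lborel. p (\<lambda>x. (s x)\<^sup>2) \<Phi> t)"
    by (simp add: spacetime_distr_def p_def pairing_def scaleR_conv_of_real mult.assoc)
  have set_int: "set_integrable lborel {0<..<T} f" if "continuous_on {0..T} f" for f :: "real \<Rightarrow> complex"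
    using borel_integrable_atLeastAtMost'[OF that] by (rule set_integrable_subset) auto
  have int1: "set_integrable lborel {0<..<T} (p (\<lambda>x. 1) \<theta>)" if "\<theta> \<in> test_functions ({0<..<T} \<times> UNIV)" for \<theta>
    unfolding p_def by (intro set_int bounded_multiplier.continuous_on_pairing[OF bounded_multiplier_1 u that])
  have int2: "set_integrable lborel {0<..<T} (p (\<lambda>x. (s x)\<^sup>2) \<Phi>)"
    unfolding p_def by (intro set_int bounded_multiplier.continuous_on_pairing[OF bounded_multiplier_s2 u \<Phi>])
  have int_b: "set_integrable lborel {0<..<T} (p (\<lambda>x. 1) (dir_deriv (0, b) (dir_deriv (0, b) \<Phi>)))" if "b \<in> Basis" for b
    by (intro int1 test_functions_dir_deriv \<Phi> Basis_spacetime that)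
  have "0 = (LINT t:{0<..<T}|lborel. time_integrand u \<Phi> t)"
    using integral_time_integrand_eq_0[OF u \<open>0 < T\<close> W der \<Phi>] by simp
  also have "\<dots> = (LINT t:{0<..<T}|lborel. p (\<lambda>x. 1) (dir_deriv (1, 0) \<Phi>) t
      + (\<Sum>b\<in>Basis. p (\<lambda>x. 1) (dir_deriv (0, b) (dir_deriv (0, b) \<Phi>)) t) - p (\<lambda>x. (s x)\<^sup>2) \<Phi> t)"
    unfolding time_integrand_def p_def ..
  also have "\<dots> = ?D (dir_deriv (1, 0) \<Phi>) + (\<Sum>b\<in>Basis. ?D (dir_deriv (0, b) (dir_deriv (0, b) \<Phi>)))
      - (LINT t:{0<..<T}|lborel. p (\<lambda>x. (s x)\<^sup>2) \<Phi> t)"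
    using int1[OF test_functions_dir_deriv[OF \<Phi> Basis_spacetime(1)]] int2 int_b
    unfolding D set_lebesgue_integral_def set_integrable_def
    by (simp only: scaleR_diff_right scaleR_add_right scaleR_sum_right
        Bochner_Integration.integral_diff Bochner_Integration.integral_add Bochner_Integration.integral_sum
        Bochner_Integration.integrable_add Bochner_Integration.integrable_sum)
  finally show "distr_deriv (1, 0) ?D \<Phi> - (\<Sum>b\<in>Basis. distr_deriv (0, b) (distr_deriv (0, b) ?D) \<Phi>)
      + spacetime_distr T (\<lambda>t x. complex_of_real ((s x)\<^sup>2) * fst (rep_l2 (u t) x)) \<Phi> = 0"
    unfolding Dq distr_deriv_def by (simp add: algebra_simps)
qed

end

section \<open>Solutions with a bound polynomial in the potential, and moderateness\<close>

text \<open>Along the evolution H^1 norm <= form norm <= initial form norm, and the potential energy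
  of the datum is at most Q times its squared L^2 norm. The constant depends neither on T nor on the
  regularity of \<open>q\<close>.\<close>

lemma heat_solution_exists:
  fixes q u\<^sub>0 :: "'a::euclidean_space \<Rightarrow> complex" and \<psi> :: "'a \<Rightarrow> real"
  assumes \<psi>: "friedrichs_mollifier \<psi>" and "0 < T"
    and q: "q \<in> borel_measurable borel" "\<And>x. q x \<in> \<real>\<^sub>\<ge>\<^sub>0" "AE x in lborel. norm (q x) \<le> Q" and "0 \<le> Q"
    and u\<^sub>0: "u\<^sub>0 \<in> H1_space"
  shows "\<exists>u. solves_heat T q u\<^sub>0 u \<and> CH1_norm T u \<le> (1 + Q) * H1_norm u\<^sub>0"
proof -
  define s where "s x = sqrt (Re (q x))" for x
  have q_nonneg: "0 \<le> Re (q x)" "Im (q x) = 0" for x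
    using q(2)[of x] by (auto simp: complex_nonneg_Reals_iff)
  have s2: "(s x)\<^sup>2 = Re (q x)" for x using q_nonneg[of x] by (simp add: s_def)
  have q_eq: "q = (\<lambda>x. complex_of_real ((s x)\<^sup>2))"
    using q_nonneg by (auto simp: s2 complex_eq_iff)
  interpret potential s "sqrt Q" \<psi>
  proof
    show "s \<in> borel_measurable borel" unfolding s_def[abs_def] using q(1) by measurable
    show "AE x in lborel. \<bar>s x\<bar> \<le> sqrt Q"
      using q(3) by (rule eventually_mono) (use complex_Re_le_cmod order_trans q_nonneg(1) in \<open>auto simp: s_def\<close>)
  qed fact
  define g where "g b = weak_deriv b u\<^sub>0" for b
  have u\<^sub>0_sq: "square_integrable u\<^sub>0" using u\<^sub>0 by (simp add: H1_space_def L2_space_iff)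
  have "g b \<in> L2_space \<and> is_weak_deriv b u\<^sub>0 (g b)" if "b \<in> Basis" for b
  proof -
    have "\<exists>h. h \<in> L2_space \<and> is_weak_deriv b u\<^sub>0 h" using u\<^sub>0 that by (auto simp: H1_space_def)
    then show ?thesis unfolding g_def weak_deriv_def by (rule someI_ex)
  qed
  then have g: "square_integrable (g b)" "is_weak_deriv b u\<^sub>0 (g b)" if "b \<in> Basis" for b
    using that by (auto simp: L2_space_iff)
  \<comment> \<open>The initial state assembled from the datum, its chosen weak gradient and its
    multiple by \<open>s\<close>; taking the datum in H^1 is what puts it into
    \<open>W\<close>.\<close>
  define F :: "'a \<Rightarrow> 'a state" where
    "F x = (u\<^sub>0 x, (\<Sum>b\<in>Basis. Re (g b x) *\<^sub>R b, \<Sum>b\<in>Basis. Im (g b x) *\<^sub>R b), s x *\<^sub>R u\<^sub>0 x)" for x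
  have "bounded_linear (\<lambda>z. Re z *\<^sub>R b)" "bounded_linear (\<lambda>z. Im z *\<^sub>R b)" for b :: 'a
    by (intro bounded_linear_scaleR_const bounded_linear_Re bounded_linear_Im)+
  then have "square_integrable (\<lambda>x. Re (g b x) *\<^sub>R b)" "square_integrable (\<lambda>x. Im (g b x) *\<^sub>R b)" if "b \<in> Basis" for b
    using square_integrable_linear[OF _ g(1)[OF that]] by blast+
  then have F_sq: "square_integrable F"
    unfolding F_def[abs_def]
    by (intro square_integrable_Pair square_integrable_sum
        square_integrable_bounded_scaleR[OF s_measurable s_bound] u\<^sub>0_sq finite_Basis)
  have F_adm: "admissible s F"
  proof -
    have "grad_component b (F x) = g b x" if "b \<in> Basis" for b x
      using that by (simp only: grad_component_def F_def fst_conv snd_conv inner_sum_left_Basis) simp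
    then show ?thesis using g(2) by (simp add: admissible_def F_def[abs_def])
  qed
  then have F_W: "abs_l2 F \<in> W" by (simp add: abs_l2_in_W_iff F_sq)
  obtain u where u: "continuous_on {0..T} u" "u 0 = abs_l2 F" "\<And>t. u t \<in> W"
    "\<And>t. t \<in> {0..T} \<Longrightarrow> norm (u t) \<le> norm (abs_l2 F)"
    "\<And>t v. t \<in> {0..T} \<Longrightarrow> v \<in> W \<Longrightarrow>
       ((\<lambda>r. E (u r) \<bullet> v) has_real_derivative E (u t) \<bullet> v - u t \<bullet> v) (at t within {0..T})"
  proof (rule constrained_evolution[OF subspace_W closed_W bounded_linear_E E_symmetric E_nonneg E_le _ F_W less_imp_le[OF \<open>0 < T\<close>]])
    show "U = 0" if "U \<in> W" "E U \<bullet> U = 0" for U using that by (rule E_injective)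
  qed (rule that)
  have "AE x in lborel. fst (rep_l2 (u 0) x) = u\<^sub>0 x"
    unfolding u(2) using rep_abs_l2[OF F_sq] by (rule eventually_mono) (simp add: F_def)
  from solves_heat_evolution[OF u(1) \<open>0 < T\<close> u(3) u(5) this]
  have "solves_heat T q u\<^sub>0 (\<lambda>t x. fst (rep_l2 (u t) x))" unfolding q_eq .
  moreover have "CH1_norm T (\<lambda>t x. fst (rep_l2 (u t) x)) \<le> (1 + Q) * H1_norm u\<^sub>0"
    unfolding CH1_norm_def
  proof (rule cSUP_least)
    show "{0..T} \<noteq> {}" using \<open>0 < T\<close> by simp
    fix t assume t: "t \<in> {0..T}"
    have "H1_norm (\<lambda>x. fst (rep_l2 (u t) x)) \<le> norm (u t)"
      using H1_norm_le[OF square_integrable_rep[of "u t"]] u(3)[of t] by (simp add: W_iff)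
    also have "\<dots> \<le> norm (abs_l2 F)" using u(4)[OF t] .
    also have "\<dots> \<le> (1 + Q) * H1_norm u\<^sub>0"
    proof (rule power2_le_imp_le)
      have "(LINT x|lborel. (norm (s x *\<^sub>R u\<^sub>0 x))\<^sup>2) \<le> (LINT x|lborel. Q * (norm (u\<^sub>0 x))\<^sup>2)"
      proof (rule integral_mono_AE)
        show "integrable lborel (\<lambda>x. (norm (s x *\<^sub>R u\<^sub>0 x))\<^sup>2)"
          using square_integrable_bounded_scaleR[OF s_measurable s_bound u\<^sub>0_sq] by (simp add: square_integrable_def)
        show "integrable lborel (\<lambda>x. Q * (norm (u\<^sub>0 x))\<^sup>2)"
          using u\<^sub>0_sq by (simp add: square_integrable_def)
        show "AE x in lborel. (norm (s x *\<^sub>R u\<^sub>0 x))\<^sup>2 \<le> Q * (norm (u\<^sub>0 x))\<^sup>2"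
          using q(3)
        proof (rule eventually_mono)
          fix x assume "norm (q x) \<le> Q"
          then have "(s x)\<^sup>2 \<le> Q" unfolding s2 using complex_Re_le_cmod order_trans by blast
          then show "(norm (s x *\<^sub>R u\<^sub>0 x))\<^sup>2 \<le> Q * (norm (u\<^sub>0 x))\<^sup>2"
            by (simp add: power_mult_distrib mult_right_mono)
        qed
      qed
      also have "\<dots> = Q * (L2_norm u\<^sub>0)\<^sup>2" by (simp add: L2_norm_power2)
      also have "\<dots> \<le> Q * (H1_norm u\<^sub>0)\<^sup>2"
        unfolding H1_norm_def using \<open>0 \<le> Q\<close>
        by (intro mult_left_mono) (auto simp: sum_nonneg)
      finally have "(norm (abs_l2 F))\<^sup>2 \<le> (1 + Q) * (H1_norm u\<^sub>0)\<^sup>2"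
        unfolding admissible_energy(2)[OF F_sq F_adm] by (simp add: F_def distrib_right)
      \<comment> \<open>The energy estimate yields the factor sqrt (1 + Q); since 1 + Q >= 1 it is
        replaced by 1 + Q, which keeps the bound polynomial.\<close>
      also have "\<dots> \<le> ((1 + Q) * H1_norm u\<^sub>0)\<^sup>2"
        unfolding power_mult_distrib using \<open>0 \<le> Q\<close>
        by (intro mult_right_mono) (simp_all add: power2_eq_square)
      finally show "(norm (abs_l2 F))\<^sup>2 \<le> ((1 + Q) * H1_norm u\<^sub>0)\<^sup>2" .
      show "0 \<le> (1 + Q) * H1_norm u\<^sub>0" using \<open>0 \<le> Q\<close> by (simp add: H1_norm_nonneg)
    qed
    finally show "H1_norm (\<lambda>x. fst (rep_l2 (u t) x)) \<le> (1 + Q) * H1_norm u\<^sub>0" .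
  qed
  ultimately show ?thesis by blast
qed

lemma Linf_norm_bound:
  assumes "f \<in> Linf_space"
  shows "AE x in lborel. norm (f x) \<le> Linf_norm f"
proof -
  let ?e = "esssup lborel (\<lambda>x. ereal (norm (f x)))"
  have "?e < \<infinity>" using assms by (simp add: Linf_space_def)
  moreover have "AE x in lborel. ereal (norm (f x)) \<le> ?e" by (rule esssup_AE)
  ultimately show ?thesis unfolding Linf_norm_def by (cases ?e) auto
qed

theorem theorem2p4:
  fixes T :: real
    and q u\<^sub>0 :: "('a::euclidean_space \<Rightarrow> complex) \<Rightarrow> complex"
    and \<psi> :: "'a \<Rightarrow> real" and \<omega> :: "real \<Rightarrow> real"
    and q\<^sub>\<epsilon> u\<^sub>0\<^sub>\<epsilon> :: "real \<Rightarrow> 'a \<Rightarrow> complex"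
  assumes "0 < T"
    and "distribution q" and "distribution u\<^sub>0"
    and "friedrichs_mollifier \<psi>" and "regularising_scale \<omega>"
    and "bdd_above (\<omega> ` {0<..1})"
    and "is_regularisation \<psi> \<omega> q q\<^sub>\<epsilon>" and "is_regularisation \<psi> \<omega> u\<^sub>0 u\<^sub>0\<^sub>\<epsilon>"
    and "\<forall>\<epsilon>\<in>{0<..1}. \<forall>x. q\<^sub>\<epsilon> \<epsilon> x \<in> \<real>\<^sub>\<ge>\<^sub>0"
    and "\<exists>(N::nat) (N\<^sub>0::nat) C C\<^sub>0. 0 < C \<and> 0 < C\<^sub>0 \<and> (\<forall>\<epsilon>\<in>{0<..1}.
           u\<^sub>0\<^sub>\<epsilon> \<epsilon> \<in> H1_space \<and> H1_norm (u\<^sub>0\<^sub>\<epsilon> \<epsilon>) \<le> C\<^sub>0 / \<omega> \<epsilon> ^ N\<^sub>0 \<and>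
           q\<^sub>\<epsilon> \<epsilon> \<in> Linf_space \<and> Linf_norm (q\<^sub>\<epsilon> \<epsilon>) \<le> C / \<omega> \<epsilon> ^ N)"
  shows "\<exists>u. very_weak_solution \<psi> \<omega> T q u\<^sub>0 u"
proof -
  obtain N N\<^sub>0 :: nat and C C\<^sub>0 where "0 < C" "0 < C\<^sub>0" and bounds: "\<And>\<epsilon>. \<epsilon> \<in> {0<..1} \<Longrightarrow>
      u\<^sub>0\<^sub>\<epsilon> \<epsilon> \<in> H1_space \<and> H1_norm (u\<^sub>0\<^sub>\<epsilon> \<epsilon>) \<le> C\<^sub>0 / \<omega> \<epsilon> ^ N\<^sub>0 \<and>
      q\<^sub>\<epsilon> \<epsilon> \<in> Linf_space \<and> Linf_norm (q\<^sub>\<epsilon> \<epsilon>) \<le> C / \<omega> \<epsilon> ^ N"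
    using assms(10) by blast
  have \<omega>_pos: "0 < \<omega> \<epsilon>" if "\<epsilon> \<in> {0<..1}" for \<epsilon>
    using assms(5) that by (simp add: regularising_scale_def)
  \<comment> \<open>An upper bound of \<open>\<omega>\<close> on (0,1] gives 1 <= (A /
    \<open>\<omega>\<close>)^N. This absorbs the summand 1 of 1 + C / \<open>\<omega>\<close>^N into
    one negative power, so that the product with the bound on the initial datum has exponent N +
    N0.\<close>
  obtain A where A: "\<And>\<epsilon>. \<epsilon> \<in> {0<..1} \<Longrightarrow> \<omega> \<epsilon> \<le> A"
    using assms(6) unfolding bdd_above_def by blast
  have "\<forall>\<epsilon>\<in>{0<..1}. \<exists>u. solves_heat T (q\<^sub>\<epsilon> \<epsilon>) (u\<^sub>0\<^sub>\<epsilon> \<epsilon>) u \<and>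
      CH1_norm T u \<le> (1 + C / \<omega> \<epsilon> ^ N) * H1_norm (u\<^sub>0\<^sub>\<epsilon> \<epsilon>)"
  proof
    fix \<epsilon> :: real assume \<epsilon>: "\<epsilon> \<in> {0<..1}"
    show "\<exists>u. solves_heat T (q\<^sub>\<epsilon> \<epsilon>) (u\<^sub>0\<^sub>\<epsilon> \<epsilon>) u \<and> CH1_norm T u \<le> (1 + C / \<omega> \<epsilon> ^ N) * H1_norm (u\<^sub>0\<^sub>\<epsilon> \<epsilon>)"
    proof (rule heat_solution_exists[OF assms(4,1)])
      show "q\<^sub>\<epsilon> \<epsilon> \<in> borel_measurable borel" using bounds[OF \<epsilon>] by (simp add: Linf_space_def)
      show "q\<^sub>\<epsilon> \<epsilon> x \<in> \<real>\<^sub>\<ge>\<^sub>0" for x using assms(9) \<epsilon> by blast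
      have "AE x in lborel. norm (q\<^sub>\<epsilon> \<epsilon> x) \<le> Linf_norm (q\<^sub>\<epsilon> \<epsilon>)"
        using bounds[OF \<epsilon>] by (intro Linf_norm_bound) simp
      then show "AE x in lborel. norm (q\<^sub>\<epsilon> \<epsilon> x) \<le> C / \<omega> \<epsilon> ^ N"
        by (rule eventually_mono) (use bounds[OF \<epsilon>] in linarith)
      show "0 \<le> C / \<omega> \<epsilon> ^ N" using \<open>0 < C\<close> \<omega>_pos[OF \<epsilon>] by simp
      show "u\<^sub>0\<^sub>\<epsilon> \<epsilon> \<in> H1_space" using bounds[OF \<epsilon>] by simp
    qed
  qed
  then obtain u where u: "\<And>\<epsilon>. \<epsilon> \<in> {0<..1} \<Longrightarrow> solves_heat T (q\<^sub>\<epsilon> \<epsilon>) (u\<^sub>0\<^sub>\<epsilon> \<epsilon>) (u \<epsilon>)"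
    "\<And>\<epsilon>. \<epsilon> \<in> {0<..1} \<Longrightarrow> CH1_norm T (u \<epsilon>) \<le> (1 + C / \<omega> \<epsilon> ^ N) * H1_norm (u\<^sub>0\<^sub>\<epsilon> \<epsilon>)"
    by (metis bchoice)
  have u_bound: "CH1_norm T (u \<epsilon>) \<le> (A ^ N + C) * C\<^sub>0 / \<omega> \<epsilon> ^ (N + N\<^sub>0)" if \<epsilon>: "\<epsilon> \<in> {0<..1}" for \<epsilon>
  proof -
    have "1 \<le> A ^ N / \<omega> \<epsilon> ^ N"
      using power_mono[OF A[OF \<epsilon>], of N] \<omega>_pos[OF \<epsilon>] by simp
    then have "1 + C / \<omega> \<epsilon> ^ N \<le> (A ^ N + C) / \<omega> \<epsilon> ^ N" by (simp add: add_divide_distrib)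
    moreover have "0 \<le> 1 + C / \<omega> \<epsilon> ^ N" using \<open>0 < C\<close> \<omega>_pos[OF \<epsilon>] by (intro add_nonneg_nonneg) auto
    ultimately have "(1 + C / \<omega> \<epsilon> ^ N) * H1_norm (u\<^sub>0\<^sub>\<epsilon> \<epsilon>) \<le> ((A ^ N + C) / \<omega> \<epsilon> ^ N) * (C\<^sub>0 / \<omega> \<epsilon> ^ N\<^sub>0)"
      using bounds[OF \<epsilon>] H1_norm_nonneg[of "u\<^sub>0\<^sub>\<epsilon> \<epsilon>"] by (intro mult_mono) auto
    with u(2)[OF \<epsilon>] show ?thesis by (simp add: power_add)
  qed
  \<comment> \<open>Moderateness asks for a positive constant. Evaluating at epsilon = 1 shows that
    \<open>A\<close> is at least a value of \<open>\<omega>\<close>, hence positive.\<close>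
  have "0 < (A ^ N + C) * C\<^sub>0"
    using A[of 1] \<omega>_pos[of 1] \<open>0 < C\<close> \<open>0 < C\<^sub>0\<close> by (intro mult_pos_pos add_nonneg_pos zero_le_power) auto
  moreover have "u \<epsilon> \<in> CH1_space T" if "\<epsilon> \<in> {0<..1}" for \<epsilon>
    using u(1)[OF that] unfolding solves_heat_def by blast
  ultimately have "moderate (CH1_space T) (CH1_norm T) \<omega> u"
    unfolding moderate_def using u_bound by blast
  moreover have "moderate Linf_space Linf_norm \<omega> q\<^sub>\<epsilon>" "moderate H1_space H1_norm \<omega> u\<^sub>0\<^sub>\<epsilon>"
    unfolding moderate_def using bounds \<open>0 < C\<close> \<open>0 < C\<^sub>0\<close> by blast+
  ultimately have "very_weak_solution \<psi> \<omega> T q u\<^sub>0 u"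
    unfolding very_weak_solution_def using assms(7-9) u(1) by blast
  then show ?thesis by blast
qed

end
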